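(* Let $D$ be a $5\times 5$ diagonal matrix with positive diagonal entries. Then, for all $\psi\in\Psi$, $$D\cdot T(\psi)\cdot D\in\bigcup_{r\ge 0}\mathrm{LAS}^{(r)}_{\Delta_5}\subseteq\bigcup_{r\ge 0}\mathcal K^{(r)}_5 .$$
   Context: $\mathcal S^n$ is the set of real symmetric $n\times n$ matrices. $\Sigma$ denotes the cone of sums of squares of polynomials in $\mathbb R[x]=\mathbb R[x_1,\dots,x_n]$; $\Sigma_k$ is the set of elements of $\Sigma$ of degree at most $k$ (with $\Sigma_k=\{0\}$ if $k<0$). $I_\Delta$ is the ideal of $\mathbb R[x]$ generated by $\sum_{i=1}^n x_i-1$, and $x^{\circ 2}=(x_1^2,\dots,x_n^2)$. For integers $r\ge 0$, $$\mathrm{LAS}^{(r)}_{\Delta_n}=\Big\{M\in\mathcal S^n: x^TMx=\sigma_0+\sum_{i=1}^n\sigma_ix_i+q\ \text{ for some }\sigma_0\in\Sigma_r,\ \sigma_i\in\Sigma_{r-1},\ q\in I_\Delta\Big\},$$ $$\mathcal K^{(r)}_n=\Big\{M\in\mathcal S^n:\Big(\sum_{i=1}^n x_i^2\Big)^r (x^{\circ 2})^TMx^{\circ 2}\in\Sigma\Big\}.$$ The parameter set is $\Psi=\{\psi\in\mathbb R^5:\sum_{i=1}^5\psi_i<\pi,\ \psi_i>0\text{ for }i=1,\dots,5\}$, and $$T(\psi)=\begin{pmatrix} 1 & -\cos \psi_4 & \cos(\psi_4+\psi_5) & \cos(\psi_2+\psi_3) & -\cos\psi_3 \\ -\cos \psi_4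 & 1 & -\cos\psi_5 & \cos(\psi_5+\psi_1) & \cos(\psi_3+\psi_4) \\ \cos(\psi_4+\psi_5) & -\cos\psi_5 & 1 & -\cos\psi_1 & \cos(\psi_1+\psi_2) \\ \cos(\psi_2+\psi_3) & \cos(\psi_5+\psi_1) & -\cos\psi_1 & 1 & -\cos\psi_2 \\ -\cos\psi_3 & \cos(\psi_3+\psi_4) & \cos(\psi_1+\psi_2) & -\cos\psi_2 & 1 \end{pmatrix}.$$ *)

theory Defs
  imports "HOL-Analysis.Analysis" "HOL-Library.Poly_Mapping"
begin

text \<open>The ring \<open>\<real>[x\<^sub>i : i \<in> 'n]\<close> in \<open>n = CARD('n)\<close> variables: a polynomial is the finitely supported
  map sending an exponent vector \<open>'n \<Rightarrow>\<^sub>0 nat\<close> to its coefficient. Addition and (convolution)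
  multiplication are those of the \<open>comm_ring_1\<close> instance of \<open>poly_mapping\<close>.\<close>

type_synonym 'n rpoly = "('n \<Rightarrow>\<^sub>0 nat) \<Rightarrow>\<^sub>0 real"

definition Var :: "'n \<Rightarrow> 'n rpoly" where
  "Var i = Poly_Mapping.single (Poly_Mapping.single i 1) 1"

definition Const :: "real \<Rightarrow> 'n rpoly" where
  "Const c = Poly_Mapping.single 0 c"

text \<open>The total degree is a natural number, with the harmless convention that the zero polynomial
  has degree \<open>0\<close>: it only occurs in \<open>SOS_deg\<close>, where a negative bound is treated separately.\<close>

definition total_degree :: "'n::finite rpoly \<Rightarrow> nat" where
  "total_degree p =
     Max (insert 0 ((\<lambda>m. \<Sum>i\<in>UNIV. Poly_Mapping.lookup m i) ` Poly_Mapping.keys p))"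

definition SOS :: "'n rpoly set" where
  "SOS = {p. \<exists>(m::nat) (g :: nat \<Rightarrow> 'n rpoly). p = (\<Sum>k<m. (g k)\<^sup>2)}"

definition SOS_deg :: "int \<Rightarrow> 'n::finite rpoly set" where
  "SOS_deg k = (if k < 0 then {0} else {p \<in> SOS. int (total_degree p) \<le> k})"

definition ideal_simplex :: "'n::finite rpoly set" where
  "ideal_simplex = {p * ((\<Sum>i\<in>UNIV. Var i) - 1) | p. True}"

definition quad_form :: "real^'n^'n \<Rightarrow> ('n \<Rightarrow> 'n rpoly) \<Rightarrow> 'n::finite rpoly" where
  "quad_form M y = (\<Sum>i\<in>UNIV. \<Sum>j\<in>UNIV. y i * Const (M $ i $ j) * y j)"

definition sym_matrices :: "(real^'n^'n) set" where
  "sym_matrices = {M. transpose M = M}"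

definition LAS :: "nat \<Rightarrow> (real^'n^'n::finite) set" where
  "LAS r = {M \<in> sym_matrices. \<exists>\<sigma>\<^sub>0 \<sigma> q.
     \<sigma>\<^sub>0 \<in> SOS_deg (int r) \<and> (\<forall>i. \<sigma> i \<in> SOS_deg (int r - 1)) \<and> q \<in> ideal_simplex \<and>
     quad_form M Var = \<sigma>\<^sub>0 + (\<Sum>i\<in>UNIV. \<sigma> i * Var i) + q}"

definition K_cone :: "nat \<Rightarrow> (real^'n^'n::finite) set" where
  "K_cone r = {M \<in> sym_matrices.
     (\<Sum>i\<in>UNIV. (Var i)\<^sup>2) ^ r * quad_form M (\<lambda>i. (Var i)\<^sup>2) \<in> SOS}"

text \<open>Coordinates of \<open>\<real>\<^sup>5\<close> are indexed by the elements \<open>1, 2, 3, 4, 5\<close> of the five-element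
  type \<open>5\<close>; there \<open>5 = 0\<close>, and \<open>vector\<close> lists the coordinates in the order \<open>1, 2, 3, 4, 5\<close>.\<close>

lemma vector_5:
  fixes a b c d e :: "'a::zero"
  shows "(vector [a, b, c, d, e] :: 'a^5) $ 1 = a"
    "(vector [a, b, c, d, e] :: 'a^5) $ 2 = b"
    "(vector [a, b, c, d, e] :: 'a^5) $ 3 = c"
    "(vector [a, b, c, d, e] :: 'a^5) $ 4 = d"
    "(vector [a, b, c, d, e] :: 'a^5) $ 5 = e"
  by (simp_all add: vector_def)

definition Psi :: "(real^5) set" where
  "Psi = {\<psi>. (\<Sum>i\<in>UNIV. \<psi> $ i) < pi \<and> (\<forall>i. \<psi> $ i > 0)}"

definition T :: "real^5 \<Rightarrow> real^5^5" where
  "T \<psi> = vector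
    [vector [1, - cos (\<psi>$4), cos (\<psi>$4 + \<psi>$5), cos (\<psi>$2 + \<psi>$3), - cos (\<psi>$3)],
     vector [- cos (\<psi>$4), 1, - cos (\<psi>$5), cos (\<psi>$5 + \<psi>$1), cos (\<psi>$3 + \<psi>$4)],
     vector [cos (\<psi>$4 + \<psi>$5), - cos (\<psi>$5), 1, - cos (\<psi>$1), cos (\<psi>$1 + \<psi>$2)],
     vector [cos (\<psi>$2 + \<psi>$3), cos (\<psi>$5 + \<psi>$1), - cos (\<psi>$1), 1, - cos (\<psi>$2)],
     vector [- cos (\<psi>$3), cos (\<psi>$3 + \<psi>$4), cos (\<psi>$1 + \<psi>$2), - cos (\<psi>$2), 1]]"

end

theory Submission
  imports Defs
begin

text \<open>Let \<open>Q\<close> be the quadratic module generated by the coordinates on the hyperplane \<open>\<Sum>i. x $ i = 1\<close>.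
  Calling a polynomial \<open>F\<close> bounded by \<open>r\<close> if \<open>r - F\<close> and \<open>r + F\<close> are in \<open>Q\<close> gives a submultiplicative
  seminorm. Elements of \<open>Q\<close> are approximated by squares in it, so the closure of \<open>Q\<close> is closed under
  products, and a Bernstein-type approximation shows that the closure contains every polynomial that is
  nonnegative on the simplex.

  For \<open>f = x\<^sup>T D T(\<psi>) D x\<close> no \<open>\<epsilon>\<close> may be lost. The five zeros of \<open>f\<close> on the simplex satisfy
  Marshall's boundary Hessian condition. If \<open>w\<^sub>k\<close> is the squared distance from the \<open>k\<close>-th zero in suitable
  coordinates, a peak function at that zero reduces \<open>f + \<epsilon> w\<^sub>k \<in> Q\<close> to a local statement. Multiplying
  up over the zeros gives \<open>f + \<epsilon> (\<Prod>k. w\<^sub>k) \<in> Q\<close> for all \<open>\<epsilon> > 0\<close>, and since \<open>f - \<delta> (\<Prod>k. w\<^sub>k)\<close>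
  satisfies the same hypotheses for small \<open>\<delta>\<close>, the error term can be absorbed.

  The zeros and their nondegeneracy are read off from five decompositions of \<open>f\<close>, one for each
  rotation of the indices, as a sum of two squares plus three products of coordinates.\<close>

section \<open>The quadratic module of the simplex\<close>

text \<open>Membership in \<open>LAS\<close> is an exact identity, while closure arguments only give
  f + e in Q for each e > 0; since f has zeros on the simplex, a theorem for strictly positive
  polynomials does not apply. The remedy is an error term adapted to the zeros. Near its zero, f
  dominates a small multiple of w_k inside the simplex: quadratically in the directions along the
  face, linearly in those leading off it. The product of all w_k, unlike their sum, vanishes at
  every zero, so a small multiple of it can be subtracted from f beforehand without losing
  nonnegativity and is then given back exactly. Everything is done with functions on the hyperplane,
  so that reduction modulo the ideal becomes agreement of values; the return to formal polynomials
  is a separate step. The diagonal scaling amounts to the substitution y_i = d_i x_i and only moves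
  the zeros, each of which is supported on three cyclically consecutive indices.\<close>

type_synonym 'n rfun = "real^'n \<Rightarrow> real"

definition hyperplane1 :: "(real^'n::finite) set" where
  "hyperplane1 = {x. (\<Sum>i\<in>UNIV. x $ i) = 1}"

definition std_simplex :: "(real^'n::finite) set" where
  "std_simplex = {x \<in> hyperplane1. \<forall>i. 0 \<le> x $ i}"

text \<open>Rule \<open>cong\<close> plays the role of reduction modulo the ideal: membership
  depends only on values on the hyperplane. Members may be arbitrary elsewhere, which is why
  polynomiality appears as a separate premise later.\<close>

inductive_set QM :: "('n::finite) rfun set" where
  square: "real_polynomial_function p \<Longrightarrow> (\<lambda>x. (p x)\<^sup>2) \<in> QM"
| square_coord: "real_polynomial_function p \<Longrightarrow> (\<lambda>x. (p x)\<^sup>2 * x $ i) \<in> QM"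
| add: "F \<in> QM \<Longrightarrow> G \<in> QM \<Longrightarrow> (\<lambda>x. F x + G x) \<in> QM"
| cong: "F \<in> QM \<Longrightarrow> (\<And>x. x \<in> hyperplane1 \<Longrightarrow> F x = G x) \<Longrightarrow> G \<in> QM"

lemma poly_coord [intro]: "real_polynomial_function (\<lambda>x::real^'n::finite. x $ i)"
  by (rule real_polynomial_function.intros(1)) (rule bounded_linear_vec_nth)

lemma QM_square_mult: "F \<in> QM \<Longrightarrow> real_polynomial_function p \<Longrightarrow> (\<lambda>x. (p x)\<^sup>2 * F x) \<in> QM"
proof (induction rule: QM.induct)
  case (square q)
  then show ?case using QM.square[of "\<lambda>x. p x * q x"]
    by (simp add: power_mult_distrib real_polynomial_function.intros(4))
next
  case (square_coord q i)
  then show ?case using QM.square_coord[of "\<lambda>x. p x * q x" i]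
    by (simp add: power_mult_distrib real_polynomial_function.intros(4) mult.assoc)
next
  case (add F G)
  then have "(\<lambda>x. (p x)\<^sup>2 * F x + (p x)\<^sup>2 * G x) \<in> QM" by (intro QM.add) auto
  then show ?case by (simp add: distrib_left)
next
  case (cong F G)
  show ?case by (rule QM.cong[of "\<lambda>x. (p x)\<^sup>2 * F x"]) (use cong in auto)
qed

lemma QM_cmult: "F \<in> QM \<Longrightarrow> 0 \<le> c \<Longrightarrow> (\<lambda>x. c * F x) \<in> QM"
  using QM_square_mult[of F "\<lambda>x. sqrt c"] by auto

lemma QM_const: "0 \<le> c \<Longrightarrow> (\<lambda>x. c) \<in> QM"
  using QM.square[of "\<lambda>x. sqrt c"] by auto

lemma QM_coord: "(\<lambda>x. x $ i) \<in> QM"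
  using QM.square_coord[of "\<lambda>x. 1" i] by auto

lemma QM_sum: "finite A \<Longrightarrow> (\<And>a. a \<in> A \<Longrightarrow> F a \<in> QM) \<Longrightarrow> (\<lambda>x. \<Sum>a\<in>A. F a x) \<in> QM"
proof (induction A rule: finite_induct)
  case empty then show ?case using QM_const[of 0] by simp
next
  case (insert a A) then show ?case using QM.add[of "F a" "\<lambda>x. \<Sum>a\<in>A. F a x"] by simp
qed

text \<open>On the hyperplane 1 - x_i is the sum of the other coordinates. This is the source of all
  boundedness: it makes the module Archimedean.\<close>

lemma QM_coord_le_one: "(\<lambda>x. 1 - x $ i) \<in> QM"
proof (rule QM.cong)
  show "(\<lambda>x. \<Sum>j\<in>UNIV-{i}. x $ j) \<in> QM"
    by (rule QM_sum) (auto intro: QM_coord)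
  show "(\<Sum>j\<in>UNIV-{i}. x $ j) = 1 - x $ i" if "x \<in> hyperplane1" for x
    using that by (simp add: hyperplane1_def sum_diff1)
qed

section \<open>The Archimedean seminorm\<close>

definition QM_bound :: "real \<Rightarrow> ('n::finite) rfun \<Rightarrow> bool" where
  "QM_bound r F \<longleftrightarrow> (\<lambda>x. r - F x) \<in> QM \<and> (\<lambda>x. r + F x) \<in> QM"

lemma QM_bound_mono: "QM_bound r F \<Longrightarrow> r \<le> s \<Longrightarrow> QM_bound s F"
proof -
  assume a: "QM_bound r F" "r \<le> s"
  have "0 \<le> s - r" using a by simp
  from QM.add[OF QM_const[OF this], of "\<lambda>x. r - F x"] QM.add[OF QM_const[OF this], of "\<lambda>x. r + F x"]
  show ?thesis using a by (simp add: QM_bound_def)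
qed

lemma QM_bound_add: "QM_bound r F \<Longrightarrow> QM_bound s G \<Longrightarrow> QM_bound (r + s) (\<lambda>x. F x + G x)"
  unfolding QM_bound_def
  using QM.add[of "\<lambda>x. r - F x" "\<lambda>x. s - G x"] QM.add[of "\<lambda>x. r + F x" "\<lambda>x. s + G x"]
  by (simp add: algebra_simps)

lemma QM_bound_minus: "QM_bound r F \<Longrightarrow> QM_bound r (\<lambda>x. - F x)"
  by (simp add: QM_bound_def)

lemma QM_bound_cmult:
  assumes "QM_bound r F" shows "QM_bound (\<bar>c\<bar> * r) (\<lambda>x. c * F x)"
proof -
  have "QM_bound (\<bar>c\<bar> * r) (\<lambda>x. \<bar>c\<bar> * F x)"
    unfolding QM_bound_def
    using QM_cmult[of "\<lambda>x. r - F x" "\<bar>c\<bar>"] QM_cmult[of "\<lambda>x. r + F x" "\<bar>c\<bar>"] assms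
    by (simp add: QM_bound_def algebra_simps)
  then show ?thesis
    using QM_bound_minus[of "\<bar>c\<bar> * r" "\<lambda>x. \<bar>c\<bar> * F x"] by (cases "c \<ge> 0") auto
qed

text \<open>Only multiplication by squares is available, so (1 - F)(1 + F) cannot be formed
  directly; the average of (1 + F)^2 (1 - F) and (1 - F)^2 (1 + F) replaces it.\<close>

lemma QM_bound_one_square:
  assumes p: "real_polynomial_function F" and F: "QM_bound 1 F"
  shows "(\<lambda>x. 1 - (F x)\<^sup>2) \<in> QM"
proof -
  have "(\<lambda>x. (1 + F x)\<^sup>2 * (1 - F x)) \<in> QM" "(\<lambda>x. (1 - F x)\<^sup>2 * (1 + F x)) \<in> QM"
    using F p by (auto intro!: QM_square_mult simp: QM_bound_def)
  then have "(\<lambda>x. (1/2) * ((1 + F x)\<^sup>2 * (1 - F x) + (1 - F x)\<^sup>2 * (1 + F x))) \<in> QM"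
    by (intro QM_cmult QM.add) auto
  then show ?thesis
    by (rule QM.cong) (simp add: power2_eq_square algebra_simps)
qed

text \<open>Polarisation: 1 - F H = (1 - ((F + H)/2)^2) + ((F - H)/2)^2. Taking H = G and H = -G
  gives both bounds.\<close>

lemma QM_bound_one_mult:
  assumes pF: "real_polynomial_function F" and F: "QM_bound 1 F"
    and pG: "real_polynomial_function G" and G: "QM_bound 1 G"
  shows "QM_bound 1 (\<lambda>x. F x * G x)"
proof -
  have *: "(\<lambda>x. 1 - F x * H x) \<in> QM" if H: "QM_bound 1 H" "real_polynomial_function H" for H
  proof -
    have "QM_bound 2 (\<lambda>x. F x + H x)" using QM_bound_add[OF F H(1)] by simp
    from QM_bound_cmult[OF this, of "1/2"] have "QM_bound 1 (\<lambda>x. (F x + H x) / 2)" by simp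
    then have 1: "(\<lambda>x. 1 - ((F x + H x) / 2)\<^sup>2) \<in> QM"
      using pF H by (intro QM_bound_one_square) auto
    have 2: "(\<lambda>x. ((F x - H x) / 2)\<^sup>2) \<in> QM" using pF H by (intro QM.square) auto
    show ?thesis
      by (rule QM.cong[OF QM.add[OF 1 2]]) (simp add: power2_eq_square field_simps)
  qed
  from *[OF G pG] *[OF QM_bound_minus[OF G]] pG show ?thesis
    by (auto simp: QM_bound_def)
qed

lemma QM_bound_mult:
  assumes pF: "real_polynomial_function F" and F: "QM_bound r F" and r: "0 < r"
    and pG: "real_polynomial_function G" and G: "QM_bound s G" and s: "0 < s"
  shows "QM_bound (r * s) (\<lambda>x. F x * G x)"
proof -
  have 1: "QM_bound 1 (\<lambda>x. (1/r) * F x)" "QM_bound 1 (\<lambda>x. (1/s) * G x)"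
    using QM_bound_cmult[OF F, of "1/r"] QM_bound_cmult[OF G, of "1/s"] r s by auto
  have "QM_bound 1 (\<lambda>x. ((1/r) * F x) * ((1/s) * G x))"
    using pF pG by (intro QM_bound_one_mult 1) auto
  from QM_bound_cmult[OF this, of "r * s"] show ?thesis using r s by simp
qed

lemma QM_bound_exists:
  assumes "real_polynomial_function (F :: 'n::finite rfun)"
  shows "\<exists>r>0. QM_bound r F"
  using assms
proof (induction rule: real_polynomial_function.induct)
  case (const c)
  have "QM_bound (\<bar>c\<bar>+1) (\<lambda>x. c)" by (auto simp: QM_bound_def intro!: QM_const)
  then show ?case by (intro exI[of _ "\<bar>c\<bar>+1"]) auto
next
  case (add f g)
  then obtain r s where "0 < r" "QM_bound r f" "0 < s" "QM_bound s g" by blast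
  then show ?case using QM_bound_add[of r f s g] add_pos_pos[of r s] by blast
next
  case (mult f g)
  then obtain r s where "0 < r" "QM_bound r f" "0 < s" "QM_bound s g" by blast
  then show ?case using QM_bound_mult[of f r g s] mult.hyps mult_pos_pos[of r s] by blast
next
  case (linear f)
  then interpret bounded_linear f .
  have c: "QM_bound 1 (\<lambda>x. x $ i)" for i :: 'n
    using QM_coord_le_one[of i] QM.add[OF QM_const[of 1] QM_coord[of i]] by (simp add: QM_bound_def)
  have "QM_bound (\<Sum>i\<in>A. \<bar>f (axis i 1)\<bar>) (\<lambda>x. \<Sum>i\<in>A. f (axis i 1) * x $ i)" for A :: "'n set"
  proof (induction A rule: infinite_finite_induct)
    case (insert a A)
    then show ?case
      using QM_bound_add[OF QM_bound_cmult[OF c, of "f (axis a 1)" a] insert.IH] by simp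
  qed (auto simp: QM_bound_def intro!: QM_const)
  moreover have "f x = (\<Sum>i\<in>UNIV. f (axis i 1) * x $ i)" for x
  proof -
    have "(\<Sum>i\<in>UNIV. x $ i *\<^sub>R axis i 1) = x"
      using basis_expansion[of x] by (simp only: scalar_mult_eq_scaleR)
    then have "f x = f (\<Sum>i\<in>UNIV. x $ i *\<^sub>R axis i 1)" by simp
    also have "\<dots> = (\<Sum>i\<in>UNIV. f (axis i 1) * x $ i)" by (simp add: sum scale mult.commute)
    finally show ?thesis .
  qed
  then have "f = (\<lambda>x. \<Sum>i\<in>UNIV. f (axis i 1) * x $ i)" by (rule ext)
  ultimately have "QM_bound (\<Sum>i\<in>UNIV. \<bar>f (axis i 1)\<bar>) f" by metis
  from QM_bound_mono[OF this, of "(\<Sum>i\<in>UNIV. \<bar>f (axis i 1)\<bar>) + 1"] show ?case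
    by (intro exI[of _ "(\<Sum>i\<in>UNIV. \<bar>f (axis i 1)\<bar>) + 1"]) (auto intro!: add_nonneg_pos sum_nonneg)
qed

section \<open>Square roots and products\<close>

lemma QM_nonneg: "F \<in> QM \<Longrightarrow> x \<in> std_simplex \<Longrightarrow> 0 \<le> F x"
  by (induction arbitrary: x rule: QM.induct) (auto simp: std_simplex_def)

text \<open>A fixed point q of the step satisfies (1 - q)^2 = 1 - u. The domain is generic so that
  the same recursion on a one-point type yields the numerical majorant
  \<open>sqrt_seq\<close>.\<close>

primrec sqrt_iter :: "('a \<Rightarrow> real) \<Rightarrow> nat \<Rightarrow> 'a \<Rightarrow> real" where
  "sqrt_iter u 0 = (\<lambda>x. u x / 2)"
| "sqrt_iter u (Suc k) = (\<lambda>x. (u x + (sqrt_iter u k x)\<^sup>2) / 2)"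

declare sqrt_iter.simps(2) [simp del]

definition sqrt_seq :: "nat \<Rightarrow> real" where
  "sqrt_seq k = sqrt_iter (\<lambda>_. 1) k ()"

text \<open>The iteration at u = 1 increases and stays below 1, hence converges; its increments
  become the error radii of \<open>sqrt_iter_bound\<close>.\<close>

lemma sqrt_seq_props:
  shows "0 < sqrt_seq k" "sqrt_seq k < 1" "sqrt_seq k < sqrt_seq (Suc k)" "(\<lambda>k. sqrt_seq (Suc k) - sqrt_seq k) \<longlonglongrightarrow> 0"
proof -
  have rec: "sqrt_seq (Suc k) = (1 + (sqrt_seq k)\<^sup>2) / 2" for k by (simp add: sqrt_seq_def sqrt_iter.simps)
  have bd: "0 < sqrt_seq k \<and> sqrt_seq k < 1" for k
  proof (induction k)
    case 0 then show ?case by (simp add: sqrt_seq_def)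
  next
    case (Suc k)
    then have "(sqrt_seq k)\<^sup>2 < 1" by (simp add: power_less_one_iff)
    then show ?case by (simp add: rec add_pos_nonneg)
  qed
  then show "0 < sqrt_seq k" "sqrt_seq k < 1" by auto
  have inc: "sqrt_seq k < sqrt_seq (Suc k)" for k
  proof -
    have "0 < (1 - sqrt_seq k)\<^sup>2" using bd[of k] by simp
    then show ?thesis by (simp add: rec power2_eq_square algebra_simps)
  qed
  then show "sqrt_seq k < sqrt_seq (Suc k)" .
  have "incseq sqrt_seq" using inc by (intro incseq_SucI) (simp add: less_imp_le)
  then obtain L where L: "sqrt_seq \<longlonglongrightarrow> L"
    using incseq_convergent[of sqrt_seq 1] bd by (metis less_imp_le)
  from tendsto_diff[OF LIMSEQ_Suc[OF L] L] show "(\<lambda>k. sqrt_seq (Suc k) - sqrt_seq k) \<longlonglongrightarrow> 0" by simp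
qed

text \<open>Visser's iteration for \<open>1 - sqrt (1 - u)\<close>. All iterates are polynomials in \<open>u\<close> with nonnegative
  coefficients, so their bounds are the values of the same iteration at \<open>u = 1\<close>.\<close>

lemma sqrt_iter_bound:
  fixes u :: "'n::finite rfun"
  assumes pu: "real_polynomial_function u" and u: "QM_bound 1 u"
  shows "real_polynomial_function (sqrt_iter u k) \<and> QM_bound (sqrt_seq k) (sqrt_iter u k) \<and>
    QM_bound (sqrt_seq (Suc k) - sqrt_seq k) (\<lambda>x. sqrt_iter u (Suc k) x - sqrt_iter u k x)"
proof (induction k)
  case 0
  have "QM_bound (1/2) (\<lambda>x. u x / 2)" using QM_bound_cmult[OF u, of "1/2"] by simp
  moreover have "QM_bound (1/8) (\<lambda>x. (u x)\<^sup>2 / 8)"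
    using QM_bound_cmult[OF QM_bound_one_mult[OF pu u pu u], of "1/8"] by (simp add: power2_eq_square)
  ultimately show ?case using pu by (auto simp: sqrt_seq_def sqrt_iter.simps power2_eq_square field_simps)
next
  case (Suc k)
  note y = sqrt_seq_props
  let ?q = "sqrt_iter u"
  have rec: "sqrt_seq (Suc k) = (1 + (sqrt_seq k)\<^sup>2) / 2" for k by (simp add: sqrt_seq_def sqrt_iter.simps)
  have p: "real_polynomial_function (?q k)" "real_polynomial_function (?q (Suc k))"
    using Suc pu by (auto simp: sqrt_iter.simps power2_eq_square intro!: real_polynomial_function_divide)
  have b1: "QM_bound (sqrt_seq (Suc k)) (?q (Suc k))"
    using QM_bound_cmult[OF QM_bound_add[OF u QM_bound_mult[OF p(1) _ y(1) p(1) _ y(1), of k k]], of "1/2"] Suc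
    by (simp add: rec sqrt_iter.simps power2_eq_square)
  have d: "QM_bound (sqrt_seq (Suc k) - sqrt_seq k) (\<lambda>x. ?q (Suc k) x - ?q k x)" using Suc by simp
  have s: "QM_bound (sqrt_seq (Suc k) + sqrt_seq k) (\<lambda>x. ?q (Suc k) x + ?q k x)"
    using QM_bound_add[OF b1] Suc by simp
  \<comment> \<open>Half of difference times sum is the next increment, for the functions and for
    the majorant alike, so submultiplicativity carries the bound over.\<close>
  have "QM_bound ((sqrt_seq (Suc k) - sqrt_seq k) * (sqrt_seq (Suc k) + sqrt_seq k))
      (\<lambda>x. (?q (Suc k) x - ?q k x) * (?q (Suc k) x + ?q k x))"
  proof (rule QM_bound_mult[OF _ d _ _ s])
    show "0 < sqrt_seq (Suc k) - sqrt_seq k" using y(3)[of k] by linarith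
    show "0 < sqrt_seq (Suc k) + sqrt_seq k" using y(1)[of k] y(1)[of "Suc k"] by linarith
  qed (use p in blast)+
  from QM_bound_cmult[OF this, of "1/2"]
  have "QM_bound (1/2 * ((sqrt_seq (Suc k) - sqrt_seq k) * (sqrt_seq (Suc k) + sqrt_seq k)))
      (\<lambda>x. 1/2 * ((?q (Suc k) x - ?q k x) * (?q (Suc k) x + ?q k x)))"
    by simp
  moreover have "1/2 * ((?q (Suc k) x - ?q k x) * (?q (Suc k) x + ?q k x)) = ?q (Suc (Suc k)) x - ?q (Suc k) x" for x
  proof -
    have "2 * ?q (Suc (Suc k)) x = u x + ?q (Suc k) x * ?q (Suc k) x"
      "2 * ?q (Suc k) x = u x + ?q k x * ?q k x"
      by (simp_all add: sqrt_iter.simps(2) power2_eq_square)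
    then have "2 * (?q (Suc (Suc k)) x - ?q (Suc k) x) = ?q (Suc k) x * ?q (Suc k) x - ?q k x * ?q k x"
      by argo
    then show ?thesis by (simp add: algebra_simps)
  qed
  moreover have "1/2 * ((sqrt_seq (Suc k) - sqrt_seq k) * (sqrt_seq (Suc k) + sqrt_seq k)) =
      sqrt_seq (Suc (Suc k)) - sqrt_seq (Suc k)"
  proof -
    have "sqrt_seq (Suc (Suc k)) - sqrt_seq (Suc k) = ((sqrt_seq (Suc k))\<^sup>2 - (sqrt_seq k)\<^sup>2) / 2"
      using rec[of k] rec[of "Suc k"] by argo
    also have "\<dots> = 1/2 * ((sqrt_seq (Suc k) - sqrt_seq k) * (sqrt_seq (Suc k) + sqrt_seq k))"
      by (simp add: power2_eq_square field_simps)
    finally show ?thesis ..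
  qed
  ultimately have "QM_bound (sqrt_seq (Suc (Suc k)) - sqrt_seq (Suc k)) (\<lambda>x. ?q (Suc (Suc k)) x - ?q (Suc k) x)"
    by (simp only:)
  then show ?case using p(2) b1 by blast
qed

text \<open>The approximant is 1 - q_k, with q_k the iterate for u = 1 - F. The defect F - (1 -
  q_k)^2 is exactly -2 times the increment from q_k to its successor, whose bound tends to
  0.\<close>

lemma QM_sqrt_approx:
  fixes F :: "'n::finite rfun"
  assumes p: "real_polynomial_function F" and F: "F \<in> QM" "(\<lambda>x. 1 - F x) \<in> QM" and e: "0 < e"
  shows "\<exists>p. real_polynomial_function p \<and> QM_bound e (\<lambda>x. F x - (p x)\<^sup>2)"
proof -
  define u where "u = (\<lambda>x. 1 - F x)"
  have pu: "real_polynomial_function u" using p by (auto simp: u_def)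
  have u: "QM_bound 1 u" unfolding QM_bound_def u_def
    using F(1) QM.add[OF QM_const[of 1] F(2)] by simp
  have "\<forall>\<^sub>F k in sequentially. sqrt_seq (Suc k) - sqrt_seq k < e / 2"
    using sqrt_seq_props(4) e by (intro order_tendstoD(2)[of _ 0]) auto
  then obtain k where k: "sqrt_seq (Suc k) - sqrt_seq k < e / 2" by (auto simp: eventually_sequentially)
  note b = sqrt_iter_bound[OF pu u, of k]
  have "QM_bound (2 * (sqrt_seq (Suc k) - sqrt_seq k)) (\<lambda>x. -2 * (sqrt_iter u (Suc k) x - sqrt_iter u k x))"
    using QM_bound_cmult[of "sqrt_seq (Suc k) - sqrt_seq k" "\<lambda>x. sqrt_iter u (Suc k) x - sqrt_iter u k x" "-2"] b
    by simp
  moreover have "-2 * (sqrt_iter u (Suc k) x - sqrt_iter u k x) = F x - (1 - sqrt_iter u k x)\<^sup>2" for x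
  proof -
    have "2 * sqrt_iter u (Suc k) x = 1 - F x + sqrt_iter u k x * sqrt_iter u k x"
      by (simp add: u_def sqrt_iter.simps(2) power2_eq_square)
    then have "F x = 1 + sqrt_iter u k x * sqrt_iter u k x - 2 * sqrt_iter u (Suc k) x" by argo
    then show ?thesis by (simp add: power2_eq_square algebra_simps)
  qed
  ultimately have "QM_bound (2 * (sqrt_seq (Suc k) - sqrt_seq k)) (\<lambda>x. F x - (1 - sqrt_iter u k x)\<^sup>2)" by (simp only:)
  then have "QM_bound e (\<lambda>x. F x - (1 - sqrt_iter u k x)\<^sup>2)" by (rule QM_bound_mono) (use k in argo)
  moreover have "real_polynomial_function (\<lambda>x. 1 - sqrt_iter u k x)"
    using b by (auto intro!: real_polynomial_function_diff)
  ultimately show ?thesis by (intro exI[of _ "\<lambda>x. 1 - sqrt_iter u k x"]) auto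
qed

text \<open>The Archimedean closure. Perturbing by constants is enough, because every polynomial is
  bounded by a constant in the sense of \<open>QM_bound\<close>.\<close>

definition QMc :: "('n::finite) rfun set" where
  "QMc = {F. real_polynomial_function F \<and> (\<forall>e>0. (\<lambda>x. F x + e) \<in> QM)}"

lemma QM_imp_QMc: "real_polynomial_function F \<Longrightarrow> F \<in> QM \<Longrightarrow> F \<in> QMc"
  by (auto simp: QMc_def intro!: QM.add QM_const)

lemma QMc_poly: "F \<in> QMc \<Longrightarrow> real_polynomial_function F"
  by (simp add: QMc_def)

lemma QMc_add:
  assumes "F \<in> QMc" "G \<in> QMc" shows "(\<lambda>x. F x + G x) \<in> QMc"
proof -
  have "(\<lambda>x. F x + G x + e) \<in> QM" if "0 < e" for e
  proof -
    have "(\<lambda>x. (F x + e/2) + (G x + e/2)) \<in> QM"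
      by (rule QM.add) (use assms that in \<open>auto simp: QMc_def\<close>)
    then show ?thesis by (rule QM.cong) simp
  qed
  then show ?thesis using assms by (auto simp: QMc_def)
qed

lemma QMc_cong:
  assumes "F \<in> QMc" "\<And>x. x \<in> hyperplane1 \<Longrightarrow> F x = G x" "real_polynomial_function G"
  shows "G \<in> QMc"
proof -
  have "(\<lambda>x. G x + e) \<in> QM" if "0 < e" for e
    by (rule QM.cong[of "\<lambda>x. F x + e"]) (use assms that in \<open>auto simp: QMc_def\<close>)
  then show ?thesis using assms by (auto simp: QMc_def)
qed

lemma QMc_closed:
  assumes "\<And>e. 0 < e \<Longrightarrow> (\<lambda>x. F x + e) \<in> QMc" shows "F \<in> QMc"
proof -
  have "real_polynomial_function (\<lambda>x. (F x + 1) - 1)"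
    using QMc_poly[OF assms[of 1]] by (intro real_polynomial_function_diff) auto
  moreover have "(\<lambda>x. F x + e) \<in> QM" if "0 < e" for e
  proof -
    have "(\<lambda>x. (F x + e/2) + e/2) \<in> QM"
      using assms[of "e/2"] that half_gt_zero[OF that] unfolding QMc_def by blast
    then show ?thesis by (rule QM.cong) simp
  qed
  ultimately show ?thesis by (auto simp: QMc_def)
qed

text \<open>A quadratic module need not be closed under products, but it contains q^2 G whenever it
  contains G. So F, scaled to lie between 0 and 1, is replaced by an approximating square.\<close>

lemma QM_mult_QMc:
  assumes p: "real_polynomial_function F" "real_polynomial_function G" and F: "F \<in> QM" and G: "G \<in> QM"
  shows "(\<lambda>x. F x * G x) \<in> QMc"
proof -
  obtain r where r: "0 < r" "QM_bound r F" using QM_bound_exists[OF p(1)] by auto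
  obtain s where s: "0 < s" "QM_bound s G" using QM_bound_exists[OF p(2)] by auto
  have f: "(\<lambda>x. (1/r) * F x) \<in> QM" "(\<lambda>x. 1 - (1/r) * F x) \<in> QM" "real_polynomial_function (\<lambda>x. (1/r) * F x)"
    using QM_cmult[OF F, of "1/r"] QM_cmult[of "\<lambda>x. r - F x" "1/r"] r p
    by (auto simp: QM_bound_def algebra_simps)
  have "(\<lambda>x. F x * G x + e) \<in> QM" if e: "0 < e" for e
  proof -
    \<comment> \<open>The defect of the square times G has bound d * s, which scaling back by r
      turns into e.\<close>
    define d where "d = e / (r * s)"
    have d: "0 < d" using e r s by (simp add: d_def)
    obtain q where q: "real_polynomial_function q" "QM_bound d (\<lambda>x. (1/r) * F x - (q x)\<^sup>2)"
      using QM_sqrt_approx[OF f(3) f(1,2) d] by auto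
    have "QM_bound (d * s) (\<lambda>x. ((1/r) * F x - (q x)\<^sup>2) * G x)"
      by (rule QM_bound_mult[OF _ q(2) d p(2) s(2,1)]) (use q p in auto)
    then have "(\<lambda>x. d * s + ((1/r) * F x - (q x)\<^sup>2) * G x) \<in> QM" by (simp add: QM_bound_def)
    then have "(\<lambda>x. r * ((d * s + ((1/r) * F x - (q x)\<^sup>2) * G x) + (q x)\<^sup>2 * G x)) \<in> QM"
      by (intro QM_cmult[OF QM.add[OF _ QM_square_mult[OF G q(1)]]]) (use r in auto)
    then show ?thesis
      by (rule QM.cong) (use r s in \<open>simp add: d_def field_simps\<close>)
  qed
  then show ?thesis using p by (auto simp: QMc_def)
qed

lemma QMc_mult:
  assumes F: "F \<in> QMc" and G: "G \<in> QMc" shows "(\<lambda>x. F x * G x) \<in> QMc"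
proof -
  have p: "real_polynomial_function F" "real_polynomial_function G" using F G by (auto simp: QMc_poly)
  then have "real_polynomial_function (\<lambda>x. F x + G x)" by auto
  then obtain r where r: "0 < r" "QM_bound r (\<lambda>x. F x + G x)" using QM_bound_exists by auto
  have "(\<lambda>x. F x * G x + e) \<in> QM" if e: "0 < e" for e
  proof -
    \<comment> \<open>Expanding (F + d)(G + d) leaves d (F + G), bounded by d r; as d is at most 1,
      the total loss d r + d^2 + d is at most d (r + 2).\<close>
    define d where "d = min 1 (e / (r + 2))"
    have d: "0 < d" using e r by (simp add: d_def)
    have "d * r + d * d + d \<le> d * (r + 2)"
      using mult_left_mono[of d 1 d] d by (simp add: d_def algebra_simps)
    also have "\<dots> \<le> e" using r pos_le_divide_eq[of "r + 2" d e] by (simp add: d_def)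
    finally have d2: "0 \<le> e - d * r - d * d - d" by simp
    have 1: "(\<lambda>x. (F x + d) * (G x + d)) \<in> QMc"
      by (rule QM_mult_QMc) (use F G d p in \<open>auto simp: QMc_def\<close>)
    then have 1: "(\<lambda>x. (F x + d) * (G x + d) + d) \<in> QM" using d by (auto simp: QMc_def)
    have 2: "(\<lambda>x. d * (r - (F x + G x))) \<in> QM"
      using r(2) d by (intro QM_cmult) (auto simp: QM_bound_def)
    from QM.add[OF QM.add[OF 1 2] QM_const[OF d2]] show ?thesis
      by (rule QM.cong) (simp add: algebra_simps)
  qed
  then show ?thesis using p by (auto simp: QMc_def)
qed

lemma QMc_const: "0 \<le> c \<Longrightarrow> (\<lambda>x. c) \<in> QMc"
  by (intro QM_imp_QMc QM_const) auto

lemma QMc_cmult: "F \<in> QMc \<Longrightarrow> 0 \<le> c \<Longrightarrow> (\<lambda>x. c * F x) \<in> QMc"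
  using QMc_mult[OF QMc_const] by blast

lemma QMc_coord: "(\<lambda>x. x $ i) \<in> QMc"
  by (intro QM_imp_QMc QM_coord) auto

lemma QMc_sum: "finite A \<Longrightarrow> (\<And>a. a \<in> A \<Longrightarrow> F a \<in> QMc) \<Longrightarrow> (\<lambda>x. \<Sum>a\<in>A. F a x) \<in> QMc"
proof (induction A rule: finite_induct)
  case empty then show ?case using QMc_const[of 0] by simp
next
  case (insert a A) then show ?case using QMc_add[of "F a" "\<lambda>x. \<Sum>a\<in>A. F a x"] by simp
qed

text \<open>A product bound whose radius W is a function instead of a constant, needed for W = e + K
  * \<open>sqdist a\<close>. The averages of products of the given members do it.\<close>

lemma QMc_bound_mult:
  assumes "(\<lambda>x. W x + A x) \<in> QMc" "(\<lambda>x. W x - A x) \<in> QMc"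
    and "(\<lambda>x. r + G x) \<in> QMc" "(\<lambda>x. r - G x) \<in> QMc"
  shows "(\<lambda>x. r * W x + A x * G x) \<in> QMc" "(\<lambda>x. r * W x - A x * G x) \<in> QMc"
proof -
  have "(\<lambda>x. (1/2) * ((W x + A x) * (r + G x) + (W x - A x) * (r - G x))) \<in> QMc"
       "(\<lambda>x. (1/2) * ((W x + A x) * (r - G x) + (W x - A x) * (r + G x))) \<in> QMc"
    by (intro QMc_cmult QMc_add QMc_mult assms; simp)+
  moreover have "(1/2) * ((W x + A x) * (r + G x) + (W x - A x) * (r - G x)) = r * W x + A x * G x"
     "(1/2) * ((W x + A x) * (r - G x) + (W x - A x) * (r + G x)) = r * W x - A x * G x" for x
    by (simp_all add: algebra_simps)
  ultimately show "(\<lambda>x. r * W x + A x * G x) \<in> QMc" "(\<lambda>x. r * W x - A x * G x) \<in> QMc"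
    by (simp_all only:)
qed

section \<open>Nonnegative polynomials on the simplex\<close>

lemmas polyf_intros = poly_coord real_polynomial_function.intros(2-4) real_polynomial_function_diff
  real_polynomial_function_minus real_polynomial_function_power real_polynomial_function_sum

definition sqdist :: "real^'n \<Rightarrow> real^'n::finite \<Rightarrow> real" where
  "sqdist a x = (\<Sum>i\<in>UNIV. (x $ i - a $ i)\<^sup>2)"

lemma sqdist_QMc: "sqdist a \<in> QMc"
proof -
  have "(\<lambda>x. \<Sum>i\<in>UNIV. (x $ i - a $ i)\<^sup>2) \<in> QMc"
    by (intro QMc_sum QM_imp_QMc QM.square polyf_intros) auto
  then show ?thesis by (simp add: sqdist_def[abs_def])
qed

text \<open>Uniform continuity in algebraic form: K depends on F and e but not on the base point a.
  This is the estimate behind Bernstein's and Korovkin's theorems, with membership in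
  \<open>QMc\<close> in place of inequalities.\<close>

lemma approx_by_sqdist:
  fixes F :: "'n::finite rfun"
  assumes "real_polynomial_function F" "0 < e"
  shows "\<exists>K\<ge>0. \<forall>a\<in>std_simplex. (\<lambda>x. e + K * sqdist a x + (F x - F a)) \<in> QMc \<and>
    (\<lambda>x. e + K * sqdist a x - (F x - F a)) \<in> QMc"
  using assms
proof (induction arbitrary: e rule: real_polynomial_function.induct)
  case (linear f)
  then interpret bounded_linear f by simp
  let ?c = "\<lambda>i. f (axis i 1)"
  define e1 where "e1 = e / CARD('n)"
  have e1: "0 < e1" using linear.prems by (simp add: e1_def card_gt_0_iff)
  \<comment> \<open>Completing the square bounds c_i t by e1 + c_i^2 t^2 / (4 e1) in either sign;
    the sum over i dominates every one of these coefficients.\<close>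
  define K where "K = (\<Sum>i\<in>UNIV. (?c i)\<^sup>2 / (4 * e1))"
  have exp: "f x = (\<Sum>i\<in>UNIV. ?c i * x $ i)" for x
  proof -
    have "(\<Sum>i\<in>UNIV. x $ i *\<^sub>R axis i 1) = x"
      using basis_expansion[of x] by (simp only: scalar_mult_eq_scaleR)
    then have "f x = f (\<Sum>i\<in>UNIV. x $ i *\<^sub>R axis i 1)" by simp
    then show ?thesis by (simp add: sum scale mult.commute)
  qed
  have pf: "real_polynomial_function f" by (rule real_polynomial_function.intros(1)) (rule linear.hyps)
  have Ki: "(?c i)\<^sup>2 / (4 * e1) \<le> K" for i
    unfolding K_def using e1 by (intro member_le_sum) auto
  have main: "(\<lambda>x. e + K * sqdist a x + s * (f x - f a)) \<in> QMc" if s: "s\<^sup>2 = 1" for a s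
  proof (rule QMc_cong)
    let ?g = "\<lambda>i x. (sqrt e1 + s * ?c i / (2 * sqrt e1) * (x $ i - a $ i))\<^sup>2 +
        (K - (?c i)\<^sup>2 / (4 * e1)) * (x $ i - a $ i)\<^sup>2"
    show "(\<lambda>x. \<Sum>i\<in>UNIV. ?g i x) \<in> QMc"
      by (intro QMc_sum QMc_add QMc_cmult QM_imp_QMc[OF _ QM.square] polyf_intros) (use Ki in simp_all)
    show "real_polynomial_function (\<lambda>x. e + K * sqdist a x + s * (f x - f a))"
      by (intro polyf_intros pf QMc_poly[OF sqdist_QMc])
    fix x :: "real^'n" assume "x \<in> hyperplane1"
    have "?g i x = e1 + K * (x $ i - a $ i)\<^sup>2 + s * (?c i * x $ i - ?c i * a $ i)" for i
    proof -
      define q where "q = s * ?c i / (2 * sqrt e1)"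
      define t where "t = x $ i - a $ i"
      have "q\<^sup>2 = (?c i)\<^sup>2 / (4 * e1)" "2 * sqrt e1 * q = s * ?c i" "(sqrt e1)\<^sup>2 = e1"
        using e1 s by (simp_all add: q_def power_divide power_mult_distrib)
      moreover have "(sqrt e1 + q * t)\<^sup>2 = (sqrt e1)\<^sup>2 + (2 * sqrt e1 * q) * t + q\<^sup>2 * t\<^sup>2"
        by (simp add: power2_eq_square algebra_simps)
      ultimately have "(sqrt e1 + q * t)\<^sup>2 + (K - (?c i)\<^sup>2 / (4 * e1)) * t\<^sup>2 = e1 + K * t\<^sup>2 + s * ?c i * t"
        by (simp add: left_diff_distrib)
      then show ?thesis by (simp add: q_def t_def algebra_simps)
    qed
    then have "(\<Sum>i\<in>UNIV. ?g i x) = (\<Sum>i\<in>UNIV. e1 + K * (x $ i - a $ i)\<^sup>2 + s * (?c i * x $ i - ?c i * a $ i))"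
      by simp
    also have "\<dots> = e + K * sqdist a x + s * (f x - f a)"
      unfolding exp[of x] exp[of a]
      by (simp add: sum.distrib sqdist_def sum_distrib_left sum_subtractf right_diff_distrib e1_def)
    finally show "(\<Sum>i\<in>UNIV. ?g i x) = e + K * sqdist a x + s * (f x - f a)" .
  qed
  have "0 \<le> K" unfolding K_def using e1 by (intro sum_nonneg) auto
  then show ?case using main[of 1] main[of "-1"] by (intro exI[of _ K]) (auto simp: algebra_simps)
next
  case (const c)
  then show ?case by (intro exI[of _ 0]) (auto intro: QMc_const)
next
  case (add f g)
  from add.IH(1)[of "e/2"] add.prems obtain K1 where K1: "0 \<le> K1"
    "\<And>a. a \<in> std_simplex \<Longrightarrow> (\<lambda>x. e/2 + K1 * sqdist a x + (f x - f a)) \<in> QMc"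
    "\<And>a. a \<in> std_simplex \<Longrightarrow> (\<lambda>x. e/2 + K1 * sqdist a x - (f x - f a)) \<in> QMc" by auto
  from add.IH(2)[of "e/2"] add.prems obtain K2 where K2: "0 \<le> K2"
    "\<And>a. a \<in> std_simplex \<Longrightarrow> (\<lambda>x. e/2 + K2 * sqdist a x + (g x - g a)) \<in> QMc"
    "\<And>a. a \<in> std_simplex \<Longrightarrow> (\<lambda>x. e/2 + K2 * sqdist a x - (g x - g a)) \<in> QMc" by auto
  show ?case
  proof (intro exI[of _ "K1 + K2"] conjI ballI)
    fix a :: "real^'n" assume a: "a \<in> std_simplex"
    show "(\<lambda>x. e + (K1 + K2) * sqdist a x + (f x + g x - (f a + g a))) \<in> QMc"
      using QMc_add[OF K1(2)[OF a] K2(2)[OF a]] by (simp add: algebra_simps)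
    show "(\<lambda>x. e + (K1 + K2) * sqdist a x - (f x + g x - (f a + g a))) \<in> QMc"
      using QMc_add[OF K1(3)[OF a] K2(3)[OF a]] by (simp add: algebra_simps)
  qed (use K1 K2 in simp)
next
  case (mult f g)
  obtain R where R: "0 < R" "QM_bound R f" using QM_bound_exists mult.hyps by blast
  obtain r where r: "0 < r" "QM_bound r g" using QM_bound_exists mult.hyps by blast
  \<comment> \<open>Write f g - f(a) g(a) = (f - f(a)) g + f(a) (g - g(a)). The first term costs r d
    and the second R d, together e.\<close>
  define d where "d = e / (R + r)"
  have d: "0 < d" "r * d + R * d = e" 
  proof -
    show "0 < d" using R r mult.prems by (simp add: d_def)
    have "r * d + R * d = (R + r) * d" by (simp add: algebra_simps)
    also have "\<dots> = e" using R r by (simp add: d_def)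
    finally show "r * d + R * d = e" .
  qed
  from mult.IH(1)[OF d(1)] obtain K1 where K1: "0 \<le> K1"
    "\<And>a. a \<in> std_simplex \<Longrightarrow> (\<lambda>x. d + K1 * sqdist a x + (f x - f a)) \<in> QMc"
    "\<And>a. a \<in> std_simplex \<Longrightarrow> (\<lambda>x. d + K1 * sqdist a x - (f x - f a)) \<in> QMc" by auto
  from mult.IH(2)[OF d(1)] obtain K2 where K2: "0 \<le> K2"
    "\<And>a. a \<in> std_simplex \<Longrightarrow> (\<lambda>x. d + K2 * sqdist a x + (g x - g a)) \<in> QMc"
    "\<And>a. a \<in> std_simplex \<Longrightarrow> (\<lambda>x. d + K2 * sqdist a x - (g x - g a)) \<in> QMc" by auto
  have rg: "(\<lambda>x. r + g x) \<in> QMc" "(\<lambda>x. r - g x) \<in> QMc"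
    using r mult.hyps by (auto simp: QM_bound_def intro!: QM_imp_QMc)
  show ?case
  proof (intro exI[of _ "r * K1 + R * K2"] conjI ballI)
    fix a :: "real^'n" assume a: "a \<in> std_simplex"
    have "0 \<le> R - f a" "0 \<le> R + f a"
      using QM_nonneg[OF _ a, of "\<lambda>x. R - f x"] QM_nonneg[OF _ a, of "\<lambda>x. R + f x"] R(2)
      by (auto simp: QM_bound_def)
    then have fa: "(\<lambda>x. R + f a) \<in> QMc" "(\<lambda>x. R - f a) \<in> QMc" by (auto intro: QMc_const)
    note 1 = QMc_bound_mult[OF K1(2,3)[OF a] rg]
    note 2 = QMc_bound_mult[OF K2(2,3)[OF a] fa]
    have e: "e = r * d + R * d" using d by simp
    show "(\<lambda>x. e + (r * K1 + R * K2) * sqdist a x + (f x * g x - f a * g a)) \<in> QMc"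
      using QMc_add[OF 1(1) 2(1)] unfolding e by (simp add: algebra_simps)
    show "(\<lambda>x. e + (r * K1 + R * K2) * sqdist a x - (f x * g x - f a * g a)) \<in> QMc"
      using QMc_add[OF 1(2) 2(2)] unfolding e by (simp add: algebra_simps)
  qed (use K1 K2 r R in simp)
qed

text \<open>The words of length \<open>N\<close>, weighted by their monomials, are the multinomial distribution: a partition of
  unity by elements of \<open>QMc\<close>, concentrated near \<open>x = word_sum w / N\<close>.\<close>

fun word_weight :: "'n list \<Rightarrow> real^'n::finite \<Rightarrow> real" where
  "word_weight [] x = 1"
| "word_weight (k # w) x = word_weight w x * x $ k"

fun word_sum :: "'n list \<Rightarrow> real^'n::finite" where
  "word_sum [] = 0"
| "word_sum (k # w) = word_sum w + axis k 1"

lemma sum_words_Suc: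
  fixes f :: "'n::finite list \<Rightarrow> real"
  shows "(\<Sum>w | length w = Suc N. f w) = (\<Sum>w | length w = N. \<Sum>k\<in>UNIV. f (k # w))"
proof -
  have "{w::'n list. length w = Suc N} = (\<lambda>(w, k). k # w) ` ({w. length w = N} \<times> UNIV)"
    by (auto simp: length_Suc_conv image_iff)
  moreover have "inj_on (\<lambda>(w, k). k # w) ({w::'n list. length w = N} \<times> UNIV)"
    by (auto simp: inj_on_def)
  ultimately show ?thesis
    by (simp add: sum.reindex sum.cartesian_product case_prod_unfold)
qed

lemma finite_words: "finite {w::'n::finite list. length w = N}"
  using finite_lists_length_eq[of "UNIV::'n set" N] by simp

lemma word_weight_QMc: "word_weight w \<in> QMc"
proof (induction w)
  case Nil
  have "(\<lambda>x. 1) \<in> QMc" by (rule QMc_const) simp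
  then show ?case by (simp add: word_weight.simps(1)[abs_def])
next
  case (Cons k w)
  from QMc_mult[OF this QMc_coord[of k]] show ?case by (simp add: word_weight.simps(2)[abs_def])
qed

lemma word_sum_nonneg: "0 \<le> word_sum w $ i"
  by (induction w) (auto simp: axis_def)

lemma word_sum_total: "(\<Sum>i\<in>UNIV. word_sum w $ i) = length w"
  by (induction w) (auto simp: sum.distrib axis_def)

lemma word_weight_total:
  assumes "x \<in> hyperplane1"
  shows "(\<Sum>w | length w = N. word_weight w x) = 1"
proof (induction N)
  case (Suc N)
  have "(\<Sum>k\<in>UNIV. word_weight w x * x $ k) = word_weight w x" for w
    using assms by (simp add: hyperplane1_def flip: sum_distrib_left)
  then show ?case using Suc by (simp add: sum_words_Suc)
qed simp

text \<open>The letters act as N independent draws, each contributing 1 - |x|^2 to the variance. As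
  an identity on the hyperplane it also covers points where some weights are negative.\<close>

lemma word_weight_variance:
  fixes x :: "real^'n::finite"
  assumes x: "x \<in> hyperplane1"
  shows "(\<Sum>w | length w = N. word_weight w x * (\<Sum>i\<in>UNIV. (word_sum w $ i - N * x $ i)\<^sup>2)) =
    N * (1 - (\<Sum>i\<in>UNIV. (x $ i)\<^sup>2))"
proof (induction N)
  case (Suc N)
  have s1: "(\<Sum>k\<in>UNIV. x $ k) = 1" using x by (simp add: hyperplane1_def)
  \<comment> \<open>Append a letter k with weight x_k: the part linear in the old deviation D
    averages to zero because the weights sum to 1.\<close>
  have step: "(\<Sum>k\<in>UNIV. x $ k * (\<Sum>i\<in>UNIV. (S $ i + axis k 1 $ i - Suc N * x $ i)\<^sup>2)) =
      (\<Sum>i\<in>UNIV. (S $ i - N * x $ i)\<^sup>2) + (1 - (\<Sum>i\<in>UNIV. (x $ i)\<^sup>2))" for S :: "real^'n"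
  proof -
    define D where "D = (\<lambda>i. S $ i - N * x $ i)"
    have "(\<Sum>i\<in>UNIV. (S $ i + axis k 1 $ i - Suc N * x $ i)\<^sup>2) =
        (\<Sum>i\<in>UNIV. (D i)\<^sup>2) + 2 * (D k - (\<Sum>i\<in>UNIV. D i * x $ i)) + 1 - 2 * x $ k + (\<Sum>i\<in>UNIV. (x $ i)\<^sup>2)" for k
    proof -
      have "(S $ i + axis k 1 $ i - Suc N * x $ i)\<^sup>2 =
        (D i)\<^sup>2 + 2 * ((if i = k then D k else 0) - D i * x $ i) + (if i = k then 1 - 2 * x $ k else 0) + (x $ i)\<^sup>2" for i
        by (auto simp: D_def axis_def power2_eq_square algebra_simps)
      then show ?thesis by (simp add: sum.distrib sum_subtractf flip: sum_distrib_left)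
    qed
    then have "(\<Sum>k\<in>UNIV. x $ k * (\<Sum>i\<in>UNIV. (S $ i + axis k 1 $ i - Suc N * x $ i)\<^sup>2)) =
       (\<Sum>k\<in>UNIV. x $ k * ((\<Sum>i\<in>UNIV. (D i)\<^sup>2) + 2 * (D k - (\<Sum>i\<in>UNIV. D i * x $ i)) + 1 - 2 * x $ k + (\<Sum>i\<in>UNIV. (x $ i)\<^sup>2)))"
      by simp
    also have "\<dots> = (\<Sum>k\<in>UNIV. x $ k * ((\<Sum>i\<in>UNIV. (D i)\<^sup>2) - 2 * (\<Sum>i\<in>UNIV. D i * x $ i) + 1 + (\<Sum>i\<in>UNIV. (x $ i)\<^sup>2))
        + 2 * (D k * x $ k) - 2 * (x $ k)\<^sup>2)"
      by (intro sum.cong refl) (simp add: power2_eq_square algebra_simps)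
    also have "\<dots> = (\<Sum>i\<in>UNIV. (D i)\<^sup>2) + (1 - (\<Sum>i\<in>UNIV. (x $ i)\<^sup>2))"
      by (simp add: sum.distrib sum_subtractf s1 flip: sum_distrib_left sum_distrib_right)
    finally show ?thesis by (simp add: D_def)
  qed
  have "(\<Sum>w | length w = Suc N. word_weight w x * (\<Sum>i\<in>UNIV. (word_sum w $ i - Suc N * x $ i)\<^sup>2)) =
      (\<Sum>w | length w = N. word_weight w x *
        (\<Sum>k\<in>UNIV. x $ k * (\<Sum>i\<in>UNIV. (word_sum w $ i + axis k 1 $ i - Suc N * x $ i)\<^sup>2)))"
    by (simp add: sum_words_Suc sum_distrib_left mult.assoc del: of_nat_Suc)
  also have "\<dots> = (\<Sum>w | length w = N. word_weight w x * (\<Sum>i\<in>UNIV. (word_sum w $ i - N * x $ i)\<^sup>2))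
     + (\<Sum>w | length w = N. word_weight w x) * (1 - (\<Sum>i\<in>UNIV. (x $ i)\<^sup>2))"
    by (simp only: step distrib_left sum.distrib sum_distrib_right)
  also have "\<dots> = Suc N * (1 - (\<Sum>i\<in>UNIV. (x $ i)\<^sup>2))"
    by (simp add: Suc.IH word_weight_total[OF x] algebra_simps)
  finally show ?case .
qed simp

theorem nonneg_imp_QMc:
  fixes F :: "'n::finite rfun"
  assumes p: "real_polynomial_function F" and F: "\<And>x. x \<in> std_simplex \<Longrightarrow> 0 \<le> F x"
  shows "F \<in> QMc"
proof -
  have "(\<lambda>x. F x + 2 * e) \<in> QMc" if e: "0 < e" for e
  proof -
    obtain K where K: "0 \<le> K"
      and K2: "\<And>a. a \<in> std_simplex \<Longrightarrow> (\<lambda>x. e + K * sqdist a x + (F x - F a)) \<in> QMc"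
      using approx_by_sqdist[OF p e] by blast
    obtain N :: nat where N: "K / e < N" using reals_Archimedean2 by blast
    then have N0: "0 < N" using K e by (metis divide_nonneg_pos not_gr_zero of_nat_0 not_le)
    have KN: "K / N \<le> e" using N N0 e by (simp add: field_simps)
    define a :: "'n list \<Rightarrow> real^'n" where "a w = (1 / N) *\<^sub>R word_sum w" for w
    have a: "a w \<in> std_simplex" if "length w = N" for w
      using that N0 word_sum_nonneg[of w] word_sum_total[of w]
      by (simp add: a_def std_simplex_def hyperplane1_def flip: sum_divide_distrib)
    \<comment> \<open>The terms F (a w) times weight form the Bernstein polynomial of F; the other
      terms compare F with it. By the variance formula the sum equals e + F + (K/N)(1 - |x|^2), and
      the last two summands complete this to F + 2 e.\<close>
    have "(\<lambda>x. (\<Sum>w | length w = N. word_weight w x * (e + K * sqdist (a w) x + (F x - F (a w)))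
          + F (a w) * word_weight w x) + (K / N) * sqdist 0 x + (e - K / N)) \<in> QMc"
      using a F K KN
      by (intro QMc_add QMc_sum QMc_mult QMc_cmult QMc_const finite_words word_weight_QMc sqdist_QMc K2) auto
    then show ?thesis
    proof (rule QMc_cong)
      show "real_polynomial_function (\<lambda>x. F x + 2 * e)" using p by auto
      fix x :: "real^'n" assume x: "x \<in> hyperplane1"
      have "sqdist (a w) x = (\<Sum>i\<in>UNIV. (word_sum w $ i - N * x $ i)\<^sup>2) / N\<^sup>2" for w
      proof -
        have "(x $ i - a w $ i)\<^sup>2 = (word_sum w $ i - N * x $ i)\<^sup>2 / N\<^sup>2" for i
          using N0 by (simp add: a_def power2_eq_square field_simps)
        then show ?thesis by (simp add: sqdist_def sum_divide_distrib)
      qed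
      then have "(\<Sum>w | length w = N. word_weight w x * sqdist (a w) x) =
          (\<Sum>w | length w = N. word_weight w x * (\<Sum>i\<in>UNIV. (word_sum w $ i - N * x $ i)\<^sup>2)) / N\<^sup>2"
        by (simp only: times_divide_eq_right flip: sum_divide_distrib)
      also have "\<dots> = (1 - sqdist 0 x) / N"
        unfolding word_weight_variance[OF x] using N0 by (simp add: sqdist_def power2_eq_square)
      finally have v: "(\<Sum>w | length w = N. word_weight w x * sqdist (a w) x) = (1 - sqdist 0 x) / N" .
      have "(\<Sum>w | length w = N. word_weight w x * (e + K * sqdist (a w) x + (F x - F (a w)))
          + F (a w) * word_weight w x) =
          (\<Sum>w | length w = N. word_weight w x * (e + F x) + K * (word_weight w x * sqdist (a w) x))"
        by (intro sum.cong refl) (simp add: algebra_simps)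
      also have "\<dots> = (\<Sum>w | length w = N. word_weight w x) * (e + F x) +
          K * (\<Sum>w | length w = N. word_weight w x * sqdist (a w) x)"
        by (simp only: sum.distrib sum_distrib_left sum_distrib_right)
      also have "\<dots> = e + F x + K * ((1 - sqdist 0 x) / N)"
        by (simp add: v word_weight_total[OF x])
      finally show "(\<Sum>w | length w = N. word_weight w x * (e + K * sqdist (a w) x + (F x - F (a w)))
          + F (a w) * word_weight w x) + (K / N) * sqdist 0 x + (e - K / N) = F x + 2 * e"
        by (simp add: diff_divide_distrib right_diff_distrib)
    qed
  qed
  from this[of "e / 2" for e] have "(\<lambda>x. F x + e) \<in> QMc" if "0 < e" for e using that by simp
  then show ?thesis by (rule QMc_closed)
qed

section \<open>Charts at a zero\<close>

lemma continuous_on_polyf: "real_polynomial_function F \<Longrightarrow> continuous_on S F"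
  by (simp add: continuous_at_imp_continuous_on continuous_real_polymonial_function)

lemma QMcD: "F \<in> QMc \<Longrightarrow> 0 < e \<Longrightarrow> (\<lambda>x. F x + e) \<in> QM"
  by (simp add: QMc_def)

lemma compact_std_simplex: "compact (std_simplex :: (real^'n::finite) set)"
proof -
  have "closed ({x::real^'n. (\<Sum>i\<in>UNIV. x $ i) = 1} \<inter> (\<Inter>i. {x. 0 \<le> x $ i}))"
    by (intro closed_Int closed_INT ballI closed_Collect_eq closed_Collect_le continuous_intros)
  moreover have "std_simplex = cbox 0 1 \<inter> ({x::real^'n. (\<Sum>i\<in>UNIV. x $ i) = 1} \<inter> (\<Inter>i. {x. 0 \<le> x $ i}))"
  proof -
    have "x $ i \<le> 1" if "x \<in> std_simplex" for x :: "real^'n" and i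
      using QM_nonneg[OF QM_coord_le_one that, of i] by simp
    then show ?thesis by (auto simp: std_simplex_def hyperplane1_def mem_box_cart)
  qed
  ultimately show ?thesis using compact_Int_closed[OF compact_cbox] by metis
qed

lemma polyf_bounded_simplex:
  assumes "real_polynomial_function (F :: 'n::finite rfun)"
  obtains B where "0 < B" "\<And>x. x \<in> std_simplex \<Longrightarrow> \<bar>F x\<bar> \<le> B"
proof -
  obtain r where "0 < r" "QM_bound r F" using QM_bound_exists[OF assms] by auto
  moreover have "\<bar>F x\<bar> \<le> r" if "x \<in> std_simplex" for x
    using QM_nonneg[OF _ that, of "\<lambda>x. r - F x"] QM_nonneg[OF _ that, of "\<lambda>x. r + F x"] \<open>QM_bound r F\<close>
    by (simp add: QM_bound_def)
  ultimately show ?thesis using that by blast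
qed

lemma QM_of_nonneg:
  assumes "real_polynomial_function F" "\<And>x. x \<in> std_simplex \<Longrightarrow> - e < F x" "0 < e"
  shows "(\<lambda>x. F x + 2 * e) \<in> QM"
proof -
  have "(\<lambda>x. F x + e) \<in> QMc"
  proof (rule nonneg_imp_QMc)
    show "real_polynomial_function (\<lambda>x. F x + e)" by (intro polyf_intros assms)
    show "0 \<le> F x + e" if "x \<in> std_simplex" for x using assms(2)[OF that] by simp
  qed
  from QMcD[OF this assms(3)] have "(\<lambda>x. F x + e + e) \<in> QM" .
  then show ?thesis by (rule QM.cong) simp
qed

definition sumsq :: "'j set \<Rightarrow> ('j \<Rightarrow> 'n rfun) \<Rightarrow> real^'n::finite \<Rightarrow> real" where
  "sumsq J z x = (\<Sum>j\<in>J. (z j x)\<^sup>2)"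

text \<open>A chart at \<open>v\<close> consists of generators of the ideal of \<open>v\<close> modulo the equation of the hyperplane.\<close>

definition chart :: "real^'n::finite \<Rightarrow> 'j set \<Rightarrow> ('j \<Rightarrow> 'n rfun) \<Rightarrow> bool" where
  "chart v J z \<longleftrightarrow> v \<in> std_simplex \<and> finite J \<and>
    (\<forall>j\<in>J. real_polynomial_function (z j) \<and> z j v = 0) \<and>
    (\<forall>i. \<exists>\<kappa>. \<forall>x\<in>hyperplane1. x $ i - v $ i = (\<Sum>j\<in>J. \<kappa> j * z j x))"

text \<open>A local certificate at v. The \<open>a j\<close> are nonnegative on the whole simplex
  because they are passed to \<open>nonneg_imp_QMc\<close>; the \<open>b j\<close> are positive at v
  alone, since peak functions localise the rest.\<close>

definition pos_decomp :: "real^'n::finite \<Rightarrow> 'j set \<Rightarrow> ('j \<Rightarrow> 'n rfun) \<Rightarrow> 'n rfun \<Rightarrow>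
    'j set \<Rightarrow> ('j \<Rightarrow> 'n rfun) \<Rightarrow> ('j \<Rightarrow> 'n rfun) \<Rightarrow> ('j \<Rightarrow> 'n) \<Rightarrow> bool" where
  "pos_decomp v J z f L a b \<iota> \<longleftrightarrow> finite L \<and>
    (\<forall>j\<in>J. real_polynomial_function (a j) \<and> (\<forall>x\<in>std_simplex. 0 \<le> a j x)) \<and>
    (\<forall>j\<in>L. v $ \<iota> j = 0 \<and> real_polynomial_function (b j) \<and> 0 < b j v) \<and>
    (\<forall>x\<in>hyperplane1. f x = (\<Sum>j\<in>J. a j x * (z j x)\<^sup>2) + (\<Sum>j\<in>L. b j x * x $ \<iota> j))"

lemma pos_decompD:
  assumes "pos_decomp v J z f L a b \<iota>"
  shows "finite L"
    "\<And>j. j \<in> J \<Longrightarrow> real_polynomial_function (a j)" "\<And>j x. j \<in> J \<Longrightarrow> x \<in> std_simplex \<Longrightarrow> 0 \<le> a j x"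
    "\<And>j. j \<in> L \<Longrightarrow> v $ \<iota> j = 0" "\<And>j. j \<in> L \<Longrightarrow> real_polynomial_function (b j)" "\<And>j. j \<in> L \<Longrightarrow> 0 < b j v"
    "\<And>x. x \<in> hyperplane1 \<Longrightarrow> f x = (\<Sum>j\<in>J. a j x * (z j x)\<^sup>2) + (\<Sum>j\<in>L. b j x * x $ \<iota> j)"
  using assms by (simp_all add: pos_decomp_def)

definition pos_form :: "real^'n::finite \<Rightarrow> 'j set \<Rightarrow> ('j \<Rightarrow> 'n rfun) \<Rightarrow> 'n rfun \<Rightarrow> bool" where
  "pos_form v J z f \<longleftrightarrow> (\<exists>L a b \<iota>. pos_decomp v J z f L a b \<iota>)"

text \<open>Lets a cut-off factor be put in front of f in the induction over the zeros.\<close>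

lemma pos_form_mult:
  assumes "pos_form v J z f" "real_polynomial_function g" "\<And>x. x \<in> std_simplex \<Longrightarrow> 0 \<le> g x" "0 < g v"
  shows "pos_form v J z (\<lambda>x. g x * f x)"
proof -
  from assms(1) obtain L a b \<iota> where "pos_decomp v J z f L a b \<iota>"
    unfolding pos_form_def by (elim exE)
  note D = pos_decompD[OF this]
  have "pos_decomp v J z (\<lambda>x. g x * f x) L (\<lambda>j x. g x * a j x) (\<lambda>j x. g x * b j x) \<iota>"
    unfolding pos_decomp_def
  proof (intro conjI ballI)
    fix x :: "real^'a" assume "x \<in> hyperplane1"
    then show "g x * f x = (\<Sum>j\<in>J. g x * a j x * (z j x)\<^sup>2) + (\<Sum>j\<in>L. g x * b j x * x $ \<iota> j)"
      by (simp add: D(7) distrib_left sum_distrib_left mult.assoc)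
  next
    fix j assume "j \<in> J"
    then show "real_polynomial_function (\<lambda>x. g x * a j x)" by (intro polyf_intros assms D)
  next
    fix j assume "j \<in> L"
    then show "real_polynomial_function (\<lambda>x. g x * b j x)" by (intro polyf_intros assms D)
  qed (use D assms in auto)
  then show ?thesis unfolding pos_form_def by (intro exI)
qed

text \<open>A first-order Taylor expansion without derivatives; for products, f g - f(v) g(v) = (f -
  f(v)) g + f(v) (g - g(v)).\<close>

lemma chart_generates:
  assumes ch: "chart v J z" and p: "real_polynomial_function p"
  shows "\<exists>c. (\<forall>j\<in>J. real_polynomial_function (c j)) \<and>
    (\<forall>x\<in>hyperplane1. p x - p v = (\<Sum>j\<in>J. c j x * z j x))"
  using p
proof (induction rule: real_polynomial_function.induct)
  case (linear f)
  then interpret bounded_linear f by simp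
  obtain \<kappa> where \<kappa>: "\<And>i x. x \<in> hyperplane1 \<Longrightarrow> x $ i - v $ i = (\<Sum>j\<in>J. \<kappa> i j * z j x)"
    using ch unfolding chart_def by metis
  show ?case
  proof (intro exI[of _ "\<lambda>j x. \<Sum>i\<in>UNIV. f (axis i 1) * \<kappa> i j"] conjI ballI)
    fix x :: "real^'a" assume x: "x \<in> hyperplane1"
    have "(\<Sum>i\<in>UNIV. (x - v) $ i *\<^sub>R axis i 1) = x - v"
      using basis_expansion[of "x - v"] by (simp only: scalar_mult_eq_scaleR)
    then have "f x - f v = f (\<Sum>i\<in>UNIV. (x - v) $ i *\<^sub>R axis i 1)" by (simp add: diff)
    also have "\<dots> = (\<Sum>i\<in>UNIV. f (axis i 1) * (x $ i - v $ i))" by (simp add: sum scale mult.commute)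
    also have "\<dots> = (\<Sum>i\<in>UNIV. \<Sum>j\<in>J. f (axis i 1) * \<kappa> i j * z j x)"
      by (simp add: \<kappa>[OF x] sum_distrib_left mult.assoc)
    also have "\<dots> = (\<Sum>j\<in>J. (\<Sum>i\<in>UNIV. f (axis i 1) * \<kappa> i j) * z j x)"
      by (subst sum.swap) (simp add: sum_distrib_right)
    finally show "f x - f v = (\<Sum>j\<in>J. (\<Sum>i\<in>UNIV. f (axis i 1) * \<kappa> i j) * z j x)" .
  qed (rule polyf_intros)
next
  case (const c)
  show ?case by (intro exI[of _ "\<lambda>j x. 0"]) (auto intro: polyf_intros)
next
  case (add f g)
  then obtain c d where c: "\<forall>j\<in>J. real_polynomial_function (c j)" "\<forall>x\<in>hyperplane1. f x - f v = (\<Sum>j\<in>J. c j x * z j x)"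
    and d: "\<forall>j\<in>J. real_polynomial_function (d j)" "\<forall>x\<in>hyperplane1. g x - g v = (\<Sum>j\<in>J. d j x * z j x)"
    by blast
  show ?case
  proof (intro exI[of _ "\<lambda>j x. c j x + d j x"] conjI ballI)
    fix x :: "real^'a" assume x: "x \<in> hyperplane1"
    have "f x + g x - (f v + g v) = (f x - f v) + (g x - g v)" by simp
    also have "\<dots> = (\<Sum>j\<in>J. (c j x + d j x) * z j x)"
      using x c d by (simp add: distrib_right sum.distrib)
    finally show "f x + g x - (f v + g v) = (\<Sum>j\<in>J. (c j x + d j x) * z j x)" .
  next
    fix j assume "j \<in> J"
    then show "real_polynomial_function (\<lambda>x. c j x + d j x)"
      using c(1) d(1) by (intro polyf_intros) auto
  qed
next
  case (mult f g)
  then obtain c d where c: "\<forall>j\<in>J. real_polynomial_function (c j)" "\<forall>x\<in>hyperplane1. f x - f v = (\<Sum>j\<in>J. c j x * z j x)"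
    and d: "\<forall>j\<in>J. real_polynomial_function (d j)" "\<forall>x\<in>hyperplane1. g x - g v = (\<Sum>j\<in>J. d j x * z j x)"
    by blast
  show ?case
  proof (intro exI[of _ "\<lambda>j x. c j x * g x + f v * d j x"] conjI ballI)
    fix x :: "real^'a" assume x: "x \<in> hyperplane1"
    have "f x * g x - f v * g v = (f x - f v) * g x + f v * (g x - g v)" by (simp add: algebra_simps)
    also have "\<dots> = (\<Sum>j\<in>J. c j x * z j x) * g x + f v * (\<Sum>j\<in>J. d j x * z j x)"
      using x c(2) d(2) by metis
    also have "\<dots> = (\<Sum>j\<in>J. (c j x * g x + f v * d j x) * z j x)"
      by (simp add: sum_distrib_left sum_distrib_right sum.distrib algebra_simps)
    finally show "f x * g x - f v * g v = (\<Sum>j\<in>J. (c j x * g x + f v * d j x) * z j x)" .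
  next
    fix j assume "j \<in> J"
    then show "real_polynomial_function (\<lambda>x. c j x * g x + f v * d j x)"
      using c(1) d(1) by (intro polyf_intros mult.hyps) auto
  qed
qed

lemma polyf_sumsq: "chart v J z \<Longrightarrow> real_polynomial_function (sumsq J z)"
  unfolding sumsq_def[abs_def] chart_def by (intro polyf_intros) auto

lemma sumsq_nonneg: "0 \<le> sumsq J z x"
  by (simp add: sumsq_def sum_nonneg)

lemma sumsq_centre: "chart v J z \<Longrightarrow> sumsq J z v = 0"
  by (simp add: sumsq_def chart_def)

lemma sumsq_pos:
  assumes ch: "chart v J z" and x: "x \<in> std_simplex" "x \<noteq> v"
  shows "0 < sumsq J z x"
proof (rule ccontr)
  assume "\<not> 0 < sumsq J z x"
  then have "sumsq J z x = 0" using sumsq_nonneg[of J z x] by simp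
  then have "\<forall>j\<in>J. z j x = 0" using ch by (simp add: sumsq_def sum_nonneg_eq_0_iff chart_def)
  then have "x $ i - v $ i = 0" for i
    using ch x(1) unfolding chart_def std_simplex_def by (metis (no_types, lifting) mem_Collect_eq mult_zero_right sum.neutral)
  then have "x = v" by (simp add: vec_eq_iff)
  then show False using x by simp
qed

lemma QM_sumsq_mult:
  assumes "chart v J z" "F \<in> QM" shows "(\<lambda>x. sumsq J z x * F x) \<in> QM"
proof -
  have "(\<lambda>x. \<Sum>j\<in>J. (z j x)\<^sup>2 * F x) \<in> QM"
    using assms by (intro QM_sum QM_square_mult) (auto simp: chart_def)
  then show ?thesis by (simp add: sumsq_def sum_distrib_right)
qed

lemma QM_sumsq_minus_square:
  assumes "chart v J z" "j \<in> J" shows "(\<lambda>x. sumsq J z x - (z j x)\<^sup>2) \<in> QM"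
proof -
  have "(\<lambda>x. \<Sum>j\<in>J-{j}. (z j x)\<^sup>2) \<in> QM"
    using assms by (intro QM_sum QM.square) (auto simp: chart_def)
  then show ?thesis using assms by (simp add: sumsq_def sum_diff1 chart_def)
qed

text \<open>Polarisation: z_j z_k is the difference of the squares of (z_j + z_k)/2 and (z_j -
  z_k)/2, and the sum of these squares is (z_j^2 + z_k^2)/2, at most
  \<open>sumsq J z\<close>.\<close>

lemma QM_absorb:
  assumes ch: "chart v J z" and j: "j \<in> J" "k \<in> J"
    and q: "(\<lambda>x. e + q x) \<in> QM" "(\<lambda>x. e - q x) \<in> QM" and e: "0 \<le> e"
  shows "(\<lambda>x. q x * (z j x * z k x) + e * sumsq J z x) \<in> QM"
proof -
  have p: "real_polynomial_function (z j)" "real_polynomial_function (z k)" using ch j by (auto simp: chart_def)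
  have "(\<lambda>x. (((z j x + z k x) / 2)\<^sup>2 * (e + q x) + ((z j x - z k x) / 2)\<^sup>2 * (e - q x)) +
     (e/2) * ((sumsq J z x - (z j x)\<^sup>2) + (sumsq J z x - (z k x)\<^sup>2))) \<in> QM"
    using e by (intro QM.add[OF QM.add[OF QM_square_mult[OF q(1)] QM_square_mult[OF q(2)]]
          QM_cmult[OF QM.add[OF QM_sumsq_minus_square[OF ch j(1)] QM_sumsq_minus_square[OF ch j(2)]]]]
        real_polynomial_function_divide polyf_intros p) auto
  then show ?thesis
    by (rule QM.cong) (simp add: power2_eq_square field_simps)
qed

section \<open>Localisation at a zero\<close>

text \<open>A peak at the centre of the chart: 1 there and, when R bounds \<open>sumsq J z\<close>
  on the simplex, tending to 0 elsewhere on it as m grows. It is a square, so multiplying by it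
  stays inside the module.\<close>

definition bump :: "'j set \<Rightarrow> ('j \<Rightarrow> 'n rfun) \<Rightarrow> real \<Rightarrow> nat \<Rightarrow> real^'n::finite \<Rightarrow> real" where
  "bump J z R m x = ((1 - sumsq J z x / R) ^ m)\<^sup>2"

lemma polyf_bump_root:
  "chart v J z \<Longrightarrow> real_polynomial_function (\<lambda>x. (1 - sumsq J z x / R) ^ m)"
  by (intro polyf_intros real_polynomial_function_divide polyf_sumsq)

lemma polyf_bump: "chart v J z \<Longrightarrow> real_polynomial_function (bump J z R m)"
  unfolding bump_def[abs_def] by (intro polyf_intros(7) polyf_bump_root)

lemma bump_nonneg: "0 \<le> bump J z R m x"
  by (simp add: bump_def)

lemma bump_centre: "chart v J z \<Longrightarrow> bump J z R m v = 1"
  by (simp add: bump_def sumsq_centre)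

definition chart_radius :: "'j set \<Rightarrow> ('j \<Rightarrow> 'n::finite rfun) \<Rightarrow> real \<Rightarrow> bool" where
  "chart_radius J z R \<longleftrightarrow> 0 < R \<and> (\<forall>x\<in>std_simplex. sumsq J z x \<le> R)"

lemma chart_radius_exists: "chart v J z \<Longrightarrow> \<exists>R. chart_radius J z R"
  using polyf_bounded_simplex[OF polyf_sumsq] unfolding chart_radius_def by (metis abs_le_D1)

lemma bump_le_one:
  assumes "chart_radius J z R" "x \<in> std_simplex" shows "bump J z R m x \<le> 1"
proof -
  have "0 \<le> 1 - sumsq J z x / R" "1 - sumsq J z x / R \<le> 1"
    using assms sumsq_nonneg[of J z x] by (auto simp: chart_radius_def)
  then show ?thesis by (simp add: bump_def power_le_one flip: power_mult)
qed

text \<open>Near v the factor q is small by continuity; away from v \<open>sumsq J z\<close> has a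
  positive minimum by compactness, so the peak decays geometrically and uniformly.\<close>

lemma eventually_bump_mult_le:
  assumes ch: "chart v J z" and R: "chart_radius J z R"
    and q: "real_polynomial_function q" "q v = 0" and e: "0 < e"
  shows "\<forall>\<^sub>F m in sequentially. \<forall>x\<in>std_simplex. \<bar>bump J z R m x * q x\<bar> \<le> e"
proof -
  have "isCont q v" using q(1) by (rule continuous_real_polymonial_function)
  then obtain d where d: "0 < d" "\<And>x. dist x v < d \<Longrightarrow> \<bar>q x\<bar> < e"
    using e q(2) unfolding continuous_at_eps_delta by (metis dist_real_def diff_zero)
  define K where "K = std_simplex \<inter> {x. d \<le> dist x v}"
  have K: "compact K"
    unfolding K_def by (intro compact_Int_closed compact_std_simplex closed_Collect_le continuous_intros)
  obtain B where B: "0 < B" "\<And>x. x \<in> std_simplex \<Longrightarrow> \<bar>q x\<bar> \<le> B"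
    using polyf_bounded_simplex[OF q(1)] by blast
  obtain \<mu> where \<mu>: "0 < \<mu>" "\<mu> \<le> R" "\<And>x. x \<in> K \<Longrightarrow> \<mu> \<le> sumsq J z x"
  proof (cases "K = {}")
    case True then show ?thesis using R that[of R] by (auto simp: chart_radius_def)
  next
    case False
    from continuous_attains_inf[OF K False continuous_on_polyf[OF polyf_sumsq[OF ch]]]
    obtain y where y: "y \<in> K" "\<And>x. x \<in> K \<Longrightarrow> sumsq J z y \<le> sumsq J z x" by blast
    then have "y \<in> std_simplex" "y \<noteq> v" using d(1) by (auto simp: K_def)
    then show ?thesis
      using sumsq_pos[OF ch] y R by (intro that[of "sumsq J z y"]) (auto simp: chart_radius_def)
  qed
  define t where "t = (1 - \<mu> / R)\<^sup>2"
  have mR: "0 \<le> 1 - \<mu> / R" "1 - \<mu> / R < 1" using \<mu> R by (auto simp: chart_radius_def)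
  then have t: "0 \<le> t" "t < 1" by (auto simp: t_def power_less_one_iff)
  have "(\<lambda>m. t ^ m * B) \<longlonglongrightarrow> 0 * B" using t by (intro tendsto_mult LIMSEQ_power_zero tendsto_const) auto
  then have "\<forall>\<^sub>F m in sequentially. t ^ m * B < e" using e by (intro order_tendstoD) auto
  then show ?thesis
  proof eventually_elim
    case (elim m)
    show ?case
    proof
      fix x :: "real^'a" assume x: "x \<in> std_simplex"
      show "\<bar>bump J z R m x * q x\<bar> \<le> e"
      proof (cases "dist x v < d")
        case True
        have "\<bar>bump J z R m x * q x\<bar> \<le> 1 * \<bar>q x\<bar>"
          unfolding abs_mult using bump_le_one[OF R x, of m] bump_nonneg[of J z R m x]
          by (intro mult_right_mono) auto
        then show ?thesis using d(2)[OF True] by simp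
      next
        case False
        then have "x \<in> K" using x by (simp add: K_def)
        have "sumsq J z x \<le> R" "0 < R" using R x by (auto simp: chart_radius_def)
        then have "0 \<le> 1 - sumsq J z x / R" "1 - sumsq J z x / R \<le> 1 - \<mu> / R"
          using \<mu>(3)[OF \<open>x \<in> K\<close>] by (auto simp: divide_right_mono)
        then have "(1 - sumsq J z x / R) ^ (2 * m) \<le> (1 - \<mu> / R) ^ (2 * m)" by (rule power_mono[rotated])
        then have "bump J z R m x \<le> t ^ m"
          by (simp add: bump_def t_def mult.commute flip: power_mult)
        then have "\<bar>bump J z R m x * q x\<bar> \<le> t ^ m * B"
          unfolding abs_mult using B(2)[OF x] bump_nonneg[of J z R m x] t by (intro mult_mono) auto
        then show ?thesis using elim by simp
      qed
    qed
  qed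
qed

text \<open>A one-sided notion: after localisation p is nonnegative up to an arbitrarily small
  multiple of \<open>sumsq J z\<close>. Asking for it for all large m makes it additive.\<close>

definition negligible_at :: "'j set \<Rightarrow> ('j \<Rightarrow> 'n rfun) \<Rightarrow> real \<Rightarrow> 'n::finite rfun \<Rightarrow> bool" where
  "negligible_at J z R p \<longleftrightarrow>
    (\<forall>e>0. \<forall>\<^sub>F m in sequentially. (\<lambda>x. bump J z R m x * p x + e * sumsq J z x) \<in> QM)"

lemma negligible_add:
  assumes "negligible_at J z R p" "negligible_at J z R q"
  shows "negligible_at J z R (\<lambda>x. p x + q x)"
  unfolding negligible_at_def
proof (intro allI impI)
  fix e :: real assume "0 < e"
  then have "0 < e / 2" by simp
  then have "\<forall>\<^sub>F m in sequentially. (\<lambda>x. bump J z R m x * p x + e/2 * sumsq J z x) \<in> QM"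
    "\<forall>\<^sub>F m in sequentially. (\<lambda>x. bump J z R m x * q x + e/2 * sumsq J z x) \<in> QM"
    using assms unfolding negligible_at_def by blast+
  then show "\<forall>\<^sub>F m in sequentially. (\<lambda>x. bump J z R m x * (p x + q x) + e * sumsq J z x) \<in> QM"
  proof eventually_elim
    case (elim m)
    show ?case by (rule QM.cong[OF QM.add[OF elim]]) (simp add: algebra_simps)
  qed
qed

lemma negligible_sum:
  assumes ch: "chart v J z" and "finite A" "\<And>a. a \<in> A \<Longrightarrow> negligible_at J z R (p a)"
  shows "negligible_at J z R (\<lambda>x. \<Sum>a\<in>A. p a x)"
  using assms(2,3)
proof (induction A rule: finite_induct)
  case empty
  have "(\<lambda>x. sumsq J z x * e) \<in> QM" if "0 < e" for e
    using QM_sumsq_mult[OF ch QM_const[of e]] that by simp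
  then show ?case by (simp add: negligible_at_def mult.commute)
next
  case (insert a A)
  then have "negligible_at J z R (\<lambda>x. p a x + (\<Sum>a\<in>A. p a x))" by (intro negligible_add) auto
  then show ?case using insert.hyps by simp
qed

lemma negligible_cong:
  assumes "negligible_at J z R p" "\<And>x. x \<in> hyperplane1 \<Longrightarrow> p x = q x"
  shows "negligible_at J z R q"
  unfolding negligible_at_def
proof (intro allI impI)
  fix e :: real assume "0 < e"
  then have "\<forall>\<^sub>F m in sequentially. (\<lambda>x. bump J z R m x * p x + e * sumsq J z x) \<in> QM"
    using assms unfolding negligible_at_def by blast
  then show "\<forall>\<^sub>F m in sequentially. (\<lambda>x. bump J z R m x * q x + e * sumsq J z x) \<in> QM"
    by eventually_elim (rule QM.cong, assumption, simp add: assms)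
qed

lemma negligible_cubic:
  assumes ch: "chart v J z" and R: "chart_radius J z R" and j: "j \<in> J" "k \<in> J"
    and q: "real_polynomial_function q" "q v = 0"
  shows "negligible_at J z R (\<lambda>x. q x * (z j x * z k x))"
  unfolding negligible_at_def
proof (intro allI impI)
  fix e :: real assume e: "0 < e"
  have "\<forall>\<^sub>F m in sequentially. \<forall>x\<in>std_simplex. \<bar>bump J z R m x * q x\<bar> \<le> e / 4"
    using e by (intro eventually_bump_mult_le[OF ch R q]) auto
  then show "\<forall>\<^sub>F m in sequentially. (\<lambda>x. bump J z R m x * (q x * (z j x * z k x)) + e * sumsq J z x) \<in> QM"
  proof eventually_elim
    case (elim m)
    let ?q = "\<lambda>x. bump J z R m x * q x"
    have p: "real_polynomial_function ?q" by (intro polyf_intros polyf_bump[OF ch] q)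
    have b: "- (e / 2) < ?q x" "- (e / 2) < - ?q x" if "x \<in> std_simplex" for x
      using elim[rule_format, OF that] e unfolding abs_le_iff by linarith+
    have "(\<lambda>x. ?q x + 2 * (e / 2)) \<in> QM" by (rule QM_of_nonneg[OF p b(1)]) (use e in auto)
    moreover have "(\<lambda>x. - ?q x + 2 * (e / 2)) \<in> QM"
      by (rule QM_of_nonneg[OF _ b(2)]) (use e p in \<open>auto intro: polyf_intros\<close>)
    ultimately have "(\<lambda>x. e + ?q x) \<in> QM" "(\<lambda>x. e - ?q x) \<in> QM" by (simp_all add: add.commute)
    from QM_absorb[OF ch j this less_imp_le[OF e]] show ?case by (simp add: mult.assoc)
  qed
qed

text \<open>The peak times a is nonnegative, hence in \<open>QMc\<close>; its constant error gets
  multiplied by the square of z_j and so stays below a multiple of \<open>sumsq J z\<close>.\<close>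

lemma negligible_nonneg_square:
  assumes ch: "chart v J z" and j: "j \<in> J"
    and a: "real_polynomial_function a" "\<And>x. x \<in> std_simplex \<Longrightarrow> 0 \<le> a x"
  shows "negligible_at J z R (\<lambda>x. a x * (z j x)\<^sup>2)"
  unfolding negligible_at_def
proof (intro allI impI always_eventually)
  fix e :: real and m assume e: "0 < e"
  have "(\<lambda>x. bump J z R m x * a x) \<in> QMc"
    using a by (intro nonneg_imp_QMc polyf_intros polyf_bump[OF ch] mult_nonneg_nonneg bump_nonneg) auto
  from QM.add[OF QM_square_mult[OF QMcD[OF this e], of "z j"] QM_cmult[OF QM_sumsq_minus_square[OF ch j], of e]] e ch j
  have "(\<lambda>x. (z j x)\<^sup>2 * (bump J z R m x * a x + e) + e * (sumsq J z x - (z j x)\<^sup>2)) \<in> QM"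
    by (simp add: chart_def)
  then show "(\<lambda>x. bump J z R m x * (a x * (z j x)\<^sup>2) + e * sumsq J z x) \<in> QM"
    by (rule QM.cong) (simp add: algebra_simps)
qed

lemma negligible_square_coord:
  assumes ch: "chart v J z" and p: "real_polynomial_function p"
  shows "negligible_at J z R (\<lambda>x. (p x)\<^sup>2 * x $ i)"
  unfolding negligible_at_def
proof (intro allI impI always_eventually)
  fix e :: real and m assume e: "0 < e"
  have "(\<lambda>x. ((1 - sumsq J z x / R) ^ m * p x)\<^sup>2 * x $ i + sumsq J z x * e) \<in> QM"
    using e by (intro QM.add QM.square_coord QM_sumsq_mult[OF ch] QM_const polyf_intros polyf_bump_root[OF ch] p) auto
  then show "(\<lambda>x. bump J z R m x * ((p x)\<^sup>2 * x $ i) + e * sumsq J z x) \<in> QM"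
    by (rule QM.cong) (simp add: bump_def power_mult_distrib)
qed

text \<open>With \<open>\<beta> = b v\<close> we have \<open>b = ((\<beta> + b) / (2 sqrt \<beta>))\<^sup>2 - (b - \<beta>)\<^sup>2 / (4\<beta>)\<close>:
  to second order at \<open>v\<close> the multiplier \<open>b\<close> is a square.\<close>

lemma negligible_pos_coord:
  assumes ch: "chart v J z" and R: "chart_radius J z R"
    and b: "real_polynomial_function b" "0 < b v" and i: "v $ i = 0"
  shows "negligible_at J z R (\<lambda>x. b x * x $ i)"
proof -
  define \<beta> where "\<beta> = b v"
  have \<beta>: "0 < \<beta>" using b by (simp add: \<beta>_def)
  obtain c where c: "\<And>j. j \<in> J \<Longrightarrow> real_polynomial_function (c j)"
    "\<And>x. x \<in> hyperplane1 \<Longrightarrow> b x - \<beta> = (\<Sum>j\<in>J. c j x * z j x)"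
    using chart_generates[OF ch b(1)] unfolding \<beta>_def by blast
  have fin: "finite J" using ch by (simp add: chart_def)
  let ?p = "\<lambda>x. (\<beta> + b x) / (2 * sqrt \<beta>)"
  \<comment> \<open>The correction -(b - \<beta>)^2 x_i / (4 \<beta>) is quadratic in the chart
    functions, and its coefficients carry the factor x_i, which vanishes at v. Hence
    \<open>negligible_cubic\<close> applies.\<close>
  let ?q = "\<lambda>j k x. - 1 / (4 * \<beta>) * (c j x * c k x * x $ i)"
  have "negligible_at J z R (\<lambda>x. (?p x)\<^sup>2 * x $ i + (\<Sum>j\<in>J. \<Sum>k\<in>J. ?q j k x * (z j x * z k x)))"
    by (intro negligible_add negligible_square_coord[OF ch] negligible_sum[OF ch] negligible_cubic[OF ch R]
        fin real_polynomial_function_divide polyf_intros b c) (use i in auto)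
  then show ?thesis
  proof (rule negligible_cong)
    fix x :: "real^'a" assume x: "x \<in> hyperplane1"
    have "(b x - \<beta>)\<^sup>2 = (\<Sum>j\<in>J. \<Sum>k\<in>J. c j x * c k x * (z j x * z k x))"
      unfolding c(2)[OF x] power2_eq_square sum_product by (simp add: mult_ac)
    then have "(\<Sum>j\<in>J. \<Sum>k\<in>J. ?q j k x * (z j x * z k x)) = - 1 / (4 * \<beta>) * x $ i * (b x - \<beta>)\<^sup>2"
      by (simp add: sum_distrib_left mult_ac)
    moreover have "(?p x)\<^sup>2 = (\<beta> + b x)\<^sup>2 / (4 * \<beta>)" using \<beta> by (simp add: power_divide power_mult_distrib)
    ultimately have "(?p x)\<^sup>2 * x $ i + (\<Sum>j\<in>J. \<Sum>k\<in>J. ?q j k x * (z j x * z k x)) =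
        ((\<beta> + b x)\<^sup>2 - (b x - \<beta>)\<^sup>2) / (4 * \<beta>) * x $ i"
      by (simp only: diff_divide_distrib left_diff_distrib) simp
    also have "((\<beta> + b x)\<^sup>2 - (b x - \<beta>)\<^sup>2) / (4 * \<beta>) = b x"
      using \<beta> by (simp add: power2_eq_square field_simps)
    finally show "(?p x)\<^sup>2 * x $ i + (\<Sum>j\<in>J. \<Sum>k\<in>J. ?q j k x * (z j x * z k x)) = b x * x $ i" .
  qed
qed

lemma negligible_pos_form:
  assumes ch: "chart v J z" and R: "chart_radius J z R" and f: "pos_form v J z f"
  shows "negligible_at J z R f"
proof -
  from f obtain L a b \<iota> where "pos_decomp v J z f L a b \<iota>"
    unfolding pos_form_def by (elim exE)
  note D = pos_decompD[OF this]
  have "finite J" using ch by (simp add: chart_def)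
  then have "negligible_at J z R (\<lambda>x. (\<Sum>j\<in>J. a j x * (z j x)\<^sup>2) + (\<Sum>j\<in>L. b j x * x $ \<iota> j))"
    by (intro negligible_add negligible_sum[OF ch] negligible_nonneg_square[OF ch] negligible_pos_coord[OF ch R] D)
  then show ?thesis by (rule negligible_cong) (simp add: D(7))
qed

text \<open>Split f into peak times f and the rest. The rest is \<open>sumsq J z\<close> times h f
  with h a nonnegative geometric sum, so the constant error in approximating h f is itself
  multiplied by \<open>sumsq J z\<close>.\<close>

lemma single_zero:
  fixes f :: "'n::finite rfun"
  assumes ch: "chart v J z" and f: "pos_form v J z f"
    and p: "real_polynomial_function f" and pos: "\<And>x. x \<in> std_simplex \<Longrightarrow> 0 \<le> f x" and e: "0 < e"
  shows "(\<lambda>x. f x + e * sumsq J z x) \<in> QM"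
proof -
  obtain R where R: "chart_radius J z R" using chart_radius_exists[OF ch] by blast
  then have R0: "0 < R" by (simp add: chart_radius_def)
  have "0 < e / 2" using e by simp
  then have "\<forall>\<^sub>F m in sequentially. (\<lambda>x. bump J z R m x * f x + e / 2 * sumsq J z x) \<in> QM"
    using negligible_pos_form[OF ch R f] unfolding negligible_at_def by blast
  then obtain m where m: "(\<lambda>x. bump J z R m x * f x + e / 2 * sumsq J z x) \<in> QM"
    by (auto simp: eventually_sequentially)
  define h where "h x = (1 / R) * (\<Sum>i<2*m. (1 - sumsq J z x / R) ^ i)" for x
  have h: "real_polynomial_function h" "\<And>x. x \<in> std_simplex \<Longrightarrow> 0 \<le> h x"
  proof -
    show "real_polynomial_function h"
      unfolding h_def[abs_def] by (intro polyf_intros real_polynomial_function_divide polyf_sumsq[OF ch]) auto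
    show "0 \<le> h x" if "x \<in> std_simplex" for x
    proof -
      have "0 \<le> 1 - sumsq J z x / R" using R that by (simp add: chart_radius_def)
      then show ?thesis using R0 by (simp add: h_def sum_nonneg)
    qed
  qed
  have bump: "1 - bump J z R m x = sumsq J z x * h x" for x
  proof -
    have "bump J z R m x = (1 - sumsq J z x / R) ^ (2 * m)"
      by (simp add: bump_def mult.commute flip: power_mult)
    then show ?thesis
      using one_diff_power_eq[of "1 - sumsq J z x / R" "2 * m"] by (simp add: h_def)
  qed
  have "(\<lambda>x. h x * f x) \<in> QMc"
    using h pos by (intro nonneg_imp_QMc polyf_intros p) auto
  from QM.add[OF m QM_sumsq_mult[OF ch QMcD[OF this \<open>0 < e / 2\<close>]]] show ?thesis
  proof (rule QM.cong)
    fix x :: "real^'n"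
    have "bump J z R m x * f x + e / 2 * sumsq J z x + sumsq J z x * (h x * f x + e / 2) =
      bump J z R m x * f x + (sumsq J z x * h x) * f x + e * sumsq J z x" by (simp add: algebra_simps)
    also have "\<dots> = f x + e * sumsq J z x" unfolding bump[symmetric] by (simp add: algebra_simps)
    finally show "bump J z R m x * f x + e / 2 * sumsq J z x + sumsq J z x * (h x * f x + e / 2) =
      f x + e * sumsq J z x" .
  qed
qed

section \<open>Finitely many zeros\<close>

text \<open>The square of p is a quadratic form in the chart functions with bounded coefficients,
  and \<open>QM_absorb\<close> takes care of each entry.\<close>

lemma chart_square_bounded:
  assumes ch: "chart v J z" and p: "real_polynomial_function p" "p v = 0"
  shows "\<exists>C>0. (\<lambda>x. C * sumsq J z x - (p x)\<^sup>2) \<in> QM"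
proof -
  obtain c where c: "\<And>j. j \<in> J \<Longrightarrow> real_polynomial_function (c j)"
    "\<And>x. x \<in> hyperplane1 \<Longrightarrow> p x = (\<Sum>j\<in>J. c j x * z j x)"
    using chart_generates[OF ch p(1)] p(2) by auto
  have "\<exists>r>0. QM_bound r (\<lambda>x. c j x * c k x)" if "j \<in> J" "k \<in> J" for j k
    by (intro QM_bound_exists polyf_intros c that)
  then obtain r where r: "\<And>j k. j \<in> J \<Longrightarrow> k \<in> J \<Longrightarrow> 0 < r j k"
    "\<And>j k. j \<in> J \<Longrightarrow> k \<in> J \<Longrightarrow> QM_bound (r j k) (\<lambda>x. c j x * c k x)" by metis
  have fin: "finite J" using ch by (simp add: chart_def)
  define C where "C = (\<Sum>j\<in>J. \<Sum>k\<in>J. r j k)"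
  have C: "0 \<le> C" unfolding C_def using r(1) by (intro sum_nonneg) (auto intro: less_imp_le)
  have a: "(\<lambda>x. - (c j x * c k x) * (z j x * z k x) + r j k * sumsq J z x) \<in> QM" if "j \<in> J" "k \<in> J" for j k
    using r(2)[OF that] r(1)[OF that] by (intro QM_absorb[OF ch that]) (auto simp: QM_bound_def)
  have "(\<lambda>x. (\<Sum>j\<in>J. \<Sum>k\<in>J. - (c j x * c k x) * (z j x * z k x) + r j k * sumsq J z x) + sumsq J z x * 1) \<in> QM"
    by (intro QM.add[OF QM_sum[OF fin QM_sum[OF fin a]] QM_sumsq_mult[OF ch QM_const]]) simp_all
  then have "(\<lambda>x. (C + 1) * sumsq J z x - (p x)\<^sup>2) \<in> QM"
  proof (rule QM.cong)
    fix x :: "real^'a" assume x: "x \<in> hyperplane1"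
    have "(p x)\<^sup>2 = (\<Sum>j\<in>J. \<Sum>k\<in>J. c j x * c k x * (z j x * z k x))"
      unfolding c(2)[OF x] power2_eq_square sum_product by (simp add: mult_ac)
    then show "(\<Sum>j\<in>J. \<Sum>k\<in>J. - (c j x * c k x) * (z j x * z k x) + r j k * sumsq J z x) + sumsq J z x * 1 =
        (C + 1) * sumsq J z x - (p x)\<^sup>2"
      by (simp add: sum.distrib sum_negf sum_subtractf C_def sum_distrib_right distrib_right)
  qed
  then show ?thesis using C by (intro exI[of _ "C + 1"]) auto
qed

definition prod_sumsq :: "('k \<Rightarrow> 'j set) \<Rightarrow> ('k \<Rightarrow> 'j \<Rightarrow> 'n rfun) \<Rightarrow> 'k set \<Rightarrow> real^'n::finite \<Rightarrow> real" where
  "prod_sumsq J z S x = (\<Prod>k\<in>S. sumsq (J k) (z k) x)"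

lemma prod_sumsq_nonneg: "0 \<le> prod_sumsq J z S x"
  by (simp add: prod_sumsq_def prod_nonneg sumsq_nonneg)

lemma prod_sumsq_insert:
  "finite S \<Longrightarrow> k \<notin> S \<Longrightarrow> prod_sumsq J z (insert k S) x = sumsq (J k) (z k) x * prod_sumsq J z S x"
  by (simp add: prod_sumsq_def)

lemma polyf_prod_sumsq:
  assumes "finite S" "\<And>k. k \<in> S \<Longrightarrow> chart (v k) (J k) (z k)"
  shows "real_polynomial_function (prod_sumsq J z S)"
  unfolding prod_sumsq_def[abs_def]
  by (intro real_polynomial_function_prod assms(1) polyf_sumsq[OF assms(2)])

lemma QM_prod_sumsq_mult:
  assumes "finite S" "\<And>k. k \<in> S \<Longrightarrow> chart (v k) (J k) (z k)" "F \<in> QM"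
  shows "(\<lambda>x. prod_sumsq J z S x * F x) \<in> QM"
  using assms(1,2)
proof (induction S rule: finite_induct)
  case empty then show ?case using assms(3) by (simp add: prod_sumsq_def)
next
  case (insert k S)
  then have "(\<lambda>x. sumsq (J k) (z k) x * (prod_sumsq J z S x * F x)) \<in> QM"
    by (intro QM_sumsq_mult[of "v k"]) auto
  then show ?case using insert.hyps by (simp add: prod_sumsq_insert mult.assoc)
qed

text \<open>Take a cut-off u that is a multiple of the old product G and equals 1 at the new zero,
  and write f = (1 - u)^2 f + u (2 - u) f. In the first part the error of the induction hypothesis
  is multiplied by (1 - u)^2, hence bounded by a multiple of the new w_k. The second part has the
  factor G and needs only the local result at the new zero.\<close>

lemma multiple_zeros:
  fixes f :: "'n::finite rfun"
  assumes p: "real_polynomial_function f" and pos: "\<And>x. x \<in> std_simplex \<Longrightarrow> 0 \<le> f x"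
    and "finite S" "\<And>k. k \<in> S \<Longrightarrow> chart (v k) (J k) (z k)" "inj_on v S"
    and "\<And>k. k \<in> S \<Longrightarrow> pos_form (v k) (J k) (z k) f" and "0 < e"
  shows "(\<lambda>x. f x + e * prod_sumsq J z S x) \<in> QM"
  using assms(3-)
proof (induction S arbitrary: e rule: finite_induct)
  case empty
  have "f \<in> QMc" by (rule nonneg_imp_QMc[OF p pos])
  then show ?case using empty by (simp add: prod_sumsq_def QMcD)
next
  case (insert k S)
  define G where "G = prod_sumsq J z S"
  have ch: "chart (v k) (J k) (z k)" and chS: "\<And>l. l \<in> S \<Longrightarrow> chart (v l) (J l) (z l)"
    using insert.prems by auto
  have vk: "v k \<in> std_simplex" using ch by (simp add: chart_def)
  have pG: "real_polynomial_function G"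
    unfolding G_def by (rule polyf_prod_sumsq[OF insert.hyps(1) chS])
  have G0: "0 \<le> G x" for x by (simp add: G_def prod_sumsq_nonneg)
  define c where "c = G (v k)"
  have "0 < sumsq (J l) (z l) (v k)" if "l \<in> S" for l
  proof (rule sumsq_pos[OF chS[OF that] vk])
    show "v k \<noteq> v l" using insert.prems(2) insert.hyps(2) that by (auto simp: inj_on_def)
  qed
  then have c: "0 < c" by (simp add: c_def G_def prod_sumsq_def prod_pos)
  obtain R where R: "chart_radius (J k) (z k) R" using chart_radius_exists[OF ch] by blast
  let ?b = "bump (J k) (z k) R"
  have "\<forall>\<^sub>F m in sequentially. \<forall>x\<in>std_simplex. \<bar>?b m x * (G x / c - 1)\<bar> \<le> 1"
    by (intro eventually_bump_mult_le[OF ch R] polyf_intros real_polynomial_function_divide pG)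
      (use c in \<open>auto simp: c_def\<close>)
  \<comment> \<open>For this exponent u = G * peak / c exceeds the peak by at most 1, so 2 - u is
    nonnegative on the simplex.\<close>
  then obtain m where m: "\<And>x. x \<in> std_simplex \<Longrightarrow> \<bar>?b m x * (G x / c - 1)\<bar> \<le> 1"
    by (auto simp: eventually_sequentially)
  define u' where "u' x = ?b m x / c" for x
  define u where "u x = G x * u' x" for x
  have pu': "real_polynomial_function u'"
    unfolding u'_def[abs_def] by (intro real_polynomial_function_divide polyf_bump[OF ch])
  have pu: "real_polynomial_function u"
    unfolding u_def[abs_def] by (intro polyf_intros pG pu')
  have u2: "u x \<le> 2" if "x \<in> std_simplex" for x
  proof -
    have "u x = ?b m x * (G x / c - 1) + ?b m x"
      using c by (simp add: u_def u'_def field_simps)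
    then show ?thesis using m[OF that] bump_le_one[OF R that, of m] by (simp add: abs_le_iff)
  qed
  have u1: "u (v k) = 1" "u' (v k) = 1 / c"
    using c by (simp_all add: u_def u'_def bump_centre[OF ch] flip: c_def)
  have "real_polynomial_function (\<lambda>x. 1 - u x)" by (intro polyf_intros pu)
  from chart_square_bounded[OF ch this] u1 obtain C where C: "0 < C"
    "(\<lambda>x. C * sumsq (J k) (z k) x - (1 - u x)\<^sup>2) \<in> QM" by auto
  \<comment> \<open>Half of e pays for the induction hypothesis after multiplication by (1 - u)^2,
    half for the local part.\<close>
  define d where "d = e / (2 * C)"
  have d: "0 < d" "d * C = e / 2" using C insert.prems by (auto simp: d_def)
  have "(\<lambda>x. f x + d * G x) \<in> QM"
    unfolding G_def using insert.prems d by (intro insert.IH) auto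
  then have 1: "(\<lambda>x. (1 - u x)\<^sup>2 * (f x + d * G x)) \<in> QM"
    by (rule QM_square_mult) (intro polyf_intros pu)
  have 2: "(\<lambda>x. d * (G x * (C * sumsq (J k) (z k) x - (1 - u x)\<^sup>2))) \<in> QM"
    unfolding G_def using d by (intro QM_cmult QM_prod_sumsq_mult[OF insert.hyps(1) chS C(2)]) auto
  define g where "g x = u' x * (2 - u x)" for x
  have pg: "real_polynomial_function g" unfolding g_def[abs_def] by (intro polyf_intros pu pu')
  have g0: "0 \<le> g x" if "x \<in> std_simplex" for x
    using u2[OF that] c by (simp add: g_def u'_def bump_nonneg)
  have "(\<lambda>x. g x * f x + e / 2 * sumsq (J k) (z k) x) \<in> QM"
  proof (rule single_zero[OF ch])
    show "pos_form (v k) (J k) (z k) (\<lambda>x. g x * f x)"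
      using insert.prems u1 c by (intro pos_form_mult pg g0) (auto simp: g_def)
    show "real_polynomial_function (\<lambda>x. g x * f x)" by (intro polyf_intros pg p)
  qed (use g0 pos insert.prems in auto)
  then have 3: "(\<lambda>x. G x * (g x * f x + e / 2 * sumsq (J k) (z k) x)) \<in> QM"
    unfolding G_def by (intro QM_prod_sumsq_mult[OF insert.hyps(1) chS])
  from QM.add[OF QM.add[OF 1 2] 3] show ?case
  proof (rule QM.cong)
    fix x :: "real^'n"
    let ?w = "sumsq (J k) (z k) x"
    have "(1 - u x)\<^sup>2 * (f x + d * G x) + d * (G x * (C * ?w - (1 - u x)\<^sup>2)) + G x * (g x * f x + e / 2 * ?w)
      = ((1 - u x)\<^sup>2 + G x * g x) * f x + (d * C + e / 2) * (?w * G x)"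
      by (simp add: algebra_simps)
    also have "(1 - u x)\<^sup>2 + G x * g x = 1"
      by (simp add: g_def u_def power2_eq_square algebra_simps)
    finally show "(1 - u x)\<^sup>2 * (f x + d * G x) + d * (G x * (C * ?w - (1 - u x)\<^sup>2)) + G x * (g x * f x + e / 2 * ?w)
      = f x + e * prod_sumsq J z (insert k S) x"
      using d insert.hyps by (simp add: prod_sumsq_insert G_def)
  qed
qed

text \<open>In coordinates \<open>z\<close> around \<open>v\<close> the function is a nondegenerate quadratic form plus a combination
  of the boundary coordinates \<open>x $ \<iota> j\<close> whose coefficients are positive at \<open>v\<close>: Marshall's boundary
  Hessian condition.\<close>

definition boundary_hessian :: "'n::finite rfun \<Rightarrow> real^'n \<Rightarrow> 'j set \<Rightarrow> ('j \<Rightarrow> 'n rfun) \<Rightarrow>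
    'j set \<Rightarrow> ('j \<Rightarrow> 'n rfun) \<Rightarrow> ('j \<Rightarrow> 'n) \<Rightarrow> bool" where
  "boundary_hessian f v J z L b \<iota> \<longleftrightarrow> chart v J z \<and> L \<subseteq> J \<and>
    (\<forall>j\<in>L. z j = (\<lambda>x. x $ \<iota> j) \<and> real_polynomial_function (b j) \<and> 0 < b j v) \<and>
    (\<forall>x\<in>hyperplane1. f x = (\<Sum>j\<in>J-L. (z j x)\<^sup>2) + (\<Sum>j\<in>L. b j x * x $ \<iota> j))"

theorem finite_zeros_imp_QM:
  fixes f :: "'n::finite rfun"
  assumes p: "real_polynomial_function f" and K: "finite K" and inj: "inj_on v K"
    and bh: "\<And>k. k \<in> K \<Longrightarrow> boundary_hessian f (v k) (J k) (z k) (L k) (b k) (\<iota> k)"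
    and pos: "\<And>x. x \<in> std_simplex \<Longrightarrow> x \<notin> v ` K \<Longrightarrow> 0 < f x"
  shows "f \<in> QM"
proof -
  have ch: "chart (v k) (J k) (z k)" if "k \<in> K" for k using bh[OF that] by (simp add: boundary_hessian_def)
  have fin: "finite (J k)" "finite (L k)" "L k \<subseteq> J k" if "k \<in> K" for k
    using bh[OF that] ch[OF that] by (auto simp: boundary_hessian_def chart_def intro: finite_subset)
  have zL: "z k j = (\<lambda>x. x $ \<iota> k j)" "real_polynomial_function (b k j)" "0 < b k j (v k)" "v k $ \<iota> k j = 0"
    if "k \<in> K" "j \<in> L k" for k j
  proof -
    show 1: "z k j = (\<lambda>x. x $ \<iota> k j)" "real_polynomial_function (b k j)" "0 < b k j (v k)"
      using bh[OF that(1)] that(2) by (auto simp: boundary_hessian_def)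
    have "z k j (v k) = 0" using ch[OF that(1)] fin[OF that(1)] that(2) by (auto simp: chart_def)
    then show "v k $ \<iota> k j = 0" by (simp add: 1)
  qed
  have f: "f x = (\<Sum>j\<in>J k-L k. (z k j x)\<^sup>2) + (\<Sum>j\<in>L k. b k j x * x $ \<iota> k j)"
    if "k \<in> K" "x \<in> hyperplane1" for k x
    using bh[OF that(1)] that(2) by (simp add: boundary_hessian_def)
  have w: "sumsq (J k) (z k) x = (\<Sum>j\<in>J k-L k. (z k j x)\<^sup>2) + (\<Sum>j\<in>L k. (x $ \<iota> k j)\<^sup>2)" if "k \<in> K" for k x
    unfolding sumsq_def using sum.subset_diff[OF fin(3,1)[OF that], of "\<lambda>j. (z k j x)\<^sup>2"] zL(1)[OF that] by simp
  define G where "G = prod_sumsq J z K"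
  define H where "H k = prod_sumsq J z (K - {k})" for k
  have GH: "G x = sumsq (J k) (z k) x * H k x" if "k \<in> K" for k x
    using prod_sumsq_insert[of "K - {k}" k J z x] K that by (simp add: G_def H_def insert_absorb)
  have pH: "real_polynomial_function (H k)" for k
    unfolding H_def using K by (intro polyf_prod_sumsq[where v = v] ch) auto
  have H0: "0 \<le> H k x" for k x by (simp add: H_def prod_sumsq_nonneg)
  have pG: "real_polynomial_function G" unfolding G_def using K by (intro polyf_prod_sumsq[where v = v] ch) auto
  have "\<exists>B>0. \<forall>x\<in>std_simplex. \<bar>H k x\<bar> \<le> B" for k
  proof -
    obtain B where "0 < B" "\<And>x. x \<in> std_simplex \<Longrightarrow> \<bar>H k x\<bar> \<le> B"
      using polyf_bounded_simplex[OF pH[of k]] by blast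
    then show ?thesis by (intro exI[of _ B]) simp
  qed
  then obtain B where B: "\<And>k. 0 < B k" "\<And>k x. x \<in> std_simplex \<Longrightarrow> \<bar>H k x\<bar> \<le> B k"
    by metis
  obtain B' where B': "0 < B'" "\<And>x. x \<in> std_simplex \<Longrightarrow> \<bar>G x\<bar> \<le> B'"
    using polyf_bounded_simplex[OF pG] by blast
  define M where "M = B' + (\<Sum>k\<in>K. B k)"
  have M: "0 < M" unfolding M_def using B' B(1) by (intro add_pos_nonneg sum_nonneg) (auto intro: less_imp_le)
  have GM: "G x \<le> M" if "x \<in> std_simplex" for x
    using B'(2)[OF that] sum_nonneg[of K B] B(1) unfolding M_def by (force intro: less_imp_le)
  have HM: "H k x \<le> M" if "x \<in> std_simplex" "k \<in> K" for k x
    using B(2)[OF that(1), of k] member_le_sum[of k K B] B(1) B'(1) K that(2)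
    unfolding M_def by (force intro: less_imp_le)
  \<comment> \<open>A neighbourhood of v k on which b stays nonnegative after subtracting at most
    the boundary coordinate.\<close>
  define U where "U k = (\<Inter>j\<in>L k. {x. x $ \<iota> k j < b k j x})" for k
  have U: "open (U k)" if "k \<in> K" for k
    unfolding U_def using fin[OF that] zL(2)[OF that]
    by (intro open_INT ballI open_Collect_less continuous_intros continuous_on_polyf) auto
  define A where "A = std_simplex - (\<Union>k\<in>K. U k)"
  have "compact A" unfolding A_def using U by (intro compact_diff compact_std_simplex open_UN) auto
  have fA: "0 < f x" if "x \<in> A" for x
  proof (rule pos)
    have "v k \<in> U k" if "k \<in> K" for k using zL[OF that] by (auto simp: U_def)
    then show "x \<notin> v ` K" "x \<in> std_simplex" using that by (auto simp: A_def)
  qed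
  obtain \<mu> where \<mu>: "0 < \<mu>" "\<And>x. x \<in> A \<Longrightarrow> \<mu> \<le> f x"
  proof (cases "A = {}")
    case True then show ?thesis using that[of 1] by simp
  next
    case False
    from continuous_attains_inf[OF \<open>compact A\<close> False continuous_on_polyf[OF p]] fA that
    show ?thesis by blast
  qed
  \<comment> \<open>The bound 1 / M keeps 1 - d * H k nonnegative near the zeros; \<mu> / M keeps f
    - d * G nonnegative on A.\<close>
  define d where "d = min (1 / M) (\<mu> / M)"
  have d: "0 < d" using M \<mu> by (simp add: d_def)
  have dH: "d * H k x \<le> 1" if "x \<in> std_simplex" "k \<in> K" for k x
  proof -
    have "d * H k x \<le> (1 / M) * M" using HM[OF that] H0 M by (intro mult_mono) (auto simp: d_def)
    then show ?thesis using M by simp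
  qed
  have dG: "d * G x \<le> \<mu>" if "x \<in> std_simplex" for x
  proof -
    have "d * G x \<le> (\<mu> / M) * M"
      using GM[OF that] M \<mu>(1) by (intro mult_mono) (auto simp: d_def G_def prod_sumsq_nonneg)
    then show ?thesis using M by simp
  qed
  \<comment> \<open>Since G is w_k times H k, subtracting d * G lowers the weights of the squares
    and changes each boundary coefficient by a term that vanishes at v k.\<close>
  have dec: "f x - d * G x = (\<Sum>j\<in>J k-L k. (1 - d * H k x) * (z k j x)\<^sup>2) +
      (\<Sum>j\<in>L k. (b k j x - d * H k x * x $ \<iota> k j) * x $ \<iota> k j)" if "k \<in> K" "x \<in> hyperplane1" for k x
    unfolding f[OF that] GH[OF that(1)] w[OF that(1)]
    by (simp add: algebra_simps power2_eq_square sum.distrib sum_subtractf sum_distrib_left)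
  have nn: "0 \<le> f x - d * G x" if x: "x \<in> std_simplex" for x
  proof (cases "x \<in> A")
    case True then show ?thesis using \<mu>(2)[OF True] dG[OF x] by simp
  next
    case False
    then obtain k where k: "k \<in> K" "x \<in> U k" using x by (auto simp: A_def)
    have "0 \<le> b k j x - d * H k x * x $ \<iota> k j" if "j \<in> L k" for j
    proof -
      have "d * H k x * x $ \<iota> k j \<le> 1 * x $ \<iota> k j"
        using dH[OF x k(1)] x by (intro mult_right_mono) (auto simp: std_simplex_def)
      then show ?thesis using k(2) that by (force simp: U_def)
    qed
    then show ?thesis
      using dec[OF k(1), of x] dH[OF x k(1)] x
      by (auto simp: std_simplex_def intro!: add_nonneg_nonneg sum_nonneg mult_nonneg_nonneg)
  qed
  have "pos_form (v k) (J k) (z k) (\<lambda>x. f x - d * G x)" if k: "k \<in> K" for k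
  proof -
    \<comment> \<open>Boundary coordinates are chart functions too; their squares get weight 0
      because they have been moved into the coefficients b.\<close>
    have "pos_decomp (v k) (J k) (z k) (\<lambda>x. f x - d * G x) (L k)
        (\<lambda>j x. if j \<in> L k then 0 else 1 - d * H k x) (\<lambda>j x. b k j x - d * H k x * x $ \<iota> k j) (\<iota> k)"
      unfolding pos_decomp_def
    proof (intro conjI ballI)
      fix j assume "j \<in> J k"
      show "real_polynomial_function (\<lambda>x. if j \<in> L k then 0 else 1 - d * H k x)"
        by (cases "j \<in> L k") (simp_all, (intro polyf_intros pH)+)
    next
      fix j assume j: "j \<in> L k"
      show "real_polynomial_function (\<lambda>x. b k j x - d * H k x * x $ \<iota> k j)"
        by (intro polyf_intros pH zL[OF k j])
    next
      fix x :: "real^'n" assume x: "x \<in> hyperplane1"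
      have "(\<Sum>j\<in>J k. (if j \<in> L k then 0 else 1 - d * H k x) * (z k j x)\<^sup>2) = (\<Sum>j\<in>J k-L k. (1 - d * H k x) * (z k j x)\<^sup>2)"
        using fin[OF k] by (intro sum.mono_neutral_cong_right) auto
      then show "f x - d * G x = (\<Sum>j\<in>J k. (if j \<in> L k then 0 else 1 - d * H k x) * (z k j x)\<^sup>2) +
          (\<Sum>j\<in>L k. (b k j x - d * H k x * x $ \<iota> k j) * x $ \<iota> k j)"
        using dec[OF k x] by simp
    qed (use fin[OF k] zL[OF k] dH[OF _ k] in auto)
    then show ?thesis unfolding pos_form_def by (intro exI)
  qed
  \<comment> \<open>For f - d * G the error term with e = d is exactly what was subtracted, so the
    sum is f.\<close>
  then have "(\<lambda>x. (f x - d * G x) + d * prod_sumsq J z K x) \<in> QM"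
    by (intro multiple_zeros[where v = v] polyf_intros p pG K ch inj d nn)
  then show ?thesis by (simp add: G_def)
qed

section \<open>Polynomials as functions\<close>

definition monom_eval :: "('n \<Rightarrow>\<^sub>0 nat) \<Rightarrow> real^'n::finite \<Rightarrow> real" where
  "monom_eval m x = (\<Prod>i\<in>UNIV. x $ i ^ Poly_Mapping.lookup m i)"

definition peval :: "'n::finite rpoly \<Rightarrow> real^'n \<Rightarrow> real" where
  "peval p x = (\<Sum>m\<in>Poly_Mapping.keys p. Poly_Mapping.lookup p m * monom_eval m x)"

lemma monom_eval_add: "monom_eval (m + n) x = monom_eval m x * monom_eval n x"
  by (simp add: monom_eval_def lookup_add power_add prod.distrib)

lemma monom_eval_0 [simp]: "monom_eval 0 x = 1"
  by (simp add: monom_eval_def)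

lemma peval_superset:
  "finite A \<Longrightarrow> Poly_Mapping.keys p \<subseteq> A \<Longrightarrow> peval p x = (\<Sum>m\<in>A. Poly_Mapping.lookup p m * monom_eval m x)"
  unfolding peval_def by (rule sum.mono_neutral_left) (auto simp: in_keys_iff)

lemma peval_0 [simp]: "peval 0 x = 0"
  by (simp add: peval_def)

lemma peval_add [simp]: "peval (p + q) x = peval p x + peval q x"
proof -
  let ?A = "Poly_Mapping.keys p \<union> Poly_Mapping.keys q"
  have "peval r x = (\<Sum>m\<in>?A. Poly_Mapping.lookup r m * monom_eval m x)"
    if "Poly_Mapping.keys r \<subseteq> ?A" for r
    using that by (intro peval_superset) auto
  from this[of "p + q"] this[of p] this[of q] show ?thesis
    using keys_add[of p q] by (simp add: lookup_add distrib_right sum.distrib)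
qed

lemma peval_sum [simp]: "peval (\<Sum>a\<in>A. f a) x = (\<Sum>a\<in>A. peval (f a) x)"
  by (induction A rule: infinite_finite_induct) auto

lemma peval_single [simp]: "peval (Poly_Mapping.single m c) x = c * monom_eval m x"
  by (subst peval_superset[of "{m}"]) auto

lemma poly_mapping_sum_single:
  "p = (\<Sum>m\<in>Poly_Mapping.keys p. Poly_Mapping.single m (Poly_Mapping.lookup p m))"
proof (rule poly_mapping_eqI)
  fix k
  have "Poly_Mapping.lookup (\<Sum>m\<in>Poly_Mapping.keys p. Poly_Mapping.single m (Poly_Mapping.lookup p m)) k =
      (\<Sum>m\<in>Poly_Mapping.keys p. if m = k then Poly_Mapping.lookup p k else 0)"
    by (auto simp: lookup_sum lookup_single when_def intro: sum.cong)
  also have "\<dots> = Poly_Mapping.lookup p k"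
    by (simp add: in_keys_iff)
  finally show "Poly_Mapping.lookup p k =
    Poly_Mapping.lookup (\<Sum>m\<in>Poly_Mapping.keys p. Poly_Mapping.single m (Poly_Mapping.lookup p m)) k" ..
qed

lemma peval_mult [simp]: "peval (p * q) x = peval p x * peval q x"
proof -
  let ?s = "\<lambda>p m. Poly_Mapping.single m (Poly_Mapping.lookup p m)"
  have "p * q = (\<Sum>m\<in>Poly_Mapping.keys p. ?s p m) * (\<Sum>n\<in>Poly_Mapping.keys q. ?s q n)"
    using poly_mapping_sum_single[of p] poly_mapping_sum_single[of q] by simp
  also have "\<dots> = (\<Sum>m\<in>Poly_Mapping.keys p. \<Sum>n\<in>Poly_Mapping.keys q.
      Poly_Mapping.single (m + n) (Poly_Mapping.lookup p m * Poly_Mapping.lookup q n))"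
    by (simp add: sum_product mult_single)
  finally have "peval (p * q) x = (\<Sum>m\<in>Poly_Mapping.keys p. \<Sum>n\<in>Poly_Mapping.keys q.
      (Poly_Mapping.lookup p m * Poly_Mapping.lookup q n) * monom_eval (m + n) x)"
    by simp
  also have "\<dots> = peval p x * peval q x"
    by (simp add: peval_def sum_product monom_eval_add mult_ac)
  finally show ?thesis .
qed

lemma peval_1 [simp]: "peval 1 x = 1"
  using peval_single[of 0 1 x] by (simp del: peval_single)

lemma peval_power [simp]: "peval (p ^ n) x = peval p x ^ n"
  by (induction n) auto

lemma peval_minus [simp]: "peval (- p) x = - peval p x"
  using peval_add[of p "- p" x] by (simp del: peval_add)

lemma peval_diff [simp]: "peval (p - q) x = peval p x - peval q x"
  using peval_add[of p "- q" x] by (simp del: peval_add)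

lemma peval_prod [simp]: "peval (\<Prod>a\<in>A. f a) x = (\<Prod>a\<in>A. peval (f a) x)"
  by (induction A rule: infinite_finite_induct) auto

lemma peval_Const [simp]: "peval (Const c) x = c"
  by (simp add: Const_def)

lemma peval_Var [simp]: "peval (Var i) x = x $ i"
proof -
  have "monom_eval (Poly_Mapping.single i 1) x = (\<Prod>j\<in>UNIV. if j = i then x $ i else 1)"
    unfolding monom_eval_def by (intro prod.cong) (auto simp: lookup_single when_def)
  then show ?thesis by (simp add: Var_def)
qed

lemma peval_quad_form:
  "peval (quad_form M y) x = (\<Sum>i\<in>UNIV. \<Sum>j\<in>UNIV. peval (y i) x * M $ i $ j * peval (y j) x)"
  by (simp add: quad_form_def)

lemma monom_eval_pointwise_mult: "monom_eval m (\<chi> i. x $ i * y $ i) = monom_eval m x * monom_eval m y"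
  by (simp add: monom_eval_def power_mult_distrib prod.distrib)

text \<open>Dedekind's argument: the monomials are pairwise distinct characters of the multiplicative monoid of
  \<open>real^'n\<close>.\<close>

lemma monom_eval_independent:
  assumes "finite A" "\<And>x. (\<Sum>m\<in>A. c m * monom_eval m (x :: real^'n::finite)) = 0" "m \<in> A"
  shows "c m = 0"
  using assms
proof (induction A arbitrary: c m rule: finite_induct)
  case (insert k A)
  have rel: "c k * monom_eval k x + (\<Sum>m\<in>A. c m * monom_eval m x) = 0" for x :: "real^'n"
    using insert.prems(1)[of x] insert.hyps by simp
  have A: "c m = 0" if m: "m \<in> A" for m
  proof -
    have "m \<noteq> k" using insert.hyps m by auto
    then obtain i where i: "Poly_Mapping.lookup m i \<noteq> Poly_Mapping.lookup k i"
      by (metis poly_mapping_eqI)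
    \<comment> \<open>At y a monomial takes the value 2 to its exponent in variable i, which
      separates m from k.\<close>
    define y :: "real^'n" where "y = (\<chi> j. if j = i then 2 else 1)"
    have y: "monom_eval n y = 2 ^ Poly_Mapping.lookup n i" for n
    proof -
      have "monom_eval n y = (\<Prod>j\<in>UNIV. if j = i then 2 ^ Poly_Mapping.lookup n i else 1)"
        unfolding monom_eval_def y_def by (intro prod.cong) auto
      then show ?thesis by simp
    qed
    \<comment> \<open>The relation at the pointwise product of x and y, minus the value of k at y
      times the relation at x, no longer contains k.\<close>
    have "(\<Sum>m\<in>A. (c m * (monom_eval m y - monom_eval k y)) * monom_eval m x) = 0" for x
    proof -
      have "(\<Sum>m\<in>A. (c m * (monom_eval m y - monom_eval k y)) * monom_eval m x) =
          (c k * monom_eval k (\<chi> i. x $ i * y $ i) + (\<Sum>m\<in>A. c m * monom_eval m (\<chi> i. x $ i * y $ i)))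
          - monom_eval k y * (c k * monom_eval k x + (\<Sum>m\<in>A. c m * monom_eval m x))"
        by (simp add: monom_eval_pointwise_mult sum_distrib_left sum_subtractf algebra_simps)
      then show ?thesis by (simp only: rel mult_zero_right diff_self)
    qed
    from insert.IH[OF this m] have "c m * (monom_eval m y - monom_eval k y) = 0" .
    then show ?thesis using i by (simp add: y)
  qed
  show ?case
  proof (cases "m = k")
    case True
    have "c k * monom_eval k (\<chi> i. 1) = 0" using rel[of "\<chi> i. 1"] A by simp
    then show ?thesis using True by (simp add: monom_eval_def)
  qed (use A insert.prems in auto)
qed simp

lemma peval_eq_0_imp_eq_0:
  assumes "\<And>x. peval p x = 0" shows "p = 0"
proof (rule poly_mapping_eqI)
  fix m
  show "Poly_Mapping.lookup p m = Poly_Mapping.lookup 0 m"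
  proof (cases "m \<in> Poly_Mapping.keys p")
    case True
    from monom_eval_independent[OF finite_keys _ this, of "Poly_Mapping.lookup p"] assms show ?thesis
      by (simp add: peval_def)
  qed (simp add: in_keys_iff)
qed

lemma peval_eq_imp_eq: "(\<And>x. peval p x = peval q x) \<Longrightarrow> p = q"
  using peval_eq_0_imp_eq_0[of "p - q"] by simp

lemma polyf_imp_peval:
  "real_polynomial_function F \<Longrightarrow> \<exists>p. \<forall>x::real^'n::finite. F x = peval p x"
proof (induction rule: real_polynomial_function.induct)
  case (linear f)
  then interpret bounded_linear f by simp
  show ?case
  proof (intro exI[of _ "\<Sum>i\<in>UNIV. Const (f (axis i 1)) * Var i"] allI)
    fix x :: "real^'n"
    have "(\<Sum>i\<in>UNIV. x $ i *\<^sub>R axis i 1) = x"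
      using basis_expansion[of x] by (simp only: scalar_mult_eq_scaleR)
    then have "f x = f (\<Sum>i\<in>UNIV. x $ i *\<^sub>R axis i 1)" by simp
    then show "f x = peval (\<Sum>i\<in>UNIV. Const (f (axis i 1)) * Var i) x"
      by (simp add: sum scale mult.commute)
  qed
next
  case (const c)
  show ?case by (intro exI[of _ "Const c"]) simp
next
  case (add f g)
  then obtain p q where "\<forall>x. f x = peval p x" "\<forall>x. g x = peval q x" by blast
  then show ?case by (intro exI[of _ "p + q"]) simp
next
  case (mult f g)
  then obtain p q where "\<forall>x. f x = peval p x" "\<forall>x. g x = peval q x" by blast
  then show ?case by (intro exI[of _ "p * q"]) simp
qed

section \<open>The ideal of the hyperplane\<close>

definition monom_degree :: "('n::finite \<Rightarrow>\<^sub>0 nat) \<Rightarrow> nat" where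
  "monom_degree m = (\<Sum>i\<in>UNIV. Poly_Mapping.lookup m i)"

lemma monom_eval_scale: "monom_eval m (c *\<^sub>R x) = c ^ monom_degree m * monom_eval m x"
  by (simp add: monom_eval_def monom_degree_def power_mult_distrib prod.distrib power_sum)

lemma ideal_simplex_add: "p \<in> ideal_simplex \<Longrightarrow> q \<in> ideal_simplex \<Longrightarrow> p + q \<in> ideal_simplex"
proof -
  assume "p \<in> ideal_simplex" "q \<in> ideal_simplex"
  then obtain r s where "p = r * ((\<Sum>i\<in>UNIV. Var i) - 1)" "q = s * ((\<Sum>i\<in>UNIV. Var i) - 1)"
    by (auto simp: ideal_simplex_def)
  then have "p + q = (r + s) * ((\<Sum>i\<in>UNIV. Var i) - 1)" by (simp only: distrib_right)
  then show ?thesis by (auto simp: ideal_simplex_def)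
qed

lemma ideal_simplex_sum:
  "(\<And>a. a \<in> A \<Longrightarrow> p a \<in> ideal_simplex) \<Longrightarrow> (\<Sum>a\<in>A. p a) \<in> ideal_simplex"
proof (induction A rule: infinite_finite_induct)
  case (insert a A)
  then show ?case by (auto intro!: ideal_simplex_add)
qed (auto simp: ideal_simplex_def intro!: exI[of _ 0])

text \<open>Powers of E, the sum of the variables, raise every monomial to a common degree N. This
  does not change p modulo E - 1, and by scaling the resulting form P vanishes wherever the
  coordinate sum is nonzero.\<close>

lemma vanishing_imp_ideal_simplex:
  fixes p :: "'n::finite rpoly"
  assumes "\<And>x. x \<in> hyperplane1 \<Longrightarrow> peval p x = 0"
  shows "p \<in> ideal_simplex"
proof -
  define E :: "'n rpoly" where "E = (\<Sum>i\<in>UNIV. Var i)"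
  have id: "q * (E - 1) \<in> ideal_simplex" for q by (auto simp: ideal_simplex_def E_def)
  define N where "N = Max (insert 0 (monom_degree ` Poly_Mapping.keys p))"
  have N: "monom_degree m \<le> N" if "m \<in> Poly_Mapping.keys p" for m
    unfolding N_def using that by (intro Max_ge) auto
  define t where "t m = Poly_Mapping.single m (Poly_Mapping.lookup p m)" for m
  define P where "P = (\<Sum>m\<in>Poly_Mapping.keys p. t m * E ^ (N - monom_degree m))"
  have "t m * (1 - E ^ k) \<in> ideal_simplex" for m k
  proof -
    have "t m * (1 - E ^ k) = (- t m * (\<Sum>i<k. E ^ i)) * (E - 1)"
      by (simp add: one_diff_power_eq algebra_simps)
    then show ?thesis by (simp only: id)
  qed
  then have "(\<Sum>m\<in>Poly_Mapping.keys p. t m * (1 - E ^ (N - monom_degree m))) \<in> ideal_simplex"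
    by (rule ideal_simplex_sum)
  also have "(\<Sum>m\<in>Poly_Mapping.keys p. t m * (1 - E ^ (N - monom_degree m))) = (\<Sum>m\<in>Poly_Mapping.keys p. t m) - P"
    by (simp add: P_def right_diff_distrib sum_subtractf)
  also have "(\<Sum>m\<in>Poly_Mapping.keys p. t m) = p"
    unfolding t_def by (rule poly_mapping_sum_single[symmetric])
  finally have 1: "p - P \<in> ideal_simplex" .
  \<comment> \<open>The factor E settles the points of coordinate sum 0. Then E P = 0 itself
    exhibits P as -P (E - 1).\<close>
  have "peval (E * P) x = 0" for x
  proof (cases "(\<Sum>i\<in>UNIV. x $ i) = 0")
    case False
    define s where "s = (\<Sum>i\<in>UNIV. x $ i)"
    have s: "s \<noteq> 0" using False by (simp add: s_def)
    have "(1 / s) *\<^sub>R x \<in> hyperplane1"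
      using s by (simp add: hyperplane1_def s_def flip: sum_divide_distrib)
    then have 0: "peval p ((1 / s) *\<^sub>R x) = 0" by (rule assms)
    have "peval P x = s ^ N * peval p ((1 / s) *\<^sub>R x)"
      unfolding P_def peval_def[of p] sum_distrib_left peval_sum
    proof (intro sum.cong refl)
      fix m assume m: "m \<in> Poly_Mapping.keys p"
      have "s ^ N * (1 / s) ^ monom_degree m = s ^ (N - monom_degree m)"
        using N[OF m] s by (simp add: power_divide power_diff)
      then show "peval (t m * E ^ (N - monom_degree m)) x =
          s ^ N * (Poly_Mapping.lookup p m * monom_eval m ((1 / s) *\<^sub>R x))"
        by (simp add: t_def E_def monom_eval_scale mult_ac flip: s_def)
    qed
    then show ?thesis using 0 by simp
  qed (simp add: E_def)
  then have "E * P = 0" by (rule peval_eq_0_imp_eq_0)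
  then have "P = (- P) * (E - 1)" by (simp add: algebra_simps)
  then have "P \<in> ideal_simplex" using id[of "- P"] by simp
  from ideal_simplex_add[OF 1 this] show ?thesis by simp
qed

section \<open>Sums of squares of polynomials\<close>

lemma SOS_square: "p\<^sup>2 \<in> SOS"
  unfolding SOS_def by (auto intro!: exI[of _ 1] exI[of _ "\<lambda>_. p"])

lemma SOS_0: "0 \<in> SOS"
  unfolding SOS_def by (auto intro!: exI[of _ 0])

lemma SOS_add:
  assumes "p \<in> SOS" "q \<in> SOS" shows "p + q \<in> SOS"
proof -
  obtain m g where p: "p = (\<Sum>k<(m::nat). (g k)\<^sup>2)" using assms(1) by (auto simp: SOS_def)
  obtain n h where q: "q = (\<Sum>k<(n::nat). (h k)\<^sup>2)" using assms(2) by (auto simp: SOS_def)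
  have "(\<Sum>k<m + n. (if k < m then g k else h (k - m))\<^sup>2) = p + q"
    unfolding p q sum.nat_group[symmetric]
    by (induction n) (auto simp: add.assoc)
  then show ?thesis unfolding SOS_def by (intro CollectI exI[of _ "m + n"] exI[of _ "\<lambda>k. if k < m then g k else h (k - m)"]) simp
qed

lemma SOS_sum: "(\<And>a. a \<in> A \<Longrightarrow> p a \<in> SOS) \<Longrightarrow> (\<Sum>a\<in>A. p a) \<in> SOS"
  by (induction A rule: infinite_finite_induct) (auto intro: SOS_add SOS_0)

lemma SOS_square_mult:
  assumes "q \<in> SOS" shows "p\<^sup>2 * q \<in> SOS"
proof -
  obtain m g where q: "q = (\<Sum>k<(m::nat). (g k)\<^sup>2)" using assms by (auto simp: SOS_def)
  have "p\<^sup>2 * q = (\<Sum>k<m. (p * g k)\<^sup>2)" by (simp add: q sum_distrib_left power_mult_distrib)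
  then show ?thesis unfolding SOS_def by (intro CollectI exI[of _ m] exI[of _ "\<lambda>k. p * g k"])
qed

section \<open>The two hierarchies\<close>

lemma QM_imp_SOS:
  "F \<in> QM \<Longrightarrow> \<exists>\<sigma>\<^sub>0 \<sigma>. \<sigma>\<^sub>0 \<in> SOS \<and> (\<forall>i. \<sigma> i \<in> SOS) \<and>
    (\<forall>x\<in>hyperplane1. F x = peval (\<sigma>\<^sub>0 + (\<Sum>i\<in>UNIV. \<sigma> i * Var i)) x)"
proof (induction rule: QM.induct)
  case (square p)
  then obtain q where "\<forall>x. p x = peval q x" using polyf_imp_peval by blast
  then show ?case by (intro exI[of _ "q\<^sup>2"] exI[of _ "\<lambda>_. 0"]) (auto simp: SOS_0 SOS_square)
next
  case (square_coord p i)
  then obtain q where q: "\<forall>x. p x = peval q x" using polyf_imp_peval by blast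
  have "(\<Sum>j\<in>UNIV. (if j = i then q\<^sup>2 else 0) * Var j) = (\<Sum>j\<in>UNIV. if j = i then q\<^sup>2 * Var i else 0)"
    by (intro sum.cong) auto
  also have "\<dots> = q\<^sup>2 * Var i" by simp
  finally show ?case
    using q by (intro exI[of _ 0] exI[of _ "\<lambda>j. if j = i then q\<^sup>2 else 0"]) (simp add: SOS_0 SOS_square)
next
  case (add F G)
  then obtain s0 s t0 t where
    s: "s0 \<in> SOS" "\<forall>i. s i \<in> SOS" "\<forall>x\<in>hyperplane1. F x = peval (s0 + (\<Sum>i\<in>UNIV. s i * Var i)) x" and
    t: "t0 \<in> SOS" "\<forall>i. t i \<in> SOS" "\<forall>x\<in>hyperplane1. G x = peval (t0 + (\<Sum>i\<in>UNIV. t i * Var i)) x"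
    by (elim exE conjE) (rule that)
  show ?case
    by (intro exI[of _ "s0 + t0"] exI[of _ "\<lambda>i. s i + t i"])
      (use s t in \<open>simp add: SOS_add sum.distrib distrib_right\<close>)
next
  case (cong F G)
  then show ?case by simp
qed

lemma SOS_imp_SOS_deg:
  assumes "p \<in> SOS" "int (total_degree p) \<le> k" shows "p \<in> SOS_deg k"
  using assms by (simp add: SOS_deg_def)

lemma QM_imp_LAS:
  fixes M :: "real^'n::finite^'n"
  assumes sym: "transpose M = M"
    and QM: "(\<lambda>x. \<Sum>i\<in>UNIV. \<Sum>j\<in>UNIV. x $ i * M $ i $ j * x $ j) \<in> QM"
  shows "M \<in> (\<Union>r. LAS r)"
proof -
  obtain s0 s where s: "s0 \<in> SOS" "\<forall>i. s i \<in> SOS"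
    "\<forall>x\<in>hyperplane1. (\<Sum>i\<in>UNIV. \<Sum>j\<in>UNIV. x $ i * M $ i $ j * x $ j) = peval (s0 + (\<Sum>i\<in>UNIV. s i * Var i)) x"
    using QM_imp_SOS[OF QM] by (elim exE conjE) (rule that)
  define q where "q = quad_form M Var - (s0 + (\<Sum>i\<in>UNIV. s i * Var i))"
  have q: "q \<in> ideal_simplex"
    by (rule vanishing_imp_ideal_simplex) (use s(3) in \<open>simp add: q_def peval_quad_form\<close>)
  \<comment> \<open>The added 1 makes room for the smaller bound r - 1 on the multipliers of the
    coordinates.\<close>
  define r where "r = total_degree s0 + (\<Sum>i\<in>UNIV. total_degree (s i)) + 1"
  have "int (total_degree (s i)) \<le> int r - 1" for i
  proof -
    have "total_degree (s i) + 1 \<le> r"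
      using member_le_sum[of i UNIV "\<lambda>i. total_degree (s i)"] by (simp add: r_def)
    then show ?thesis by linarith
  qed
  moreover have "int (total_degree s0) \<le> int r" by (simp add: r_def sum_nonneg)
  ultimately have deg: "s0 \<in> SOS_deg (int r)" "\<forall>i. s i \<in> SOS_deg (int r - 1)"
    using s(1,2) by (simp_all add: SOS_imp_SOS_deg)
  have "quad_form M Var = s0 + (\<Sum>i\<in>UNIV. s i * Var i) + q" by (simp add: q_def)
  then have "M \<in> LAS r"
    unfolding LAS_def sym_matrices_def using sym deg q
    by (intro CollectI conjI exI[of _ s0] exI[of _ s] exI[of _ q]) auto
  then show ?thesis by blast
qed

lemma peval_homogenize:
  fixes g :: "'n::finite rpoly"
  assumes N: "\<And>m. m \<in> Poly_Mapping.keys g \<Longrightarrow> monom_degree m \<le> N"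
  shows "\<exists>h. \<forall>y. (\<Sum>i\<in>UNIV. (y $ i)\<^sup>2) \<noteq> 0 \<longrightarrow>
    peval h y = (\<Sum>i\<in>UNIV. (y $ i)\<^sup>2) ^ N * peval g (\<chi> j. (y $ j)\<^sup>2 / (\<Sum>i\<in>UNIV. (y $ i)\<^sup>2))"
proof (intro exI allI impI)
  fix y :: "real^'n"
  define s where "s = (\<Sum>i\<in>UNIV. (y $ i)\<^sup>2)"
  assume "(\<Sum>i\<in>UNIV. (y $ i)\<^sup>2) \<noteq> 0"
  then have s: "s \<noteq> 0" by (simp add: s_def)
  have "s ^ (N - monom_degree m) * (\<Prod>i\<in>UNIV. ((y $ i)\<^sup>2) ^ Poly_Mapping.lookup m i) =
      s ^ N * monom_eval m (\<chi> j. (y $ j)\<^sup>2 / s)" if "m \<in> Poly_Mapping.keys g" for m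
  proof -
    have "monom_eval m (\<chi> j. (y $ j)\<^sup>2 / s) = monom_eval m ((1 / s) *\<^sub>R (\<chi> j. (y $ j)\<^sup>2))"
      by (simp add: monom_eval_def)
    also have "s ^ N * \<dots> = (s ^ N * (1 / s) ^ monom_degree m) * monom_eval m (\<chi> j. (y $ j)\<^sup>2)"
      by (simp add: monom_eval_scale)
    also have "s ^ N * (1 / s) ^ monom_degree m = s ^ (N - monom_degree m)"
      using N[OF that] s by (simp add: power_divide power_diff)
    finally show ?thesis by (simp add: monom_eval_def)
  qed
  then show "peval (\<Sum>m\<in>Poly_Mapping.keys g. Const (Poly_Mapping.lookup g m) *
      ((\<Sum>i\<in>UNIV. (Var i)\<^sup>2) ^ (N - monom_degree m) * (\<Prod>i\<in>UNIV. ((Var i)\<^sup>2) ^ Poly_Mapping.lookup m i))) y =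
    (\<Sum>i\<in>UNIV. (y $ i)\<^sup>2) ^ N * peval g (\<chi> j. (y $ j)\<^sup>2 / (\<Sum>i\<in>UNIV. (y $ i)\<^sup>2))"
    by (simp add: s_def peval_def[of g] sum_distrib_left mult_ac)
qed

text \<open>Each square root is homogenised to level N separately, whence 2 N. Every large N is
  allowed so that all multipliers can later share one exponent.\<close>

lemma SOS_homogenize:
  fixes p :: "'n::finite rpoly"
  assumes "p \<in> SOS"
  shows "\<exists>N0. \<forall>N\<ge>N0. \<exists>q\<in>SOS. \<forall>y. (\<Sum>i\<in>UNIV. (y $ i)\<^sup>2) \<noteq> 0 \<longrightarrow>
    peval q y = (\<Sum>i\<in>UNIV. (y $ i)\<^sup>2) ^ (2 * N) * peval p (\<chi> j. (y $ j)\<^sup>2 / (\<Sum>i\<in>UNIV. (y $ i)\<^sup>2))"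
proof -
  obtain n g where p: "p = (\<Sum>k<(n::nat). (g k)\<^sup>2)" using assms by (auto simp: SOS_def)
  define N0 where "N0 = Max (insert 0 (\<Union>k<n. monom_degree ` Poly_Mapping.keys (g k)))"
  have N0: "monom_degree m \<le> N0" if "k < n" "m \<in> Poly_Mapping.keys (g k)" for k m
    unfolding N0_def using that by (intro Max_ge) auto
  show ?thesis
  proof (intro exI[of _ N0] allI impI)
    fix N assume "N0 \<le> N"
    then have "\<exists>h. \<forall>y. (\<Sum>i\<in>UNIV. (y $ i)\<^sup>2) \<noteq> 0 \<longrightarrow>
      peval h y = (\<Sum>i\<in>UNIV. (y $ i)\<^sup>2) ^ N * peval (g k) (\<chi> j. (y $ j)\<^sup>2 / (\<Sum>i\<in>UNIV. (y $ i)\<^sup>2))"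
      if "k < n" for k using N0[OF that] by (intro peval_homogenize) (meson le_trans)
    then obtain h where h: "\<And>k y. k < n \<Longrightarrow> (\<Sum>i\<in>UNIV. (y $ i)\<^sup>2) \<noteq> 0 \<Longrightarrow>
      peval (h k) y = (\<Sum>i\<in>UNIV. (y $ i)\<^sup>2) ^ N * peval (g k) (\<chi> j. (y $ j)\<^sup>2 / (\<Sum>i\<in>UNIV. (y $ i)\<^sup>2))"
      by metis
    show "\<exists>q\<in>SOS. \<forall>y. (\<Sum>i\<in>UNIV. (y $ i)\<^sup>2) \<noteq> 0 \<longrightarrow>
      peval q y = (\<Sum>i\<in>UNIV. (y $ i)\<^sup>2) ^ (2 * N) * peval p (\<chi> j. (y $ j)\<^sup>2 / (\<Sum>i\<in>UNIV. (y $ i)\<^sup>2))"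
    proof (intro bexI[of _ "\<Sum>k<n. (h k)\<^sup>2"] allI impI)
      show "(\<Sum>k<n. (h k)\<^sup>2) \<in> SOS" by (intro SOS_sum SOS_square)
      fix y :: "real^'n" assume y: "(\<Sum>i\<in>UNIV. (y $ i)\<^sup>2) \<noteq> 0"
      show "peval (\<Sum>k<n. (h k)\<^sup>2) y =
        (\<Sum>i\<in>UNIV. (y $ i)\<^sup>2) ^ (2 * N) * peval p (\<chi> j. (y $ j)\<^sup>2 / (\<Sum>i\<in>UNIV. (y $ i)\<^sup>2))"
        by (simp add: p h[OF _ y] power_mult_distrib sum_distrib_left mult.commute flip: power_mult)
    qed
  qed
qed

text \<open>The substitution of \<open>(y $ i)\<^sup>2 / (\<Sum>j. (y $ j)\<^sup>2)\<close> for \<open>x $ i\<close> turns a certificate on the simplex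
  into one for the form in \<open>y\<close>.\<close>

lemma LAS_subset_K_cone: "LAS r \<subseteq> (\<Union>r. K_cone r :: (real^'n::finite^'n) set)"
proof
  fix M :: "real^'n^'n" assume "M \<in> LAS r"
  then obtain \<sigma>\<^sub>0 \<sigma> q where sym: "M \<in> sym_matrices" and
    s: "\<sigma>\<^sub>0 \<in> SOS_deg (int r)" "\<forall>i. \<sigma> i \<in> SOS_deg (int r - 1)" and q: "q \<in> ideal_simplex" and
    M: "quad_form M Var = \<sigma>\<^sub>0 + (\<Sum>i\<in>UNIV. \<sigma> i * Var i) + q"
    unfolding LAS_def mem_Collect_eq by (elim conjE exE) (rule that)
  have "SOS_deg k \<subseteq> SOS" for k by (auto simp: SOS_deg_def SOS_0)
  then have s: "\<sigma>\<^sub>0 \<in> SOS" "\<sigma> i \<in> SOS" for i using s by auto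
  define S :: "'n rpoly" where "S = (\<Sum>i\<in>UNIV. (Var i)\<^sup>2)"
  have S: "peval S y = (\<Sum>i\<in>UNIV. (y $ i)\<^sup>2)" for y by (simp add: S_def)
  define X :: "real^'n \<Rightarrow> real^'n" where "X y = (\<chi> j. (y $ j)\<^sup>2 / peval S y)" for y
  obtain N0 where N0: "\<And>N. N0 \<le> N \<Longrightarrow> \<exists>t\<in>SOS. \<forall>y. peval S y \<noteq> 0 \<longrightarrow>
      peval t y = peval S y ^ (2 * N) * peval \<sigma>\<^sub>0 (X y)"
    using SOS_homogenize[OF s(1)] unfolding X_def S by blast
  have "\<exists>Ni. \<forall>N\<ge>Ni. \<exists>t\<in>SOS. \<forall>y. peval S y \<noteq> 0 \<longrightarrow>
      peval t y = peval S y ^ (2 * N) * peval (\<sigma> i) (X y)" for i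
    using SOS_homogenize[OF s(2)[of i]] unfolding X_def S by blast
  then obtain Ni where Ni: "\<And>i N. Ni i \<le> N \<Longrightarrow> \<exists>t\<in>SOS. \<forall>y. peval S y \<noteq> 0 \<longrightarrow>
      peval t y = peval S y ^ (2 * N) * peval (\<sigma> i) (X y)" by metis
  define N where "N = N0 + (\<Sum>i\<in>UNIV. Ni i)"
  have "N0 \<le> N" "Ni i \<le> N" for i
    using member_le_sum[of i UNIV Ni] by (auto simp: N_def)
  then obtain t0 where t0: "t0 \<in> SOS" "\<forall>y. peval S y \<noteq> 0 \<longrightarrow> peval t0 y = peval S y ^ (2 * N) * peval \<sigma>\<^sub>0 (X y)"
    using N0 by blast
  have "\<forall>i. \<exists>t. t \<in> SOS \<and> (\<forall>y. peval S y \<noteq> 0 \<longrightarrow> peval t y = peval S y ^ (2 * N) * peval (\<sigma> i) (X y))"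
  proof
    fix i
    from Ni[OF \<open>Ni i \<le> N\<close>] show "\<exists>t. t \<in> SOS \<and> (\<forall>y. peval S y \<noteq> 0 \<longrightarrow> peval t y = peval S y ^ (2 * N) * peval (\<sigma> i) (X y))"
      by (simp only: Bex_def)
  qed
  then obtain t where t: "\<forall>i. t i \<in> SOS \<and> (\<forall>y. peval S y \<noteq> 0 \<longrightarrow> peval (t i) y = peval S y ^ (2 * N) * peval (\<sigma> i) (X y))"
    by (rule choice[THEN exE])
  define B where "B = S\<^sup>2 * t0 + (\<Sum>i\<in>UNIV. S * ((Var i)\<^sup>2 * t i))"
  define Q where "Q = quad_form M (\<lambda>i. (Var i)\<^sup>2)"
  have S_mult: "S * p \<in> SOS" if "p \<in> SOS" for p
    unfolding S_def sum_distrib_right using that by (intro SOS_sum SOS_square_mult)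
  have "B \<in> SOS" unfolding B_def using t0 t by (intro SOS_add SOS_sum S_mult SOS_square_mult) auto
  \<comment> \<open>The substitution makes sense only where S is nonzero; the extra factor S extends
    the identity to all points and makes the exponent odd.\<close>
  have "S * (S ^ (2 * N) * Q) = S * B"
  proof (rule peval_eq_imp_eq)
    fix y
    show "peval (S * (S ^ (2 * N) * Q)) y = peval (S * B) y"
    proof (cases "peval S y = 0")
      case False
      define u where "u = peval S y"
      have u: "u \<noteq> 0" using False by (simp add: u_def)
      have X: "X y \<in> hyperplane1"
        using False by (simp add: hyperplane1_def X_def S flip: sum_divide_distrib)
      then have "peval q (X y) = 0" using q by (auto simp: ideal_simplex_def hyperplane1_def)
      then have "peval (quad_form M Var) (X y) = peval \<sigma>\<^sub>0 (X y) + (\<Sum>i\<in>UNIV. peval (\<sigma> i) (X y) * ((y $ i)\<^sup>2 / u))"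
        by (simp add: M X_def u_def)
      moreover have "peval Q y = u\<^sup>2 * peval (quad_form M Var) (X y)"
        using u by (simp add: Q_def peval_quad_form X_def sum_distrib_left power2_eq_square flip: u_def)
      ultimately have "peval (S ^ (2 * N) * Q) y = u ^ (2 * N) * (u\<^sup>2 * (peval \<sigma>\<^sub>0 (X y) +
          (\<Sum>i\<in>UNIV. peval (\<sigma> i) (X y) * ((y $ i)\<^sup>2 / u))))"
        by (simp add: u_def)
      also have "\<dots> = u\<^sup>2 * (u ^ (2 * N) * peval \<sigma>\<^sub>0 (X y)) +
          (\<Sum>i\<in>UNIV. u * ((y $ i)\<^sup>2 * (u ^ (2 * N) * peval (\<sigma> i) (X y))))"
        using u by (simp add: distrib_left sum_distrib_left power2_eq_square mult_ac)
      also have "\<dots> = peval B y"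
        using t0(2) t False by (simp add: B_def u_def)
      finally show ?thesis by simp
    qed simp
  qed
  then have "S ^ (2 * N + 1) * Q \<in> SOS"
    using S_mult[OF \<open>B \<in> SOS\<close>] by (simp add: mult.assoc)
  then have "M \<in> K_cone (2 * N + 1)"
    using sym by (simp add: K_cone_def S_def Q_def)
  then show "M \<in> (\<Union>r. K_cone r)" by blast
qed

section \<open>The matrices of Hildebrand\<close>

text \<open>Together with the coordinate sum, which fills the slot j0, the functionals form an
  injective linear map; its left inverse supplies the coefficients recovering x - v.\<close>

lemma chart_linear:
  fixes z :: "'n::finite \<Rightarrow> 'n rfun"
  assumes v: "v \<in> std_simplex"
    and lin: "\<And>j. j \<noteq> j0 \<Longrightarrow> linear (z j)" and zero: "\<And>j. j \<noteq> j0 \<Longrightarrow> z j v = 0"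
    and ker: "\<And>x. (\<Sum>i\<in>UNIV. x $ i) = 0 \<Longrightarrow> (\<And>j. j \<noteq> j0 \<Longrightarrow> z j x = 0) \<Longrightarrow> x = 0"
  shows "chart v (UNIV - {j0}) z"
proof -
  define \<phi> :: "real^'n \<Rightarrow> real^'n" where "\<phi> x = (\<chi> j. if j = j0 then \<Sum>i\<in>UNIV. x $ i else z j x)" for x
  have "linear \<phi>"
    by (rule linearI)
      (auto simp: \<phi>_def vec_eq_iff linear_add[OF lin] linear_scale[OF lin] sum.distrib sum_distrib_left)
  moreover have "inj \<phi>"
    unfolding linear_injective_0[OF \<open>linear \<phi>\<close>]
  proof (intro allI impI)
    fix x assume "\<phi> x = 0"
    then have *: "(if j = j0 then \<Sum>i\<in>UNIV. x $ i else z j x) = 0" for j by (simp add: \<phi>_def vec_eq_iff)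
    show "x = 0"
    proof (rule ker)
      show "(\<Sum>i\<in>UNIV. x $ i) = 0" using *[of j0] by simp
      show "z j x = 0" if "j \<noteq> j0" for j using *[of j] that by simp
    qed
  qed
  ultimately obtain g where g: "linear g" "g \<circ> \<phi> = id"
    using linear_injective_left_inverse by blast
  have "\<exists>\<kappa>. \<forall>x\<in>hyperplane1. x $ i - v $ i = (\<Sum>j\<in>UNIV-{j0}. \<kappa> j * z j x)" for i
  proof (intro exI[of _ "\<lambda>j. g (axis j 1) $ i"] ballI)
    fix x :: "real^'n" assume x: "x \<in> hyperplane1"
    have \<phi>: "\<phi> (x - v) $ j = (if j = j0 then 0 else z j x)" for j
      using x v zero[of j] by (auto simp: \<phi>_def linear_diff[OF lin] hyperplane1_def std_simplex_def sum_subtractf)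
    have "x - v = g (\<phi> (x - v))" using g(2) by (metis comp_apply id_apply)
    also have "\<phi> (x - v) = (\<Sum>j\<in>UNIV. \<phi> (x - v) $ j *\<^sub>R axis j 1)"
      using basis_expansion[of "\<phi> (x - v)"] by (simp only: scalar_mult_eq_scaleR)
    also have "g \<dots> = (\<Sum>j\<in>UNIV. \<phi> (x - v) $ j *\<^sub>R g (axis j 1))"
      by (simp add: linear_sum[OF g(1)] linear_scale[OF g(1)])
    also have "\<dots> = (\<Sum>j\<in>UNIV-{j0}. z j x *\<^sub>R g (axis j 1))"
      by (rule sum.mono_neutral_cong_right) (auto simp: \<phi>)
    finally have "(x - v) $ i = (\<Sum>j\<in>UNIV-{j0}. z j x *\<^sub>R g (axis j 1)) $ i" by simp
    then show "x $ i - v $ i = (\<Sum>j\<in>UNIV-{j0}. g (axis j 1) $ i * z j x)"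
      by (simp add: mult.commute)
  qed
  moreover have "real_polynomial_function (z j)" if "j \<noteq> j0" for j
    by (rule real_polynomial_function.intros(1)) (simp add: lin[OF that] linear_conv_bounded_linear[symmetric])
  ultimately show ?thesis using v zero by (simp add: chart_def)
qed

section \<open>Index arithmetic modulo 5\<close>

lemma exhaust_5: "k = 0 \<or> k = 1 \<or> k = 2 \<or> k = 3 \<or> k = (4::5)"
proof (induct k)
  case (of_int z)
  then have "0 \<le> z" "z < 5" by simp_all
  then have "z = 0 \<or> z = 1 \<or> z = 2 \<or> z = 3 \<or> z = 4" by arith
  then show ?case by auto
qed

lemma exhaust_5_shift:
  fixes i k :: 5
  obtains "i = k" | "i = k + 1" | "i = k + 2" | "i = k + 3" | "i = k + 4"
proof -
  have "i = k + (i - k)" by simp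
  then show thesis using exhaust_5[of "i - k"] that by (metis add.right_neutral)
qed

lemma UNIV_5_shift: "UNIV = {k, k + 1, k + 2, k + 3, k + (4::5)}"
  using exhaust_5_shift[of _ k] by auto

lemma sum_5_shift: "(\<Sum>i\<in>UNIV. g i) = g k + g (k + 1) + g (k + 2) + g (k + 3) + g (k + (4::5))"
proof -
  have "(\<Sum>i\<in>{k, k + 1, k + 2, k + 3, k + (4::5)}. g i) = g k + (g (k + 1) + (g (k + 2) + (g (k + 3) + g (k + 4))))"
    by simp
  then show ?thesis by (simp add: add.assoc flip: UNIV_5_shift)
qed

lemma sum_5_reindex: "(\<Sum>i\<in>UNIV. g (i + k)) = (\<Sum>i\<in>UNIV. g (i::5))"
  by (rule sum.reindex_bij_witness[of _ "\<lambda>i. i - k" "\<lambda>i. i + k"]) auto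

lemma mod_5: "(5::5) = 0" "(6::5) = 1" "(7::5) = 2" "(8::5) = 3"
  by simp_all

lemmas vector_5_mod = vector_5[unfolded mod_5]

text \<open>Indices are read modulo 5: a cyclic shift of the matrix is matched by the shift of the
  angles, so one computation relative to k serves all five zeros.\<close>

lemma T_entries:
  shows "T \<psi> $ k $ k = 1"
    "T \<psi> $ k $ (k + 1) = - cos (\<psi> $ (k + 3))" "T \<psi> $ (k + 1) $ k = - cos (\<psi> $ (k + 3))"
    "T \<psi> $ k $ (k + 2) = cos (\<psi> $ (k + 3) + \<psi> $ (k + 4))" "T \<psi> $ (k + 2) $ k = cos (\<psi> $ (k + 3) + \<psi> $ (k + 4))"
proof -
  consider "k = 1" | "k = 2" | "k = 3" | "k = 4" | "k = 0" using exhaust_5 by blast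
  then show "T \<psi> $ k $ k = 1"
    "T \<psi> $ k $ (k + 1) = - cos (\<psi> $ (k + 3))" "T \<psi> $ (k + 1) $ k = - cos (\<psi> $ (k + 3))"
    "T \<psi> $ k $ (k + 2) = cos (\<psi> $ (k + 3) + \<psi> $ (k + 4))" "T \<psi> $ (k + 2) $ k = cos (\<psi> $ (k + 3) + \<psi> $ (k + 4))"
    by (cases; simp add: T_def vector_5_mod mod_5)+
qed

lemma sum_squares_plane:
  fixes Y1 Y2 Y3 Y4 Y5 :: real
  shows "(Y1 * c1 + Y2 * c2 + Y3 * c3 + Y4 * c4 + Y5 * c5)\<^sup>2 + (Y1 * s1 + Y2 * s2 + Y3 * s3 + Y4 * s4 + Y5 * s5)\<^sup>2 =
    Y1\<^sup>2 * (c1\<^sup>2 + s1\<^sup>2) + Y2\<^sup>2 * (c2\<^sup>2 + s2\<^sup>2) + Y3\<^sup>2 * (c3\<^sup>2 + s3\<^sup>2) + Y4\<^sup>2 * (c4\<^sup>2 + s4\<^sup>2) + Y5\<^sup>2 * (c5\<^sup>2 + s5\<^sup>2)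
    + 2 * (Y1 * Y2 * (c1 * c2 + s1 * s2)) + 2 * (Y1 * Y3 * (c1 * c3 + s1 * s3)) + 2 * (Y1 * Y4 * (c1 * c4 + s1 * s4))
    + 2 * (Y1 * Y5 * (c1 * c5 + s1 * s5)) + 2 * (Y2 * Y3 * (c2 * c3 + s2 * s3)) + 2 * (Y2 * Y4 * (c2 * c4 + s2 * s4))
    + 2 * (Y2 * Y5 * (c2 * c5 + s2 * s5)) + 2 * (Y3 * Y4 * (c3 * c4 + s3 * s4)) + 2 * (Y3 * Y5 * (c3 * c5 + s3 * s5))
    + 2 * (Y4 * Y5 * (c4 * c5 + s4 * s5))"
  by (simp add: power2_eq_square algebra_simps)

text \<open>The 5-cycle is cut open to the path 1, 2, 3, 4, 5 and laid out in the plane with the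
  third vector at (1, 0). Pairs at most two steps apart along the path get the right inner products;
  the last summand corrects the pairs (1,4), (2,5) and (1,5).\<close>

lemma cos_form_decomp:
  fixes a b c d e Y1 Y2 Y3 Y4 Y5 :: real
  shows "Y1\<^sup>2 + Y2\<^sup>2 + Y3\<^sup>2 + Y4\<^sup>2 + Y5\<^sup>2 - 2 * cos a * (Y1 * Y2) - 2 * cos b * (Y2 * Y3) - 2 * cos c * (Y3 * Y4)
     - 2 * cos d * (Y4 * Y5) - 2 * cos e * (Y5 * Y1) + 2 * cos (a + b) * (Y1 * Y3) + 2 * cos (b + c) * (Y2 * Y4)
     + 2 * cos (c + d) * (Y3 * Y5) + 2 * cos (d + e) * (Y4 * Y1) + 2 * cos (e + a) * (Y5 * Y2) =
    (Y1 * cos (a + b) + Y2 * - cos b + Y3 * 1 + Y4 * - cos c + Y5 * cos (c + d))\<^sup>2 +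
    (Y1 * - sin (a + b) + Y2 * sin b + Y3 * 0 + Y4 * - sin c + Y5 * sin (c + d))\<^sup>2 +
    2 * ((cos (d + e) + cos (a + b + c)) * (Y1 * Y4) + (cos (e + a) + cos (b + c + d)) * (Y2 * Y5)
      - (cos e + cos (a + b + c + d)) * (Y1 * Y5))"
proof -
  have P: "cos (a + b) * - cos b + - sin (a + b) * sin b = - cos a"
    "cos (a + b) * - cos c + - sin (a + b) * - sin c = - cos (a + b + c)"
    "cos (a + b) * cos (c + d) + - sin (a + b) * sin (c + d) = cos (a + b + c + d)"
    "- cos b * - cos c + sin b * - sin c = cos (b + c)"
    "- cos b * cos (c + d) + sin b * sin (c + d) = - cos (b + c + d)"
    "- cos c * cos (c + d) + - sin c * sin (c + d) = - cos d"
    using cos_diff[of "a + b" b] cos_add[of "a + b" c] cos_add[of "a + b" "c + d"] cos_add[of b c]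
      cos_add[of b "c + d"] cos_diff[of "c + d" c]
    by (simp_all add: add.assoc)
  then show ?thesis
    unfolding sum_squares_plane P by (simp add: algebra_simps)
qed

locale hildebrand =
  fixes d :: "5 \<Rightarrow> real" and \<psi> :: "real^5"
  assumes d_pos: "0 < d i" and psi: "\<psi> \<in> Psi"
begin

definition form :: "real^5 \<Rightarrow> real" where
  "form x = (\<Sum>i\<in>UNIV. \<Sum>j\<in>UNIV. (d i * x $ i) * T \<psi> $ i $ j * (d j * x $ j))"

text \<open>Up to three entries, \<open>T \<psi>\<close> is the Gram matrix of five unit vectors in the plane, read in the order
  \<open>k + 4, k, k + 1, k + 2, k + 3\<close> and each obtained from its predecessor by a rotation through \<open>pi\<close> minus an angle.
  The vector at \<open>k + 1\<close> is \<open>(1, 0)\<close>; \<open>remainder k\<close> accounts for the three exceptional entries.\<close>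

definition plane_cos :: "5 \<Rightarrow> real^5 \<Rightarrow> real" where
  "plane_cos k x = (d (k + 4) * x $ (k + 4)) * cos (\<psi> $ (k + 2) + \<psi> $ (k + 3)) - (d k * x $ k) * cos (\<psi> $ (k + 3))
    + d (k + 1) * x $ (k + 1) - (d (k + 2) * x $ (k + 2)) * cos (\<psi> $ (k + 4))
    + (d (k + 3) * x $ (k + 3)) * cos (\<psi> $ (k + 4) + \<psi> $ k)"

definition plane_sin :: "5 \<Rightarrow> real^5 \<Rightarrow> real" where
  "plane_sin k x = - (d (k + 4) * x $ (k + 4)) * sin (\<psi> $ (k + 2) + \<psi> $ (k + 3)) + (d k * x $ k) * sin (\<psi> $ (k + 3))
    - (d (k + 2) * x $ (k + 2)) * sin (\<psi> $ (k + 4)) + (d (k + 3) * x $ (k + 3)) * sin (\<psi> $ (k + 4) + \<psi> $ k)"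

definition gA :: "5 \<Rightarrow> real" where
  "gA k = cos (\<psi> $ k + \<psi> $ (k + 1)) + cos (\<psi> $ (k + 2) + \<psi> $ (k + 3) + \<psi> $ (k + 4))"

definition gB :: "5 \<Rightarrow> real" where
  "gB k = cos (\<psi> $ (k + 1) + \<psi> $ (k + 2)) + cos (\<psi> $ (k + 3) + \<psi> $ (k + 4) + \<psi> $ k)"

text \<open>Also positive for these angles, but it enters \<open>remainder\<close> with a minus
  sign: nonnegativity of the form cannot be read off from a single decomposition.\<close>

definition gC :: "5 \<Rightarrow> real" where
  "gC k = cos (\<psi> $ (k + 1)) + cos (\<psi> $ (k + 2) + \<psi> $ (k + 3) + \<psi> $ (k + 4) + \<psi> $ k)"

definition remainder :: "5 \<Rightarrow> real^5 \<Rightarrow> real" where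
  "remainder k x = gA k * ((d (k + 4) * x $ (k + 4)) * (d (k + 2) * x $ (k + 2)))
    + gB k * ((d k * x $ k) * (d (k + 3) * x $ (k + 3)))
    - gC k * ((d (k + 4) * x $ (k + 4)) * (d (k + 3) * x $ (k + 3)))"

lemma form_decomp: "form x = (plane_cos k x)\<^sup>2 + (plane_sin k x)\<^sup>2 + 2 * remainder k x"
proof -
  let ?T = "\<lambda>i j. T \<psi> $ (k + i) $ (k + j)"
  have E: "T \<psi> $ k $ k = 1" "?T 1 1 = 1" "?T 2 2 = 1" "?T 3 3 = 1" "?T 4 4 = 1"
    "T \<psi> $ k $ (k + 1) = - cos (\<psi> $ (k + 3))" "T \<psi> $ (k + 1) $ k = - cos (\<psi> $ (k + 3))"
    "?T 1 2 = - cos (\<psi> $ (k + 4))" "?T 2 1 = - cos (\<psi> $ (k + 4))"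
    "?T 2 3 = - cos (\<psi> $ k)" "?T 3 2 = - cos (\<psi> $ k)"
    "?T 3 4 = - cos (\<psi> $ (k + 1))" "?T 4 3 = - cos (\<psi> $ (k + 1))"
    "T \<psi> $ (k + 4) $ k = - cos (\<psi> $ (k + 2))" "T \<psi> $ k $ (k + 4) = - cos (\<psi> $ (k + 2))"
    "T \<psi> $ k $ (k + 2) = cos (\<psi> $ (k + 3) + \<psi> $ (k + 4))" "T \<psi> $ (k + 2) $ k = cos (\<psi> $ (k + 3) + \<psi> $ (k + 4))"
    "?T 1 3 = cos (\<psi> $ (k + 4) + \<psi> $ k)" "?T 3 1 = cos (\<psi> $ (k + 4) + \<psi> $ k)"
    "?T 2 4 = cos (\<psi> $ k + \<psi> $ (k + 1))" "?T 4 2 = cos (\<psi> $ k + \<psi> $ (k + 1))"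
    "T \<psi> $ (k + 3) $ k = cos (\<psi> $ (k + 1) + \<psi> $ (k + 2))" "T \<psi> $ k $ (k + 3) = cos (\<psi> $ (k + 1) + \<psi> $ (k + 2))"
    "?T 4 1 = cos (\<psi> $ (k + 2) + \<psi> $ (k + 3))" "?T 1 4 = cos (\<psi> $ (k + 2) + \<psi> $ (k + 3))"
    using T_entries[of \<psi> k] T_entries[of \<psi> "k + 1"] T_entries[of \<psi> "k + 2"] T_entries[of \<psi> "k + 3"] T_entries[of \<psi> "k + 4"]
    by (simp_all add: add.assoc mod_5)
  show ?thesis
    using cos_form_decomp[of "d (k + 4) * x $ (k + 4)" "d k * x $ k" "d (k + 1) * x $ (k + 1)" "d (k + 2) * x $ (k + 2)"
        "d (k + 3) * x $ (k + 3)" "\<psi> $ (k + 2)" "\<psi> $ (k + 3)" "\<psi> $ (k + 4)" "\<psi> $ k" "\<psi> $ (k + 1)"]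
    unfolding form_def sum_5_shift[of _ k] E plane_cos_def plane_sin_def remainder_def gA_def gB_def gC_def
    by (simp add: power2_eq_square algebra_simps)
qed

lemma psi_pos: "0 < \<psi> $ i"
  using psi by (simp add: Psi_def)

lemma psi_sum: "\<psi> $ k + \<psi> $ (k + 1) + \<psi> $ (k + 2) + \<psi> $ (k + 3) + \<psi> $ (k + 4) < pi"
  using psi sum_5_shift[of "\<lambda>i. \<psi> $ i" k] by (simp add: Psi_def)

end

section \<open>Trigonometric inequalities\<close>

lemma cos_add_cos_pos:
  fixes a b :: real
  assumes "0 < a" "0 < b" "a + b < pi" shows "0 < cos a + cos b"
proof -
  have "cos (pi - b) < cos a" using assms by (intro cos_monotone_0_pi) auto
  then show ?thesis by simp
qed

text \<open>In each pair of cosines the arguments add up to the total S, so all pairs share the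
  positive factor 2 cos (S/2). Without it, sum-to-product formulas reduce the claim to the cosine
  being at least as large at (a + b - c - d)/2 as at (a + b + c + d)/2; strictness comes from cos
  (S/2) > 0.\<close>

lemma cos_certificate:
  fixes a b c d e :: real
  assumes pos: "0 < a" "0 < b" "0 < c" "0 < d" "0 < e" and sum: "a + b + c + d + e < pi"
  shows "cos e + cos (a + b + c + d) < (cos (a + b) + cos (c + d + e)) + (cos (c + d) + cos (e + a + b))"
proof -
  define S where "S = a + b + c + d + e"
  have two: "cos X + cos Z = 2 * cos (S / 2) * cos (X - S / 2)" if "Z = S - X" for X Z
  proof -
    have 1: "(X + Z) / 2 = S / 2" "(X - Z) / 2 = X - S / 2" using that by (simp_all add: field_simps)
    show ?thesis unfolding cos_plus_cos 1 by simp
  qed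
  have S: "0 < cos (S / 2)" using pos sum by (intro cos_gt_zero) (auto simp: S_def)
  have "cos (e / 2) * cos ((a + b + c + d) / 2) \<le> cos (e / 2) * cos ((a + b - c - d) / 2)"
  proof (rule mult_left_mono)
    have "cos ((a + b + c + d) / 2) \<le> cos \<bar>(a + b - c - d) / 2\<bar>"
      using pos sum by (intro cos_monotone_0_pi_le) auto
    then show "cos ((a + b + c + d) / 2) \<le> cos ((a + b - c - d) / 2)" by (simp only: cos_abs_real)
    show "0 \<le> cos (e / 2)" using pos sum by (intro cos_ge_zero) auto
  qed
  moreover have "cos (a + b - S / 2) + cos (c + d - S / 2) = 2 * (cos (e / 2) * cos ((a + b - c - d) / 2))"
  proof -
    have 1: "(a + b - S / 2 + (c + d - S / 2)) / 2 = - (e / 2)" "(a + b - S / 2 - (c + d - S / 2)) / 2 = (a + b - c - d) / 2"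
      by (simp_all add: S_def field_simps)
    show ?thesis unfolding cos_plus_cos 1 by simp
  qed
  moreover have "cos (S / 2) + cos (e - S / 2) = 2 * (cos (e / 2) * cos ((a + b + c + d) / 2))"
  proof -
    have 1: "(S / 2 + (e - S / 2)) / 2 = e / 2" "(S / 2 - (e - S / 2)) / 2 = (a + b + c + d) / 2"
      by (simp_all add: S_def field_simps)
    show ?thesis unfolding cos_plus_cos 1 by simp
  qed
  ultimately have "cos (e - S / 2) < cos (a + b - S / 2) + cos (c + d - S / 2)" using S by linarith
  then have "2 * cos (S / 2) * cos (e - S / 2) < 2 * cos (S / 2) * (cos (a + b - S / 2) + cos (c + d - S / 2))"
    using S by simp
  then show ?thesis
    using two[of "a + b + c + d" e] two[of "c + d + e" "a + b"] two[of "e + a + b" "c + d"]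
    by (simp add: S_def distrib_left)
qed

context hildebrand begin

lemma gA_pos: "0 < gA k" and gB_pos: "0 < gB k"
  unfolding gA_def gB_def
  using psi_sum[of k] psi_pos[of k] psi_pos[of "k + 1"] psi_pos[of "k + 2"] psi_pos[of "k + 3"] psi_pos[of "k + 4"]
  by (intro cos_add_cos_pos; linarith)+

lemma sin_psi_pos: "0 < sin (\<psi> $ i)"
  using psi_sum[of i] psi_pos[of i] psi_pos[of "i + 1"] psi_pos[of "i + 2"] psi_pos[of "i + 3"] psi_pos[of "i + 4"]
  by (intro sin_gt_zero; linarith)

lemma sin_psi2_pos: "0 < sin (\<psi> $ i + \<psi> $ (i + 1))"
  using psi_sum[of i] psi_pos[of i] psi_pos[of "i + 1"] psi_pos[of "i + 2"] psi_pos[of "i + 3"] psi_pos[of "i + 4"]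
  by (intro sin_gt_zero; linarith)

text \<open>The difference is the net coefficient of y (k+1) y (k+3) y (k+4) in
  \<open>remainder_sum\<close>: the gains from decompositions k + 2 and k + 3 outweigh the loss from
  decomposition k.\<close>

lemma certificate_pos: "gC k < gA (k + 2) + gB (k + 3)"
proof -
  have A: "gA (k + 2) = cos (\<psi> $ (k + 2) + \<psi> $ (k + 3)) + cos (\<psi> $ (k + 4) + \<psi> $ k + \<psi> $ (k + 1))"
    by (simp add: gA_def add.assoc mod_5)
  have B: "gB (k + 3) = cos (\<psi> $ (k + 4) + \<psi> $ k) + cos (\<psi> $ (k + 1) + \<psi> $ (k + 2) + \<psi> $ (k + 3))"
    by (simp add: gB_def add.assoc mod_5)
  show ?thesis
    using cos_certificate[of "\<psi> $ (k + 2)" "\<psi> $ (k + 3)" "\<psi> $ (k + 4)" "\<psi> $ k" "\<psi> $ (k + 1)"] psi_sum[of k]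
    unfolding A B gC_def by (simp add: psi_pos add_ac)
qed

text \<open>The vector spans the kernel of the positive semidefinite principal submatrix on \<open>k, k + 1, k + 2\<close>.\<close>

definition zero_vec :: "5 \<Rightarrow> real^5" where
  "zero_vec k = (\<chi> i. if i = k then sin (\<psi> $ (k + 4)) / d k
     else if i = k + 1 then sin (\<psi> $ (k + 3) + \<psi> $ (k + 4)) / d (k + 1)
     else if i = k + 2 then sin (\<psi> $ (k + 3)) / d (k + 2) else 0)"

lemma zero_vec_nth [simp]:
  "zero_vec k $ k = sin (\<psi> $ (k + 4)) / d k"
  "zero_vec k $ (k + 1) = sin (\<psi> $ (k + 3) + \<psi> $ (k + 4)) / d (k + 1)"
  "zero_vec k $ (k + 2) = sin (\<psi> $ (k + 3)) / d (k + 2)"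
  "zero_vec k $ (k + 3) = 0" "zero_vec k $ (k + 4) = 0"
  by (simp_all add: zero_vec_def)

lemma zero_vec_pos: "0 < zero_vec k $ k" "0 < zero_vec k $ (k + 1)" "0 < zero_vec k $ (k + 2)"
  using sin_psi_pos[of "k + 4"] sin_psi2_pos[of "k + 3"] sin_psi_pos[of "k + 3"] d_pos
  by (simp_all add: add.assoc)

definition mass :: "5 \<Rightarrow> real" where
  "mass k = (\<Sum>i\<in>UNIV. zero_vec k $ i)"

lemma mass_pos: "0 < mass k"
  using zero_vec_pos[of k] unfolding mass_def sum_5_shift[of _ k] zero_vec_nth(4,5) by linarith

definition zero :: "5 \<Rightarrow> real^5" where
  "zero k = (1 / mass k) *\<^sub>R zero_vec k"

lemma zero_nth_pos: "0 < zero k $ k" "0 < zero k $ (k + 1)" "0 < zero k $ (k + 2)"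
  unfolding zero_def using zero_vec_pos[of k] mass_pos[of k] by (simp_all del: zero_vec_nth)

lemma zero_nth_0: "zero k $ (k + 3) = 0" "zero k $ (k + 4) = 0"
  by (simp_all add: zero_def)

lemma zero_simplex: "zero k \<in> std_simplex"
proof -
  have "0 \<le> zero k $ i" for i
    by (rule exhaust_5_shift[of i k]) (use zero_nth_pos[of k] zero_nth_0[of k] in auto)
  moreover have "(\<Sum>i\<in>UNIV. zero k $ i) = 1"
    using mass_pos[of k] by (simp add: zero_def mass_def flip: sum_divide_distrib)
  ultimately show ?thesis by (simp add: std_simplex_def hyperplane1_def)
qed

lemma inj_zero: "inj zero"
proof
  fix k l assume eq: "zero k = zero l"
  show "k = l"
  proof (rule exhaust_5_shift[of l k])
    assume "l = k + 1"
    then show ?thesis using eq zero_nth_pos(3)[of l] zero_nth_0(1)[of k] by (simp add: add.assoc)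
  next
    assume "l = k + 2"
    then show ?thesis using eq zero_nth_pos(3)[of l] zero_nth_0(2)[of k] by (simp add: add.assoc)
  next
    assume "l = k + 3"
    then show ?thesis using eq zero_nth_pos(1)[of l] zero_nth_0(1)[of k] by simp
  next
    assume "l = k + 4"
    then show ?thesis using eq zero_nth_pos(1)[of l] zero_nth_0(2)[of k] by simp
  qed simp
qed

section \<open>Charts at the five zeros\<close>

lemma linear_plane: "linear (plane_cos k)" "linear (plane_sin k)"
  by (rule linearI; simp add: plane_cos_def plane_sin_def algebra_simps)+

lemma plane_zero: "plane_cos k (zero k) = 0" "plane_sin k (zero k) = 0"
proof -
  have "plane_cos k (zero_vec k) = 0" "plane_sin k (zero_vec k) = 0"
    using d_pos[THEN less_imp_neq, symmetric]
    by (simp_all add: plane_cos_def plane_sin_def sin_add)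
  then show "plane_cos k (zero k) = 0" "plane_sin k (zero k) = 0"
    by (simp_all add: zero_def linear_scale[OF linear_plane(1)] linear_scale[OF linear_plane(2)])
qed

text \<open>With the last two coordinates zero, the plane equations leave only multiples of
  \<open>zero_vec k\<close>, whose coordinate sum is positive. This gives the chart at
  \<open>zero k\<close>, and in \<open>form_pos\<close> it recognises a point as
  \<open>zero k\<close>.\<close>

lemma plane_kernel:
  assumes c: "plane_cos k x = 0" and s: "plane_sin k x = 0" and x: "x $ (k + 3) = 0" "x $ (k + 4) = 0"
    and sum: "(\<Sum>i\<in>UNIV. x $ i) = 0"
  shows "x = 0"
proof -
  let ?b = "\<psi> $ (k + 3)" and ?c = "\<psi> $ (k + 4)"
  have sb: "0 < sin ?b" by (rule sin_psi_pos)
  define t where "t = d (k + 2) * x $ (k + 2) / sin ?b"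
  have Y4: "d (k + 2) * x $ (k + 2) = t * sin ?b" using sb by (simp add: t_def)
  have "d k * x $ k * sin ?b = d (k + 2) * x $ (k + 2) * sin ?c" using s x by (simp add: plane_sin_def)
  then have Y2: "d k * x $ k = t * sin ?c" using sb by (simp add: Y4)
  have "d (k + 1) * x $ (k + 1) = d k * x $ k * cos ?b + d (k + 2) * x $ (k + 2) * cos ?c"
    using c x by (simp add: plane_cos_def)
  then have Y3: "d (k + 1) * x $ (k + 1) = t * sin (?b + ?c)"
    unfolding Y2 Y4 by (simp add: sin_add algebra_simps)
  have div: "u = t * (w / d i)" if "d i * u = t * w" for u w i
    using that d_pos[of i] by (simp add: field_simps)
  have "x $ i = t * zero_vec k $ i" for i
    by (rule exhaust_5_shift[of i k]) (use div[OF Y2] div[OF Y3] div[OF Y4] x in simp_all)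
  then have xt: "x = t *\<^sub>R zero_vec k" by (simp add: vec_eq_iff)
  then have "t * mass k = 0" using sum by (simp add: mass_def sum_distrib_left)
  then show ?thesis using xt mass_pos[of k] by simp
qed

text \<open>The index j is only a label: slots k and k + 2 hold the planar functions, k + 3 and k +
  4 the boundary coordinates, and k + 1 is left to the coordinate sum.\<close>

definition zero_coord :: "5 \<Rightarrow> 5 \<Rightarrow> real^5 \<Rightarrow> real" where
  "zero_coord k j = (if j = k then plane_cos k else if j = k + 2 then plane_sin k else (\<lambda>x. x $ j))"

lemma zero_chart: "chart (zero k) (UNIV - {k + 1}) (zero_coord k)"
proof (rule chart_linear[OF zero_simplex])
  fix j assume j: "j \<noteq> k + 1"
  show "linear (zero_coord k j)"
    using linear_plane[of k] linearI[of "\<lambda>x::real^5. x $ j"] by (simp add: zero_coord_def)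
  show "zero_coord k j (zero k) = 0"
    by (rule exhaust_5_shift[of j k]) (use j plane_zero[of k] zero_nth_0[of k] in \<open>auto simp: zero_coord_def\<close>)
next
  fix x assume sum: "(\<Sum>i\<in>UNIV. x $ i) = 0" and z: "\<And>j. j \<noteq> k + 1 \<Longrightarrow> zero_coord k j x = 0"
  show "x = 0"
    by (rule plane_kernel[of k]) (use sum z[of k] z[of "k + 2"] z[of "k + 3"] z[of "k + 4"] in \<open>simp_all add: zero_coord_def\<close>)
qed

text \<open>The remainder sorted by its boundary factors. The negative product is put into the
  coefficient at k + 4, where it vanishes at \<open>zero k\<close>.\<close>

definition boundary_coeff :: "5 \<Rightarrow> 5 \<Rightarrow> real^5 \<Rightarrow> real" where
  "boundary_coeff k j x = (if j = k + 4
     then 2 * d (k + 4) * (gA k * (d (k + 2) * x $ (k + 2)) - gC k * (d (k + 3) * x $ (k + 3)))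
     else 2 * d (k + 3) * (gB k * (d k * x $ k)))"

lemma form_boundary_hessian:
  "boundary_hessian form (zero k) (UNIV - {k + 1}) (zero_coord k) {k + 3, k + 4} (boundary_coeff k) id"
  unfolding boundary_hessian_def
proof (intro conjI ballI zero_chart)
  fix j assume j: "j \<in> {k + 3, k + 4}"
  then show "zero_coord k j = (\<lambda>x. x $ id j)" by (auto simp: zero_coord_def)
  show "real_polynomial_function (boundary_coeff k j)"
    unfolding boundary_coeff_def[abs_def] by (cases "j = k + 4"; simp; intro polyf_intros)
  show "0 < boundary_coeff k j (zero k)"
    using zero_nth_pos[of k] zero_nth_0[of k] gA_pos[of k] gB_pos[of k] d_pos by (simp add: boundary_coeff_def)
next
  fix x :: "real^5"
  have "UNIV - {k + 1} - {k + 3, k + 4} = {k, k + 2}"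
    unfolding UNIV_5_shift[of k] by auto
  then show "form x = (\<Sum>j\<in>UNIV - {k + 1} - {k + 3, k + 4}. (zero_coord k j x)\<^sup>2) +
      (\<Sum>j\<in>{k + 3, k + 4}. boundary_coeff k j x * x $ id j)"
    by (simp add: form_decomp[of x k] remainder_def zero_coord_def boundary_coeff_def algebra_simps)
qed auto

text \<open>Shifting the summation index by 2 and by 3 aligns the three families of cubic
  monomials.\<close>

lemma remainder_sum:
  "(\<Sum>k\<in>UNIV. (d (k + 1) * x $ (k + 1)) * remainder k x) =
    (\<Sum>k\<in>UNIV. (gA (k + 2) + gB (k + 3) - gC k) *
      ((d (k + 1) * x $ (k + 1)) * (d (k + 3) * x $ (k + 3)) * (d (k + 4) * x $ (k + 4))))"
proof -
  let ?y = "\<lambda>i. d i * x $ i"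
  have "(\<Sum>k\<in>UNIV. ?y (k + 1) * remainder k x) =
      (\<Sum>k\<in>UNIV. gA k * (?y (k + 4) * ?y (k + 2) * ?y (k + 1))) +
      (\<Sum>k\<in>UNIV. gB k * (?y k * ?y (k + 3) * ?y (k + 1))) -
      (\<Sum>k\<in>UNIV. gC k * (?y (k + 4) * ?y (k + 3) * ?y (k + 1)))"
    unfolding sum.distrib[symmetric] sum_subtractf[symmetric]
    by (intro sum.cong refl) (simp add: remainder_def algebra_simps)
  also have "(\<Sum>k\<in>UNIV. gA k * (?y (k + 4) * ?y (k + 2) * ?y (k + 1))) =
      (\<Sum>k\<in>UNIV. gA (k + 2) * (?y (k + 1) * ?y (k + 4) * ?y (k + 3)))"
    by (subst sum_5_reindex[of _ 2, symmetric]) (simp add: add.assoc mod_5)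
  also have "(\<Sum>k\<in>UNIV. gB k * (?y k * ?y (k + 3) * ?y (k + 1))) =
      (\<Sum>k\<in>UNIV. gB (k + 3) * (?y (k + 3) * ?y (k + 1) * ?y (k + 4)))"
    by (subst sum_5_reindex[of _ 3, symmetric]) (simp add: add.assoc mod_5)
  finally have "(\<Sum>k\<in>UNIV. ?y (k + 1) * remainder k x) =
      (\<Sum>k\<in>UNIV. gA (k + 2) * (?y (k + 1) * ?y (k + 4) * ?y (k + 3)) +
        gB (k + 3) * (?y (k + 3) * ?y (k + 1) * ?y (k + 4)) - gC k * (?y (k + 4) * ?y (k + 3) * ?y (k + 1)))"
    unfolding sum.distrib[symmetric] sum_subtractf[symmetric] .
  also have "\<dots> = (\<Sum>k\<in>UNIV. (gA (k + 2) + gB (k + 3) - gC k) * (?y (k + 1) * ?y (k + 3) * ?y (k + 4)))"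
    by (intro sum.cong refl) (simp add: algebra_simps)
  finally show ?thesis .
qed

text \<open>With \<open>y i = d i * x $ i\<close>, weighting the \<open>k\<close>-th decomposition by \<open>y (k + 1)\<close> writes \<open>(\<Sum>i. y i) * form x\<close> as
  squares times coordinates plus cubic monomials with positive coefficients.\<close>

lemma form_pos:
  assumes x: "x \<in> std_simplex" and nz: "x \<notin> range zero"
  shows "0 < form x"
proof (rule ccontr)
  assume neg: "\<not> 0 < form x"
  define y where "y i = d i * x $ i" for i
  have y0: "0 \<le> y i" for i using x d_pos[of i] by (simp add: std_simplex_def y_def)
  have eta: "0 < gA (k + 2) + gB (k + 3) - gC k" for k using certificate_pos[of k] by simp
  \<comment> \<open>If the form is not positive, the squares force every remainder to be at most 0,
    while the weighted sum of the remainders consists of nonnegative monomials. Hence all terms on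
    both sides vanish.\<close>
  have rem: "remainder k x \<le> 0" for k
    using form_decomp[of x k] neg zero_le_power2[of "plane_cos k x"] zero_le_power2[of "plane_sin k x"] by linarith
  have t0: "0 \<le> (gA (k + 2) + gB (k + 3) - gC k) * (y (k + 1) * y (k + 3) * y (k + 4))" for k
    using eta[of k] by (intro mult_nonneg_nonneg y0) auto
  have r0: "y (k + 1) * remainder k x \<le> 0" for k
    using y0 rem[of k] by (simp add: mult_nonneg_nonpos)
  have rs: "(\<Sum>k\<in>UNIV. y (k + 1) * remainder k x) =
      (\<Sum>k\<in>UNIV. (gA (k + 2) + gB (k + 3) - gC k) * (y (k + 1) * y (k + 3) * y (k + 4)))"
    unfolding y_def by (rule remainder_sum)
  have "(\<Sum>k\<in>UNIV. y (k + 1) * remainder k x) = 0"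
    using sum_nonpos[of UNIV "\<lambda>k. y (k + 1) * remainder k x"] r0
      sum_nonneg[of UNIV "\<lambda>k. (gA (k + 2) + gB (k + 3) - gC k) * (y (k + 1) * y (k + 3) * y (k + 4))"] t0
    unfolding rs by (meson antisym)
  moreover from this have "(\<Sum>k\<in>UNIV. (gA (k + 2) + gB (k + 3) - gC k) * (y (k + 1) * y (k + 3) * y (k + 4))) = 0"
    unfolding rs .
  ultimately have "\<forall>k\<in>UNIV. - (y (k + 1) * remainder k x) = 0"
    "\<forall>k\<in>UNIV. (gA (k + 2) + gB (k + 3) - gC k) * (y (k + 1) * y (k + 3) * y (k + 4)) = 0"
    using sum_nonneg_eq_0_iff[of UNIV "\<lambda>k. - (y (k + 1) * remainder k x)"] r0
      sum_nonneg_eq_0_iff[of UNIV "\<lambda>k. (gA (k + 2) + gB (k + 3) - gC k) * (y (k + 1) * y (k + 3) * y (k + 4))"] t0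
    by (simp_all add: sum_negf)
  then have rz: "y (k + 1) * remainder k x = 0" and M: "y (k + 1) * y (k + 3) * y (k + 4) = 0" for k
    using eta[of k] by (auto dest!: spec[of _ k])
  have plane: "plane_cos k x = 0" "plane_sin k x = 0" if "0 < y (k + 1)" for k
  proof -
    have "remainder k x = 0" using rz[of k] that by simp
    then have "(plane_cos k x)\<^sup>2 + (plane_sin k x)\<^sup>2 \<le> 0" using form_decomp[of x k] neg by simp
    then show "plane_cos k x = 0" "plane_sin k x = 0" by (simp_all add: sum_power2_le_zero_iff)
  qed
  have no: "\<not> (0 < y (k + 1) \<and> y (k + 3) = 0 \<and> y (k + 4) = 0)" for k
  proof
    assume h: "0 < y (k + 1) \<and> y (k + 3) = 0 \<and> y (k + 4) = 0"
    have "x - zero k = 0"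
    proof (rule plane_kernel[of k])
      show "plane_cos k (x - zero k) = 0" "plane_sin k (x - zero k) = 0"
        using plane[of k] h plane_zero[of k] by (simp_all add: linear_diff[OF linear_plane(1)] linear_diff[OF linear_plane(2)])
      show "(x - zero k) $ (k + 3) = 0" "(x - zero k) $ (k + 4) = 0"
        using h zero_nth_0[of k] d_pos[of "k + 3"] d_pos[of "k + 4"] by (auto simp: y_def)
      show "(\<Sum>i\<in>UNIV. (x - zero k) $ i) = 0"
        using x zero_simplex[of k] by (simp add: std_simplex_def hyperplane1_def sum_subtractf)
    qed
    then show False using nz by auto
  qed
  have "\<exists>i. 0 < y i"
  proof (rule ccontr)
    assume "\<not> ?thesis"
    then have "x $ i = 0" for i using y0[of i] d_pos[of i] by (metis less_eq_real_def less_irrefl mult_eq_0_iff y_def)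
    then show False using x by (simp add: std_simplex_def hyperplane1_def)
  qed
  then obtain i where "0 < y i" by blast
  then obtain k where k: "0 < y (k + 1)" by (metis diff_add_cancel)
  have M1: "y (k + 3) = 0 \<or> y (k + 4) = 0" using M[of k] k by auto
  have M2: "y (k + 2) = 0 \<or> y (k + 4) = 0" using M[of "k + 3"] k by (auto simp: add.assoc mod_5)
  have M3: "y k = 0 \<or> y (k + 3) = 0" using M[of "k + 2"] k by (auto simp: add.assoc mod_5)
  let ?a = "\<psi> $ (k + 2)" and ?b = "\<psi> $ (k + 3)" and ?c = "\<psi> $ (k + 4)" and ?d = "\<psi> $ k"
  \<comment> \<open>The sine equation balances the coordinates on the two sides of the vector at k +
    1. Given the vanishing pattern, a positive y (k+4) forces a positive y k, and a positive y (k+3)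
    forces a positive y (k+2); either way \<open>no\<close> applies to a neighbouring index.\<close>
  have s: "y (k + 4) * sin (?a + ?b) + y (k + 2) * sin ?c = y k * sin ?b + y (k + 3) * sin (?c + ?d)"
    using plane(2)[OF k] by (simp add: plane_sin_def y_def)
  have sins: "0 < sin (?a + ?b)" "0 < sin ?b" "0 < sin ?c" "0 < sin (?c + ?d)"
    using sin_psi_pos[of "k + 3"] sin_psi_pos[of "k + 4"] sin_psi2_pos[of "k + 2"] sin_psi2_pos[of "k + 4"]
    by (simp_all add: add.assoc mod_5)
  show False
  proof (cases "y (k + 4) = 0")
    case False
    then have 0: "0 < y (k + 4)" using y0[of "k + 4"] by linarith
    have 1: "y (k + 3) = 0" "y (k + 2) = 0" using M1 M2 False by auto
    have "0 < y (k + 4) * sin (?a + ?b)" using 0 sins by simp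
    then have "0 < y k * sin ?b" using s 1 by simp
    then have "0 < y k" using sins by (simp add: zero_less_mult_iff)
    then show False using no[of "k + 4"] 1 by (simp add: add.assoc mod_5)
  next
    case True
    show False
    proof (cases "y (k + 3) = 0")
      case False
      then have 0: "0 < y (k + 3)" using y0[of "k + 3"] by linarith
      have 1: "y k = 0" using M3 False by auto
      have "0 < y (k + 3) * sin (?c + ?d)" using 0 sins by simp
      then have "0 < y (k + 2) * sin ?c" using s 1 True by simp
      then have "0 < y (k + 2)" using sins by (simp add: zero_less_mult_iff)
      then show False using no[of "k + 1"] 1 True by (simp add: add.assoc mod_5)
    next
      case b: True
      then show False using no[of k] k True by simp
    qed
  qed
qed

lemma form_QM: "form \<in> QM"
proof (rule finite_zeros_imp_QM[where K = UNIV])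
  show "real_polynomial_function form" unfolding form_def[abs_def] by (intro polyf_intros) auto
  show "boundary_hessian form (zero k) (UNIV - {k + 1}) (zero_coord k) {k + 3, k + 4} (boundary_coeff k) id" for k
    by (rule form_boundary_hessian)
  show "0 < form x" if "x \<in> std_simplex" "x \<notin> zero ` UNIV" for x using form_pos that by simp
qed (auto intro: inj_zero)

end

theorem theorem2p3:
  fixes D :: "real^5^5"
  assumes diag: "\<And>i j. i \<noteq> j \<Longrightarrow> D $ i $ j = 0"
    and pos: "\<And>i. D $ i $ i > 0"
  shows "(\<forall>\<psi>\<in>Psi. D ** T \<psi> ** D \<in> (\<Union>r. LAS r)) \<and>
         (\<Union>r. LAS r :: (real^5^5) set) \<subseteq> (\<Union>r. K_cone r)"
proof (intro conjI ballI)
  fix \<psi> :: "real^5" assume psi: "\<psi> \<in> Psi"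
  interpret hildebrand "\<lambda>i. D $ i $ i" \<psi> by unfold_locales (use pos psi in auto)
  have entry: "(D ** T \<psi> ** D) $ i $ j = D $ i $ i * T \<psi> $ i $ j * D $ j $ j" for i j
  proof -
    have l: "(D ** A) $ i $ j = D $ i $ i * A $ i $ j" for A :: "real^5^5" and i j
      unfolding matrix_matrix_mult_def
      by (simp, subst sum.mono_neutral_right[of _ "{i}"]) (use diag in auto)
    have r: "(A ** D) $ i $ j = A $ i $ j * D $ j $ j" for A :: "real^5^5" and i j
      unfolding matrix_matrix_mult_def
      by (simp, subst sum.mono_neutral_right[of _ "{j}"]) (use diag in auto)
    show ?thesis by (simp add: l r)
  qed
  have symT: "T \<psi> $ i $ j = T \<psi> $ j $ i" for i j
  proof (rule exhaust_5_shift[of j i])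
    assume "j = i + 3" then show ?thesis using T_entries(4,5)[of \<psi> j] by (simp add: add.assoc mod_5)
  next
    assume "j = i + 4" then show ?thesis using T_entries(2,3)[of \<psi> j] by (simp add: add.assoc mod_5)
  qed (simp_all add: T_entries)
  show "D ** T \<psi> ** D \<in> (\<Union>r. LAS r)"
  proof (rule QM_imp_LAS)
    show "transpose (D ** T \<psi> ** D) = D ** T \<psi> ** D"
      by (simp add: transpose_def vec_eq_iff entry symT[of _ "_"] mult_ac)
    show "(\<lambda>x. \<Sum>i\<in>UNIV. \<Sum>j\<in>UNIV. x $ i * (D ** T \<psi> ** D) $ i $ j * x $ j) \<in> QM"
      using form_QM unfolding form_def[abs_def] entry by (simp add: mult_ac)
  qed
next
  show "(\<Union>r. LAS r :: (real^5^5) set) \<subseteq> (\<Union>r. K_cone r)"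
    using LAS_subset_K_cone by blast
qed

end
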